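(* Let $d\le 2$ and consider a random walk in random environment on $\mathbb{Z}^d$ as described in the context (bistochastic, of finite range, with zero local drift, ergodic, and almost surely irreducible). Then it is almost surely recurrent: for $\Pi$-a.e. $\omega\in\Omega$, the random walk $\{X_n\}_{n\in\mathbb{N}}$ with law $P_\omega$ satisfies, with $P_\omega$-probability $1$, $X_{n_j}=0$ for all $j$ along some (realization-dependent) subsequence $\{n_j\}_{j\in\mathbb{N}}$ with $n_j\to\infty$.
   Context: Random environment. Let $d\ge 1$ and let $(\Omega,\Pi)$ be a probability space acted upon by a group $\{\tau_z\}_{z\in\mathbb{Z}^d}$ of $\Pi$-preserving automorphisms (a measure-preserving action of $\mathbb{Z}^d$), and assume the action is ergodic. To each $\omega\in\Omega$ there corresponds (measurably) a matrix $p(\omega)=\{p_{xy}(\omega)\}_{x,y\in\mathbb{Z}^d}$ of nonnegative numbers such that: (i) (bistochasticity) $\sum_{y\in\mathbb{Z}^d}p_{xy}=1$ for all $x\in\mathbb{Z}^d$, and $\sum_{x\in\mathbb{Z}^d}p_{xy}=1$ for all $y\in\mathbb{Z}^d$; (ii) (finite range) there is a finite set $\Lambda\subset\mathbb{Z}^d$ (independent of $\omega$) with $p_{xy}=0$ whenever $y-x\notin\Lambda$; (iii) (zero local drift) $\sum_{y\in\mathbb{Z}^d}(y-x)\,p_{xy}=0$ for all $x\in\mathbb{Z}^d$; (iv) (covariance) $p_{xy}(\tau_z\omega)=p_{x+z,y+z}(\omega)$ for all $x,y,z\in\mathbb{Z}^d$; (v) (almost sure irreducibility) for $\Pi$-a.e.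 $\omega$ and every $y\in\mathbb{Z}^d$ there exists $n=n(\omega,y)$ such that $p^{(n)}_{0y}:=\sum_{x_1,\ldots,x_{n-1}}p_{0x_1}p_{x_1x_2}\cdots p_{x_{n-1}y}>0$. For fixed $\omega\in\Omega$, the random walk in the environment $\omega$ is the Markov chain $\{X_n\}_{n\in\mathbb{N}}$ on $\mathbb{Z}^d$ with law $P_\omega$ determined by $P_\omega(X_0=0)=1$ and $P_\omega(X_{n+1}=y\mid X_n=x)=p_{xy}(\omega)$. *)

theory Defs
  imports "HOL-Probability.Probability"
begin

text \<open>
  The lattice \<open>\<int>\<^sup>d\<close> is the type \<open>int ^ 'd\<close> with \<open>d = CARD('d)\<close>; a matrix indexed by the lattice is a
  function \<open>int ^ 'd \<Rightarrow> int ^ 'd \<Rightarrow> real\<close>.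
\<close>

definition real_vec :: "int ^ 'd::finite \<Rightarrow> real ^ 'd"
  where "real_vec v = (\<chi> i. real_of_int (v $ i))"


subsection \<open>Ergodic actions of the lattice\<close>

locale lattice_action = prob_space M
  for M :: "'w measure" +
  fixes \<tau> :: "int ^ 'd::finite \<Rightarrow> 'w \<Rightarrow> 'w"
  assumes measurable_action: "\<And>z. \<tau> z \<in> M \<rightarrow>\<^sub>M M"
    and action_preserves: "\<And>z. distr M M (\<tau> z) = M"
    and action_zero: "\<And>\<omega>. \<omega> \<in> space M \<Longrightarrow> \<tau> 0 \<omega> = \<omega>"
    and action_add: "\<And>z w \<omega>. \<omega> \<in> space M \<Longrightarrow> \<tau> (z + w) \<omega> = \<tau> z (\<tau> w \<omega>)"

locale ergodic_lattice_action = lattice_action +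
  assumes ergodic:
    "\<And>A. A \<in> sets M \<Longrightarrow> (\<And>z. \<tau> z -` A \<inter> space M = A) \<Longrightarrow> prob A = 0 \<or> prob A = 1"


subsection \<open>Random environments\<close>

text \<open>
  The sum runs over all paths \<open>x = u 0, u 1, \<dots>, u n = y\<close>, i.e. over the intermediate points
  \<open>u 1, \<dots>, u (n - 1)\<close>.
\<close>

definition transition_prob ::
  "(int ^ 'd::finite \<Rightarrow> int ^ 'd \<Rightarrow> real) \<Rightarrow> nat \<Rightarrow> int ^ 'd \<Rightarrow> int ^ 'd \<Rightarrow> real"
  where "transition_prob p n x y =
    (\<Sum>\<^sub>\<infinity>u\<in>{u \<in> {..n} \<rightarrow>\<^sub>E UNIV. u 0 = x \<and> u n = y}. \<Prod>k<n. p (u k) (u (Suc k)))"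

text \<open>In \<open>irreducible\<close>, \<open>n \<ge> 1\<close> excludes the empty path, which would make the case \<open>y = 0\<close> void.\<close>

locale random_environment = ergodic_lattice_action M \<tau>
  for M :: "'w measure" and \<tau> :: "int ^ 'd::finite \<Rightarrow> 'w \<Rightarrow> 'w" +
  fixes p :: "'w \<Rightarrow> int ^ 'd \<Rightarrow> int ^ 'd \<Rightarrow> real"
  assumes measurable_env: "\<And>x y. (\<lambda>\<omega>. p \<omega> x y) \<in> borel_measurable M"
    and nonneg: "\<And>\<omega> x y. \<omega> \<in> space M \<Longrightarrow> 0 \<le> p \<omega> x y"
    and row_sum: "\<And>\<omega> x. \<omega> \<in> space M \<Longrightarrow> ((\<lambda>y. p \<omega> x y) has_sum 1) UNIV"
    and column_sum: "\<And>\<omega> y. \<omega> \<in> space M \<Longrightarrow> ((\<lambda>x. p \<omega> x y) has_sum 1) UNIV"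
    and finite_range:
      "\<exists>\<Lambda>. finite \<Lambda> \<and> (\<forall>\<omega>\<in>space M. \<forall>x y. y - x \<notin> \<Lambda> \<longrightarrow> p \<omega> x y = 0)"
    and zero_drift:
      "\<And>\<omega> x. \<omega> \<in> space M \<Longrightarrow> ((\<lambda>y. p \<omega> x y *\<^sub>R real_vec (y - x)) has_sum 0) UNIV"
    and covariance: "\<And>\<omega> x y z. \<omega> \<in> space M \<Longrightarrow> p (\<tau> z \<omega>) x y = p \<omega> (x + z) (y + z)"
    and irreducible: "AE \<omega> in M. \<forall>y. \<exists>n\<ge>1. transition_prob (p \<omega>) n 0 y > 0"


subsection \<open>The law of the walk in a fixed environment\<close>

text \<open>
  The law of the Markov chain started at \<open>0\<close> with transition matrix \<open>p\<close>, on the space of trajectories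
  \<open>nat \<Rightarrow> int ^ 'd\<close>, is obtained from the Ionescu-Tulcea theorem.  The kernel gives the law of \<open>X n\<close>
  given \<open>X 0, \<dots>, X (n - 1)\<close>.  For a matrix that is not stochastic the result is a probability measure
  without significance; for a stochastic one it is characterised by \<open>walk_law_start\<close> and
  \<open>walk_law_step\<close> below.
\<close>

definition walk_kernel ::
  "(int ^ 'd::finite \<Rightarrow> int ^ 'd \<Rightarrow> real) \<Rightarrow> nat \<Rightarrow> (nat \<Rightarrow> int ^ 'd) \<Rightarrow> (int ^ 'd) measure"
  where "walk_kernel p n X =
    measure_pmf (case n of 0 \<Rightarrow> return_pmf 0 | Suc m \<Rightarrow> embed_pmf (p (X m)))"

lemma Ionescu_Tulcea_walk_kernel:
  fixes p :: "int ^ 'd::finite \<Rightarrow> int ^ 'd \<Rightarrow> real"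
  shows "Ionescu_Tulcea (walk_kernel p) (\<lambda>_. count_space UNIV)"
  unfolding Ionescu_Tulcea_def
proof (intro conjI allI impI)
  fix i :: nat
  show "walk_kernel p i \<in> PiM {0..<i} (\<lambda>_. count_space UNIV) \<rightarrow>\<^sub>M subprob_algebra (count_space UNIV)"
  proof (cases i)
    case 0
    then show ?thesis
      by (simp add: walk_kernel_def[abs_def] measure_pmf_in_subprob_algebra)
  next
    case (Suc m)
    have "(\<lambda>X. X m) \<in> PiM {0..<i} (\<lambda>_. count_space UNIV) \<rightarrow>\<^sub>M count_space UNIV"
      by (rule measurable_component_singleton) (simp add: Suc)
    moreover have "(\<lambda>x. measure_pmf (embed_pmf (p x))) \<in> count_space UNIV \<rightarrow>\<^sub>M subprob_algebra (count_space UNIV)"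
      by (simp add: measure_pmf_in_subprob_algebra)
    ultimately show ?thesis
      unfolding walk_kernel_def[abs_def] Suc nat.case by (rule measurable_compose)
  qed
next
  fix i and X :: "nat \<Rightarrow> int ^ 'd"
  show "prob_space (walk_kernel p i X)"
    by (simp add: walk_kernel_def prob_space_measure_pmf)
qed

definition walk_law :: "(int ^ 'd::finite \<Rightarrow> int ^ 'd \<Rightarrow> real) \<Rightarrow> (nat \<Rightarrow> int ^ 'd) measure"
  where "walk_law p =
    projective_family.lim UNIV
      (Ionescu_Tulcea.CI (walk_kernel p) (\<lambda>_. count_space UNIV)) (\<lambda>_. count_space UNIV)"

context
  fixes p :: "int ^ 'd::finite \<Rightarrow> int ^ 'd \<Rightarrow> real"
begin

interpretation IT: Ionescu_Tulcea "walk_kernel p" "\<lambda>_. count_space UNIV"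
  by (rule Ionescu_Tulcea_walk_kernel)

lemma walk_law_eq: "walk_law p = IT.PF.lim"
  by (simp add: walk_law_def)

lemma sets_walk_law: "sets (walk_law p) = sets (PiM UNIV (\<lambda>_. count_space UNIV))"
  by (simp add: walk_law_eq)

lemma space_walk_law: "space (walk_law p) = UNIV"
  using sets_eq_imp_space_eq[OF sets_walk_law] by (simp add: space_PiM)

lemma sets_singleton:
  "{restrict x {0..<n}} \<in> sets (PiM {0..<n} (\<lambda>_. count_space UNIV))" for n :: nat
proof -
  have "PiE {0..<n} (\<lambda>k. {x k}) = {restrict x {0..<n}}"
    using PiE_singleton[of "restrict x {0..<n}" "{0..<n}"]
    by (metis (mono_tags, lifting) PiE_cong restrict_apply' restrict_extensional)
  moreover have "PiE {0..<n} (\<lambda>k. {x k}) \<in> sets (PiM {0..<n} (\<lambda>_. count_space UNIV))"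
    by (rule sets_PiM_I_finite) auto
  ultimately show ?thesis
    by simp
qed

lemma emeasure_walk_law_cylinder:
  "emeasure (walk_law p) {X. \<forall>k<n. X k = x k} =
   emeasure (IT.C 0 n (\<lambda>_. undefined)) {restrict x {0..<n}}"
proof -
  note S = sets_singleton[of x n]
  have "{X. \<forall>k<n. X k = x k} = IT.PF.emb UNIV {0..<n} {restrict x {0..<n}}"
    by (auto simp: prod_emb_def fun_eq_iff restrict_def) metis
  then have "emeasure (walk_law p) {X. \<forall>k<n. X k = x k} = emeasure (IT.CI {0..<n}) {restrict x {0..<n}}"
    by (simp add: walk_law_eq IT.lim[OF _ S])
  also have "\<dots> = emeasure (IT.C 0 n (\<lambda>_. undefined)) (IT.PF.emb {0..<n} {0..<n} {restrict x {0..<n}})"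
    by (rule IT.emeasure_CI[OF _ S]) simp
  also have "IT.PF.emb {0..<n} {0..<n} {restrict x {0..<n}} = {restrict x {0..<n}}"
    using S by (intro prod_emb_id) (auto simp: PiE_iff)
  finally show ?thesis .
qed

lemma prob_space_walk_law: "prob_space (walk_law p)"
proof
  have *: "(\<lambda>_. undefined) \<in> space (PiM {0..<0} (\<lambda>_. count_space UNIV :: (int ^ 'd) measure))"
    by (auto simp: space_PiM)
  interpret C: prob_space "IT.C 0 0 (\<lambda>_. undefined)"
    by (rule IT.prob_space_C[OF *])
  have "space (IT.C 0 0 (\<lambda>_. undefined)) = {restrict undefined {0..<0}}"
    by (simp add: space_PiM restrict_def)
  then show "emeasure (walk_law p) (space (walk_law p)) = 1"
    using C.emeasure_space_1 emeasure_walk_law_cylinder[of 0 undefined]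
    by (simp add: space_walk_law)
qed

lemma emeasure_walk_law_Suc:
  "emeasure (walk_law p) {X. \<forall>k<Suc n. X k = x k} =
   emeasure (walk_law p) {X. \<forall>k<n. X k = x k} * emeasure (walk_kernel p n x) {x n}"
proof -
  let ?M = "\<lambda>n. PiM {0..<n} (\<lambda>_. count_space UNIV :: (int ^ 'd) measure)"
  let ?u = "(\<lambda>_. undefined) :: nat \<Rightarrow> int ^ 'd"
  have u: "?u \<in> space (?M 0)"
    by (auto simp: space_PiM)
  note S = sets_singleton
  have space_C: "space (IT.C 0 n ?u) = space (?M n)" and sets_C: "sets (IT.C 0 n ?u) = sets (?M n)"
    using IT.space_C[OF u, of n] IT.sets_C[OF u, of n] by simp_all
  have kern: "walk_kernel p n (restrict x {0..<n}) = walk_kernel p n x"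
    by (cases n) (simp_all add: walk_kernel_def)
  have "emeasure (IT.C 0 (Suc n) ?u) {restrict x {0..<Suc n}} =
      (\<integral>\<^sup>+X. emeasure (IT.eP n X) {restrict x {0..<Suc n}} \<partial>IT.C 0 n ?u)"
  proof -
    have "IT.eP n \<in> IT.C 0 n ?u \<rightarrow>\<^sub>M subprob_algebra (?M (Suc n))"
      using IT.measurable_eP[of n] by (simp add: measurable_cong_sets[OF sets_C refl])
    then show ?thesis
      using prob_space.not_empty[OF IT.prob_space_C[OF u, of n]]
      by (simp add: emeasure_bind[OF _ _ S])
  qed
  also have "\<dots> = (\<integral>\<^sup>+X. emeasure (walk_kernel p n x) {x n} * indicator {restrict x {0..<n}} X \<partial>IT.C 0 n ?u)"
  proof (rule nn_integral_cong)
    fix X assume "X \<in> space (IT.C 0 n ?u)"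
    then have X: "X \<in> space (?M n)"
      by (simp add: space_C)
    have "(\<lambda>y. X(n := y)) -` {restrict x {0..<Suc n}} = (if X = restrict x {0..<n} then {x n} else {})"
    proof -
      have iff: "X(n := y) = restrict x {0..<Suc n} \<longleftrightarrow> X = restrict x {0..<n} \<and> y = x n" for y
      proof
        assume eq: "X(n := y) = restrict x {0..<Suc n}"
        have "X k = restrict x {0..<n} k" for k
        proof (cases "k = n")
          case True
          then show ?thesis
            using X by (auto simp: space_PiM PiE_iff extensional_def)
        next
          case False
          then show ?thesis
            using fun_cong[OF eq, of k] by (auto simp: restrict_def split: if_splits)
        qed
        moreover have "y = x n"
          using fun_cong[OF eq, of n] by simp
        ultimately show "X = restrict x {0..<n} \<and> y = x n"
          by blast
      qed (auto simp: fun_eq_iff)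
      show ?thesis
        unfolding vimage_def singleton_iff iff by auto
    qed
    then show "emeasure (IT.eP n X) {restrict x {0..<Suc n}} =
        emeasure (walk_kernel p n x) {x n} * indicator {restrict x {0..<n}} X"
      by (simp add: IT.emeasure_eP[OF X S] kern split: if_splits)
  qed
  also have "\<dots> = emeasure (walk_kernel p n x) {x n} * emeasure (IT.C 0 n ?u) {restrict x {0..<n}}"
    by (rule nn_integral_cmult_indicator) (simp add: sets_C S)
  finally show ?thesis
    by (simp only: emeasure_walk_law_cylinder mult.commute)
qed

lemma walk_law_start: "measure (walk_law p) {X. X 0 = 0} = 1"
proof -
  interpret prob_space "walk_law p"
    by (rule prob_space_walk_law)
  have "emeasure (walk_law p) {X. X 0 = 0} = 1"
    using emeasure_walk_law_Suc[of 0 "\<lambda>_. 0"] emeasure_space_1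
    by (simp add: walk_kernel_def space_walk_law)
  then show ?thesis
    by (simp add: measure_def)
qed

lemma walk_law_step:
  assumes "\<And>x y. 0 \<le> p x y" and "\<And>x. (p x has_sum 1) UNIV"
  shows "measure (walk_law p) {X. \<forall>k\<le>Suc n. X k = x k} =
         measure (walk_law p) {X. \<forall>k\<le>n. X k = x k} * p (x n) (x (Suc n))"
proof -
  have "p (x n) summable_on UNIV"
    using assms(2) by (rule has_sum_imp_summable)
  then have abs: "Infinite_Sum.abs_summable_on (p (x n)) UNIV"
    by (rule iffD1[OF summable_on_iff_abs_summable_on_real])
  then have "(\<integral>\<^sup>+y. ennreal (p (x n) y) \<partial>count_space UNIV) = ennreal (infsetsum (p (x n)) UNIV)"
    by (intro nn_integral_conv_infsetsum assms(1)) (rule iffD1[OF abs_summable_equivalent])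
  also have "\<dots> = 1"
    using infsumI[OF assms(2)] by (simp add: infsetsum_infsum[OF abs[unfolded abs_summable_equivalent]])
  finally have "(\<integral>\<^sup>+y. ennreal (p (x n) y) \<partial>count_space UNIV) = 1" .
  then have "pmf (embed_pmf (p (x n))) (x (Suc n)) = p (x n) (x (Suc n))"
    using assms(1) by (intro pmf_embed_pmf)
  then have "emeasure (walk_kernel p (Suc n) x) {x (Suc n)} = ennreal (p (x n) (x (Suc n)))"
    by (simp add: walk_kernel_def emeasure_pmf_single)
  then show ?thesis
    using emeasure_walk_law_Suc[of "Suc n" x] assms(1)
    by (simp add: measure_def enn2real_mult less_Suc_eq_le)
qed

end

end

theory Submission
  imports Defs
begin

text \<open>
  The walk returns to the origin infinitely often as soon as the Green function
  \<open>\<Sum>n. P\<^sub>\<omega> (X n = 0)\<close> diverges (\<open>AE_infinitely_many_returns\<close>), so the task is to show that it is almost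
  surely infinite. Averaging over the environment, one argues by contradiction with a logarithmic potential.

  Suppose that the Green function at the origin is at most \<open>K\<close> on a set \<open>A\<close> of environments of positive
  probability. By the maximum principle the walk then spends an expected time of at most \<open>K\<close> at each site from which the
  environment looks as in \<open>A\<close> (\<open>occupation_le\<close>). By bistochasticity the environment seen from the walker,
  \<open>\<tau> (X n) \<omega>\<close>, is a stationary Markov process (\<open>integral_env_step\<close>), and irreducibility together with ergodicity of
  the action makes it ergodic (\<open>AE_eq_expectation_if_env_step_invariant\<close>). A mean ergodic theorem with bounded
  correctors (\<open>mean_ergodic\<close>) shows that functions of the environment may be replaced by their means when they are
  summed along the walk against a slowly varying function of the position (\<open>walk_mean_average\<close>). Applied to the
  indicator of \<open>A\<close>, this turns the bound on visits to good sites into a bound on all visits: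
  on the diffusive scale the walk would have an occupation density bounded by a constant.

  Applied to the jump probabilities, the same replacement shows that the walk acts on smooth functions of large
  scale like the constant elliptic operator whose coefficients are the mean covariance of a jump. The
  covariance is nondegenerate, again by irreducibility. Let \<open>Q\<close> be its inverse, and
  consider the potential \<open>ln (s\<^sup>2 + x \<bullet> Q x) / 2\<close>. In dimension at most two its image under that operator is at most
  \<open>s\<^sup>2 / (s\<^sup>2 + x \<bullet> Q x)\<^sup>2\<close>, whose sum over the lattice is bounded uniformly in \<open>s\<close> (\<open>sum_bump_le\<close>).
  With a bounded density, the mean potential therefore exceeds its initial value \<open>ln s\<close> by at most a constant
  up to any fixed multiple of \<open>s\<^sup>2\<close> steps. But a bounded density also forces the walk to spend, on average, at
  least half of a suitable multiple of \<open>\<Gamma>\<^sup>2 * s\<^sup>2\<close> steps at \<open>Q\<close>-distance at least \<open>\<Gamma> * s\<close> from the origin, where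
  the potential exceeds \<open>ln s\<close> by at least
  \<open>ln \<Gamma>\<close>. For large \<open>\<Gamma>\<close> this is a contradiction (\<open>bounded_returns_null\<close>). In probabilistic terms, a planar
  walk on the diffusive scale must have a logarithmically divergent occupation density at the origin.
\<close>

section \<open>The environment seen from the walker\<close>

lemma sum_eq_has_sum_of_finite_support:
  fixes f :: "'a \<Rightarrow> 'b::{topological_comm_monoid_add, t2_space}"
  assumes "(f has_sum a) UNIV" "finite S" "\<And>y. y \<notin> S \<Longrightarrow> f y = 0"
  shows "sum f S = a"
proof -
  have "(f has_sum a) S"
    using assms(1) by (rule iffD1[OF has_sum_cong_neutral, rotated -1]) (use assms in auto)
  moreover have "(f has_sum sum f S) S"
    using assms(2) by (rule has_sum_finite)
  ultimately show ?thesis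
    using has_sum_unique by blast
qed

lemma sum_translate_eq_has_sum:
  fixes f :: "'a::ab_group_add \<Rightarrow> 'b::{topological_comm_monoid_add, t2_space}"
  assumes "(f has_sum a) UNIV" "finite S" "\<And>y. y - x \<notin> S \<Longrightarrow> f y = 0"
  shows "(\<Sum>z\<in>S. f (x + z)) = a"
proof -
  have "sum f ((+) x ` S) = a"
    using assms(1)
  proof (rule sum_eq_has_sum_of_finite_support)
    fix y assume "y \<notin> (+) x ` S"
    then have "y - x \<notin> S"
      by (metis add.commute diff_add_cancel image_eqI)
    then show "f y = 0"
      by (rule assms(3))
  qed (use assms(2) in simp)
  then show ?thesis
    by (subst (asm) sum.reindex) (auto simp: inj_on_def)
qed

context lattice_action
begin

lemma action_in_space [simp]: "\<omega> \<in> space M \<Longrightarrow> \<tau> z \<omega> \<in> space M"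
  using measurable_action by (rule measurable_space)

lemma integral_action:
  fixes g :: "'w \<Rightarrow> real"
  assumes "g \<in> borel_measurable M"
  shows "(\<integral>\<omega>. g (\<tau> z \<omega>) \<partial>M) = (\<integral>\<omega>. g \<omega> \<partial>M)"
  using integral_distr[OF measurable_action[of z], of g] assms action_preserves[of z] by simp

lemma AE_action:
  assumes "AE \<omega> in M. Q \<omega>"
  shows "AE \<omega> in M. Q (\<tau> z \<omega>)"
proof (rule AE_distrD[OF measurable_action])
  show "AE \<omega> in distr M M (\<tau> z). Q \<omega>"
    using assms by (simp only: action_preserves[of z])
qed

lemma integrable_bounded:
  fixes g :: "'w \<Rightarrow> real"
  assumes "g \<in> borel_measurable M" "\<And>\<omega>. \<omega> \<in> space M \<Longrightarrow> \<bar>g \<omega>\<bar> \<le> C"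
  shows "integrable M g"
  by (rule integrable_const_bound[of _ C]) (use assms in auto)

end

text \<open>
  The finite range condition only asserts that some set of admissible jumps exists; fixing one
  turns every sum over the lattice below into a finite sum over \<open>\<Lambda>\<close>.
\<close>

locale bounded_range_environment = random_environment M \<tau> p
  for M :: "'w measure" and \<tau> :: "int ^ 'd::finite \<Rightarrow> 'w \<Rightarrow> 'w"
    and p :: "'w \<Rightarrow> int ^ 'd \<Rightarrow> int ^ 'd \<Rightarrow> real" +
  fixes \<Lambda> :: "(int ^ 'd) set"
  assumes finite_jumps: "finite \<Lambda>"
    and jumps: "\<And>\<omega> x y. \<omega> \<in> space M \<Longrightarrow> y - x \<notin> \<Lambda> \<Longrightarrow> p \<omega> x y = 0"
begin

lemma row_sum_jumps: "\<omega> \<in> space M \<Longrightarrow> (\<Sum>z\<in>\<Lambda>. p \<omega> x (x + z)) = 1"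
  by (rule sum_translate_eq_has_sum[OF row_sum finite_jumps jumps])

lemma column_sum_jumps:
  assumes w: "\<omega> \<in> space M"
  shows "(\<Sum>z\<in>\<Lambda>. p \<omega> (y - z) y) = 1"
proof -
  have "(\<Sum>z\<in>uminus ` \<Lambda>. p \<omega> (y + z) y) = 1"
  proof (rule sum_translate_eq_has_sum[OF column_sum[OF w]])
    fix x assume "x - y \<notin> uminus ` \<Lambda>"
    then have "y - x \<notin> \<Lambda>"
      by (metis image_eqI minus_diff_eq)
    then show "p \<omega> x y = 0"
      by (rule jumps[OF w])
  qed (simp add: finite_jumps)
  then show ?thesis
    by (subst (asm) sum.reindex) (auto simp: inj_on_def)
qed

lemma drift_jumps: "\<omega> \<in> space M \<Longrightarrow> (\<Sum>z\<in>\<Lambda>. p \<omega> 0 z *\<^sub>R real_vec z) = 0"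
  using sum_eq_has_sum_of_finite_support[OF zero_drift[of \<omega> 0] finite_jumps] jumps[of \<omega> _ 0] by simp

lemma p_le_one: "\<omega> \<in> space M \<Longrightarrow> p \<omega> x y \<le> 1"
proof -
  assume w: "\<omega> \<in> space M"
  show ?thesis
  proof (cases "y - x \<in> \<Lambda>")
    case True
    then have "p \<omega> x (x + (y - x)) \<le> (\<Sum>z\<in>\<Lambda>. p \<omega> x (x + z))"
      by (rule member_le_sum) (use finite_jumps nonneg[OF w] in auto)
    then show ?thesis
      using row_sum_jumps[OF w, of x] by simp
  next
    case False
    then show ?thesis
      using jumps[OF w] by simp
  qed
qed

text \<open>
  The Markov operator of the environment seen from the walker, \<open>\<omega>\<^sub>n = \<tau> (X n) \<omega>\<close>.
\<close>

definition env_step :: "('w \<Rightarrow> real) \<Rightarrow> 'w \<Rightarrow> real"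
  where "env_step g \<omega> = (\<Sum>z\<in>\<Lambda>. p \<omega> 0 z * g (\<tau> z \<omega>))"

lemma measurable_env_step [measurable]:
  assumes [measurable]: "g \<in> borel_measurable M"
  shows "env_step g \<in> borel_measurable M"
proof -
  have [measurable]: "(\<lambda>\<omega>. g (\<tau> z \<omega>)) \<in> borel_measurable M" for z
    using measurable_compose[OF measurable_action assms] .
  note measurable_env [measurable]
  show ?thesis
    unfolding env_step_def[abs_def] by measurable
qed

lemma average_le:
  assumes "\<omega> \<in> space M" "\<And>z. z \<in> \<Lambda> \<Longrightarrow> f z \<le> C"
  shows "(\<Sum>z\<in>\<Lambda>. p \<omega> 0 z * f z) \<le> C"
proof -
  have "(\<Sum>z\<in>\<Lambda>. p \<omega> 0 z * f z) \<le> (\<Sum>z\<in>\<Lambda>. p \<omega> 0 z * C)"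
    by (intro sum_mono mult_left_mono assms nonneg)
  also have "\<dots> = C"
    using row_sum_jumps[OF assms(1), of 0] by (simp add: sum_distrib_right[symmetric])
  finally show ?thesis .
qed

lemma average_abs_le:
  assumes "\<omega> \<in> space M" "\<And>z. z \<in> \<Lambda> \<Longrightarrow> \<bar>f z\<bar> \<le> C"
  shows "\<bar>\<Sum>z\<in>\<Lambda>. p \<omega> 0 z * f z\<bar> \<le> C"
proof -
  have "f z \<le> C" "- f z \<le> C" if "z \<in> \<Lambda>" for z
    using assms(2)[OF that] by auto
  then show ?thesis
    using average_le[OF assms(1), of f C] average_le[OF assms(1), of "\<lambda>z. - f z" C]
    by (simp add: sum_negf abs_le_iff)
qed

lemma env_step_bounded:
  assumes "\<And>\<omega>. \<omega> \<in> space M \<Longrightarrow> \<bar>g \<omega>\<bar> \<le> C" "\<omega> \<in> space M"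
  shows "\<bar>env_step g \<omega>\<bar> \<le> C"
  unfolding env_step_def by (rule average_abs_le) (use assms in auto)

text \<open>
  Stationarity of the environment seen from the walker. Translating the term for the jump \<open>z\<close> by
  \<open>-z\<close> turns it into \<open>p \<omega> (-z) 0 * g \<omega>\<close>, so the sum over \<open>z\<close> is a column sum: this is where
  bistochasticity enters.
\<close>

lemma integral_env_step:
  assumes g [measurable]: "g \<in> borel_measurable M" and b: "\<And>\<omega>. \<omega> \<in> space M \<Longrightarrow> \<bar>g \<omega>\<bar> \<le> C"
  shows "(\<integral>\<omega>. env_step g \<omega> \<partial>M) = (\<integral>\<omega>. g \<omega> \<partial>M)"
proof -
  note measurable_env [measurable]
  have [measurable]: "(\<lambda>\<omega>. g (\<tau> z \<omega>)) \<in> borel_measurable M" for z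
    using measurable_compose[OF measurable_action g] .
  have C: "0 \<le> C"
    using b not_empty by force
  have bd: "\<bar>p \<omega> x y * c\<bar> \<le> C" if "\<omega> \<in> space M" "\<bar>c\<bar> \<le> C" for \<omega> x y c
    using mult_mono[OF p_le_one[OF that(1), of x y] that(2)] nonneg[OF that(1), of x y]
    by (simp add: abs_mult)
  have "(\<integral>\<omega>. env_step g \<omega> \<partial>M) = (\<Sum>z\<in>\<Lambda>. \<integral>\<omega>. p \<omega> 0 z * g (\<tau> z \<omega>) \<partial>M)"
    unfolding env_step_def
    by (rule Bochner_Integration.integral_sum, rule integrable_bounded[of _ C]) (auto intro!: bd b)
  also have "\<dots> = (\<Sum>z\<in>\<Lambda>. \<integral>\<omega>. p \<omega> (0 - z) 0 * g \<omega> \<partial>M)"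
  proof (rule sum.cong[OF refl])
    fix z
    have "(\<integral>\<omega>. p \<omega> 0 z * g (\<tau> z \<omega>) \<partial>M) = (\<integral>\<omega>. p (\<tau> z \<omega>) (0 - z) 0 * g (\<tau> z \<omega>) \<partial>M)"
      by (rule Bochner_Integration.integral_cong) (simp_all add: covariance)
    also have "\<dots> = (\<integral>\<omega>. p \<omega> (0 - z) 0 * g \<omega> \<partial>M)"
      by (rule integral_action[of "\<lambda>\<omega>. p \<omega> (0 - z) 0 * g \<omega>"]) measurable
    finally show "(\<integral>\<omega>. p \<omega> 0 z * g (\<tau> z \<omega>) \<partial>M) = (\<integral>\<omega>. p \<omega> (0 - z) 0 * g \<omega> \<partial>M)" .
  qed
  also have "\<dots> = (\<integral>\<omega>. (\<Sum>z\<in>\<Lambda>. p \<omega> (0 - z) 0 * g \<omega>) \<partial>M)"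
    by (rule Bochner_Integration.integral_sum[symmetric], rule integrable_bounded[of _ C])
      (auto intro!: bd b)
  also have "\<dots> = (\<integral>\<omega>. g \<omega> \<partial>M)"
    by (rule Bochner_Integration.integral_cong)
      (simp_all only: sum_distrib_right[symmetric] column_sum_jumps mult_1_left)
  finally show ?thesis .
qed

lemma connecting_path:
  assumes "transition_prob (p \<omega>) n 0 y > 0"
  obtains u where "u 0 = 0" "u n = y" "\<And>k. k < n \<Longrightarrow> p \<omega> (u k) (u (Suc k)) \<noteq> 0"
proof -
  let ?S = "{u \<in> {..n} \<rightarrow>\<^sub>E UNIV. u 0 = 0 \<and> u n = y}"
  have "\<exists>u\<in>?S. (\<Prod>k<n. p \<omega> (u k) (u (Suc k))) \<noteq> 0"
  proof (rule ccontr)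
    assume "\<not> ?thesis"
    then have "transition_prob (p \<omega>) n 0 y = 0"
      unfolding transition_prob_def by (intro infsum_0) blast
    with assms show False
      by simp
  qed
  then obtain u where u: "u 0 = 0" "u n = y" "(\<Prod>k<n. p \<omega> (u k) (u (Suc k))) \<noteq> 0"
    by blast
  then show ?thesis
    by (intro that[of u]) (simp_all add: prod_zero_iff)
qed

text \<open>
  Irreducibility joins the origin to every site by a path of edges of positive probability, so
  whatever is almost surely unchanged along the edges leaving the origin, and is transported by the
  action, is unchanged on the whole lattice. It is used for functions of the environment (ergodicity)
  and for linear functionals of the position (nondegeneracy of the covariance).
\<close>

lemma AE_edge_invariant_imp:
  fixes f :: "'w \<Rightarrow> int ^ 'd \<Rightarrow> 'b"
  assumes edge: "AE \<omega> in M. \<forall>z\<in>\<Lambda>. p \<omega> 0 z \<noteq> 0 \<longrightarrow> f \<omega> z = f \<omega> 0"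
    and cov: "\<And>\<omega> x z. \<omega> \<in> space M \<Longrightarrow> f (\<tau> x \<omega>) z = f (\<tau> x \<omega>) 0 \<Longrightarrow> f \<omega> (x + z) = f \<omega> x"
  shows "AE \<omega> in M. \<forall>y. f \<omega> y = f \<omega> 0"
proof -
  have "AE \<omega> in M. \<forall>x. \<forall>z\<in>\<Lambda>. p (\<tau> x \<omega>) 0 z \<noteq> 0 \<longrightarrow> f (\<tau> x \<omega>) z = f (\<tau> x \<omega>) 0"
    by (subst AE_all_countable) (intro allI AE_action edge)
  with irreducible AE_space show ?thesis
  proof eventually_elim
    case (elim \<omega>)
    note w = elim(2)
    have step: "f \<omega> y = f \<omega> x" if "p \<omega> x y \<noteq> 0" for x y
    proof -
      have "y - x \<in> \<Lambda>"
        using jumps[OF w] that by blast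
      moreover have "p (\<tau> x \<omega>) 0 (y - x) \<noteq> 0"
        using that w by (simp add: covariance)
      ultimately have "f \<omega> (x + (y - x)) = f \<omega> x"
        using elim(3) cov[OF w] by blast
      then show ?thesis
        by simp
    qed
    show ?case
    proof
      fix y
      obtain n where "transition_prob (p \<omega>) n 0 y > 0"
        using elim(1) by blast
      then obtain u where u: "u 0 = 0" "u n = y" "\<And>k. k < n \<Longrightarrow> p \<omega> (u k) (u (Suc k)) \<noteq> 0"
        by (rule connecting_path) blast
      have "k \<le> n \<Longrightarrow> f \<omega> (u k) = f \<omega> 0" for k
        by (induction k) (use u(1) step[OF u(3)] in auto)
      from this[of n] show "f \<omega> y = f \<omega> 0"
        using u(2) by simp
    qed
  qed
qed

text \<open>
  Ergodicity speaks of strictly invariant sets, whereas \<open>f\<close> is invariant only up to a null set. The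
  set where the whole orbit of \<open>f\<close> exceeds the mean is strictly invariant, hence trivial; a function
  that almost surely stays on one side of its mean is equal to it.
\<close>

lemma AE_eq_expectation_if_action_invariant:
  fixes f :: "'w \<Rightarrow> real"
  assumes f [measurable]: "f \<in> borel_measurable M" and int: "integrable M f"
    and inv: "AE \<omega> in M. \<forall>y. f (\<tau> y \<omega>) = f \<omega>"
  shows "AE \<omega> in M. f \<omega> = (\<integral>\<omega>. f \<omega> \<partial>M)"
proof -
  define c where "c = (\<integral>\<omega>. f \<omega> \<partial>M)"
  have [measurable]: "(\<lambda>\<omega>. f (\<tau> z \<omega>)) \<in> borel_measurable M" for z
    using measurable_compose[OF measurable_action f] .
  have zero: "AE \<omega> in M. f \<omega> = c" if "AE \<omega> in M. 0 \<le> \<sigma> * (f \<omega> - c)" "\<sigma> \<noteq> 0" for \<sigma> :: real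
  proof -
    have "integrable M (\<lambda>\<omega>. \<sigma> * (f \<omega> - c))"
      using int by simp
    moreover have "(\<integral>\<omega>. \<sigma> * (f \<omega> - c) \<partial>M) = 0"
      using int by (simp add: c_def prob_space)
    ultimately have "AE \<omega> in M. \<sigma> * (f \<omega> - c) = 0"
      using integral_nonneg_eq_0_iff_AE[OF _ that(1)] by blast
    then show ?thesis
      using that(2) by simp
  qed
  define A where "A = {\<omega> \<in> space M. \<forall>y. f (\<tau> y \<omega>) > c}"
  have A: "A \<in> sets M"
    unfolding A_def by measurable
  have "\<tau> z -` A \<inter> space M = A" for z
  proof -
    have "(\<forall>y. f (\<tau> (y + z) \<omega>) > c) \<longleftrightarrow> (\<forall>y. f (\<tau> y \<omega>) > c)" for \<omega>
      by (metis diff_add_cancel)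
    then have "(\<forall>y. f (\<tau> y (\<tau> z \<omega>)) > c) \<longleftrightarrow> (\<forall>y. f (\<tau> y \<omega>) > c)"
      if "\<omega> \<in> space M" for \<omega>
      using that by (simp add: action_add[symmetric])
    then show ?thesis
      unfolding A_def by auto
  qed
  then consider "prob A = 0" | "prob A = 1"
    using ergodic[OF A] by blast
  then have "AE \<omega> in M. f \<omega> = c"
  proof cases
    case 1
    then have "AE \<omega> in M. \<omega> \<notin> A"
      by (simp add: prob_eq_0[OF A])
    with inv AE_space have "AE \<omega> in M. 0 \<le> (-1) * (f \<omega> - c)"
      by eventually_elim (auto simp: A_def not_less)
    then show ?thesis
      by (rule zero) simp
  next
    case 2
    then have "AE \<omega> in M. \<omega> \<in> A"
      by (rule AE_prob_1)
    with AE_space have "AE \<omega> in M. 0 \<le> 1 * (f \<omega> - c)"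
    proof eventually_elim
      case (elim \<omega>)
      then have "f (\<tau> 0 \<omega>) > c"
        by (simp add: A_def)
      then show ?case
        using elim(1) by (simp add: action_zero)
    qed
    then show ?thesis
      by (rule zero) simp
  qed
  then show ?thesis
    by (simp add: c_def)
qed

text \<open>
  By stationarity the Dirichlet form of a function fixed by \<open>env_step\<close> vanishes:
  \<open>\<integral> \<Sum>z. p 0 z * (f \<circ> \<tau> z - f)\<^sup>2 = 2 * \<integral> f\<^sup>2 - 2 * \<integral> f * env_step f = 0\<close>. So \<open>f\<close> does not change along the
  edges that the walk can take. Hence the environment seen from the walker is ergodic.
\<close>

lemma AE_eq_expectation_if_env_step_invariant:
  assumes f [measurable]: "f \<in> borel_measurable M" and b: "\<And>\<omega>. \<omega> \<in> space M \<Longrightarrow> \<bar>f \<omega>\<bar> \<le> C"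
    and inv: "AE \<omega> in M. env_step f \<omega> = f \<omega>"
  shows "AE \<omega> in M. f \<omega> = (\<integral>\<omega>. f \<omega> \<partial>M)"
proof -
  note measurable_env [measurable]
  have [measurable]: "(\<lambda>\<omega>. f (\<tau> z \<omega>)) \<in> borel_measurable M" for z
    using measurable_compose[OF measurable_action f] .
  define D where "D \<omega> = (\<Sum>z\<in>\<Lambda>. p \<omega> 0 z * (f (\<tau> z \<omega>) - f \<omega>)\<^sup>2)" for \<omega>
  have b2: "\<bar>(f \<omega>)\<^sup>2\<bar> \<le> C\<^sup>2" if "\<omega> \<in> space M" for \<omega>
    using b[OF that] power_mono[OF b[OF that], of 2] by simp
  have sq [measurable]: "(\<lambda>\<omega>. (f \<omega>)\<^sup>2) \<in> borel_measurable M"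
    by measurable
  have D_eq: "D \<omega> = env_step (\<lambda>\<omega>. (f \<omega>)\<^sup>2) \<omega> - 2 * f \<omega> * env_step f \<omega> + (f \<omega>)\<^sup>2"
    if "\<omega> \<in> space M" for \<omega>
  proof -
    have "D \<omega> = (\<Sum>z\<in>\<Lambda>. p \<omega> 0 z * (f (\<tau> z \<omega>))\<^sup>2 - 2 * f \<omega> * (p \<omega> 0 z * f (\<tau> z \<omega>)) + p \<omega> 0 z * (f \<omega>)\<^sup>2)"
      unfolding D_def by (rule sum.cong[OF refl]) (simp add: power2_eq_square algebra_simps)
    also have "\<dots> = env_step (\<lambda>\<omega>. (f \<omega>)\<^sup>2) \<omega> - 2 * f \<omega> * env_step f \<omega> + (\<Sum>z\<in>\<Lambda>. p \<omega> 0 z) * (f \<omega>)\<^sup>2"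
      by (simp add: sum.distrib sum_subtractf env_step_def sum_distrib_left sum_distrib_right)
    finally show ?thesis
      using row_sum_jumps[OF that, of 0] by simp
  qed
  have int1: "integrable M (env_step (\<lambda>\<omega>. (f \<omega>)\<^sup>2))"
    by (rule integrable_bounded[of _ "C\<^sup>2"]) (use env_step_bounded[OF b2] in auto)
  have int2: "integrable M (\<lambda>\<omega>. (f \<omega>)\<^sup>2)"
    by (rule integrable_bounded[of _ "C\<^sup>2"]) (use b2 in auto)
  have AED: "AE \<omega> in M. D \<omega> = env_step (\<lambda>\<omega>. (f \<omega>)\<^sup>2) \<omega> - (f \<omega>)\<^sup>2"
    using inv AE_space by eventually_elim (simp add: D_eq power2_eq_square)
  have Dm [measurable]: "D \<in> borel_measurable M"
    unfolding D_def[abs_def] by measurable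
  have "integrable M D"
    by (rule Bochner_Integration.integrable_cong_AE_imp[of M "\<lambda>\<omega>. env_step (\<lambda>\<omega>. (f \<omega>)\<^sup>2) \<omega> - (f \<omega>)\<^sup>2"])
      (use int1 int2 AED in \<open>auto elim: eventually_mono\<close>)
  moreover have "AE \<omega> in M. 0 \<le> D \<omega>"
    using AE_space by eventually_elim (auto simp: D_def intro!: sum_nonneg mult_nonneg_nonneg nonneg)
  moreover have "(\<integral>\<omega>. D \<omega> \<partial>M) = (\<integral>\<omega>. env_step (\<lambda>\<omega>. (f \<omega>)\<^sup>2) \<omega> - (f \<omega>)\<^sup>2 \<partial>M)"
    by (rule integral_cong_AE) (use AED in auto)
  then have "(\<integral>\<omega>. D \<omega> \<partial>M) = 0"
    using int1 int2 integral_env_step[OF sq b2] by simp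
  ultimately have "AE \<omega> in M. D \<omega> = 0"
    using integral_nonneg_eq_0_iff_AE by blast
  with AE_space have "AE \<omega> in M. \<forall>z\<in>\<Lambda>. p \<omega> 0 z \<noteq> 0 \<longrightarrow> f (\<tau> z \<omega>) = f (\<tau> 0 \<omega>)"
  proof eventually_elim
    case (elim \<omega>)
    then have "\<forall>z\<in>\<Lambda>. p \<omega> 0 z * (f (\<tau> z \<omega>) - f \<omega>)\<^sup>2 = 0"
      unfolding D_def by (subst (asm) sum_nonneg_eq_0_iff) (auto simp: finite_jumps nonneg)
    then show ?case
      using elim by (auto simp: action_zero)
  qed
  then have "AE \<omega> in M. \<forall>y. f (\<tau> y \<omega>) = f (\<tau> 0 \<omega>)"
    by (rule AE_edge_invariant_imp) (simp add: action_add[symmetric] add.commute)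
  with AE_space have "AE \<omega> in M. \<forall>y. f (\<tau> y \<omega>) = f \<omega>"
    by eventually_elim (simp add: action_zero)
  then show ?thesis
    using AE_eq_expectation_if_action_invariant[OF f integrable_bounded[OF f b]] by simp
qed

end

section \<open>A mean ergodic theorem with bounded correctors\<close>

context bounded_range_environment
begin

lemma env_step_add: "env_step (\<lambda>\<omega>. g \<omega> + h \<omega>) \<omega> = env_step g \<omega> + env_step h \<omega>"
  unfolding env_step_def by (simp add: sum.distrib algebra_simps)

lemma env_step_scale: "env_step (\<lambda>\<omega>. c * g \<omega>) \<omega> = c * env_step g \<omega>"
  unfolding env_step_def by (simp add: sum_distrib_left algebra_simps)

text \<open>
  Jensen's inequality: the variance of \<open>g\<close> under the jump law is nonnegative.
\<close>

lemma env_step_square_le: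
  assumes w: "\<omega> \<in> space M"
  shows "(env_step g \<omega>)\<^sup>2 \<le> env_step (\<lambda>\<omega>. (g \<omega>)\<^sup>2) \<omega>"
proof -
  define m where "m = env_step g \<omega>"
  have "0 \<le> (\<Sum>z\<in>\<Lambda>. p \<omega> 0 z * (g (\<tau> z \<omega>) - m)\<^sup>2)"
    by (intro sum_nonneg mult_nonneg_nonneg nonneg w) simp
  also have "\<dots> = (\<Sum>z\<in>\<Lambda>. p \<omega> 0 z * (g (\<tau> z \<omega>))\<^sup>2 - 2 * m * (p \<omega> 0 z * g (\<tau> z \<omega>)) + p \<omega> 0 z * m\<^sup>2)"
    by (rule sum.cong[OF refl]) (simp add: power2_eq_square algebra_simps)
  also have "\<dots> = env_step (\<lambda>\<omega>. (g \<omega>)\<^sup>2) \<omega> - 2 * m * env_step g \<omega> + (\<Sum>z\<in>\<Lambda>. p \<omega> 0 z) * m\<^sup>2"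
    by (simp add: sum.distrib sum_subtractf env_step_def sum_distrib_left sum_distrib_right)
  finally show ?thesis
    using row_sum_jumps[OF w, of 0] by (simp add: m_def power2_eq_square)
qed

text \<open>
  A centred bounded function is, up to a small \<open>L\<^sup>2\<close> error, a coboundary \<open>h - env_step h\<close> of a bounded
  function. This is the mean ergodic theorem, obtained through an element of minimal norm: among
  the functions \<open>v = g - (h - env_step h)\<close> with \<open>\<bar>v\<bar> \<le> C\<close>, a set that is convex and stable under
  \<open>env_step\<close>, a minimising sequence is Cauchy in \<open>L\<^sup>2\<close> by the parallelogram identity. It is also
  asymptotically fixed by \<open>env_step\<close>, since \<open>env_step v\<close> competes with \<open>v\<close>. Its limit is therefore
  constant by ergodicity and has mean zero, so the minimal norm is zero. The uniform bound \<open>C\<close> makes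
  dominated convergence available.
\<close>

lemma mean_ergodic:
  assumes g [measurable]: "g \<in> borel_measurable M" and gb: "\<And>\<omega>. \<omega> \<in> space M \<Longrightarrow> \<bar>g \<omega>\<bar> \<le> C"
    and g0: "(\<integral>\<omega>. g \<omega> \<partial>M) = 0" and e: "e > 0"
  obtains h B where "h \<in> borel_measurable M" "\<And>\<omega>. \<omega> \<in> space M \<Longrightarrow> \<bar>h \<omega>\<bar> \<le> B"
    "(\<integral>\<omega>. (g \<omega> - (h \<omega> - env_step h \<omega>))\<^sup>2 \<partial>M) \<le> e"
proof -
  define S where "S = {v. v \<in> borel_measurable M \<and> (\<forall>\<omega>\<in>space M. \<bar>v \<omega>\<bar> \<le> C) \<and>
    (\<exists>h B. h \<in> borel_measurable M \<and> (\<forall>\<omega>\<in>space M. \<bar>h \<omega>\<bar> \<le> B) \<and>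
      (\<forall>\<omega>\<in>space M. v \<omega> = g \<omega> - (h \<omega> - env_step h \<omega>)))}"
  have SI: "v \<in> S" if "v \<in> borel_measurable M" "\<And>\<omega>. \<omega> \<in> space M \<Longrightarrow> \<bar>v \<omega>\<bar> \<le> C"
    "h \<in> borel_measurable M" "\<And>\<omega>. \<omega> \<in> space M \<Longrightarrow> \<bar>h \<omega>\<bar> \<le> B"
    "\<And>\<omega>. \<omega> \<in> space M \<Longrightarrow> v \<omega> = g \<omega> - (h \<omega> - env_step h \<omega>)" for v h B
    using that unfolding S_def by blast
  have SE: thesis if "v \<in> S" "\<And>h B. \<lbrakk>h \<in> borel_measurable M; \<And>\<omega>. \<omega> \<in> space M \<Longrightarrow> \<bar>h \<omega>\<bar> \<le> B;
      \<And>\<omega>. \<omega> \<in> space M \<Longrightarrow> v \<omega> = g \<omega> - (h \<omega> - env_step h \<omega>)\<rbrakk> \<Longrightarrow> thesis" for v thesis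
    using that unfolding S_def by blast
  have Sm [measurable]: "v \<in> borel_measurable M" and Sb: "\<omega> \<in> space M \<Longrightarrow> \<bar>v \<omega>\<bar> \<le> C" if "v \<in> S" for v \<omega>
    using that unfolding S_def by blast+
  have C: "0 \<le> C"
    using gb not_empty by force
  have abs2: "\<bar>x\<bar> \<le> K \<Longrightarrow> \<bar>x\<^sup>2\<bar> \<le> K\<^sup>2" for x K :: real
    using power_mono[of "\<bar>x\<bar>" K 2] by simp
  have gS: "g \<in> S"
    by (rule SI[of _ "\<lambda>_. 0" 0]) (auto simp: gb env_step_def)
  \<comment> \<open>If \<open>h\<close> corrects \<open>v\<close>, then \<open>h + v\<close> corrects \<open>env_step v\<close>.\<close>
  have step_S: "env_step v \<in> S" if v: "v \<in> S" for v
  proof -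
    obtain h B where h [measurable]: "h \<in> borel_measurable M" "\<And>\<omega>. \<omega> \<in> space M \<Longrightarrow> \<bar>h \<omega>\<bar> \<le> B"
      "\<And>\<omega>. \<omega> \<in> space M \<Longrightarrow> v \<omega> = g \<omega> - (h \<omega> - env_step h \<omega>)"
      using v by (rule SE) blast
    note Sm[OF v, measurable]
    show ?thesis
    proof (rule SI[of _ "\<lambda>\<omega>. h \<omega> + v \<omega>" "B + C"])
      fix \<omega> assume w: "\<omega> \<in> space M"
      show "\<bar>env_step v \<omega>\<bar> \<le> C"
        by (rule env_step_bounded[OF Sb[OF v] w])
      show "\<bar>h \<omega> + v \<omega>\<bar> \<le> B + C"
        using h(2)[OF w] Sb[OF v w] by linarith
      show "env_step v \<omega> = g \<omega> - (h \<omega> + v \<omega> - env_step (\<lambda>\<omega>. h \<omega> + v \<omega>) \<omega>)"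
        using h(3)[OF w] by (simp add: env_step_add)
    qed measurable
  qed
  have mid_S: "(\<lambda>\<omega>. (1/2) * (v \<omega> + w \<omega>)) \<in> S" if v: "v \<in> S" and w: "w \<in> S" for v w
  proof -
    obtain h B where h [measurable]: "h \<in> borel_measurable M" "\<And>\<omega>. \<omega> \<in> space M \<Longrightarrow> \<bar>h \<omega>\<bar> \<le> B"
      "\<And>\<omega>. \<omega> \<in> space M \<Longrightarrow> v \<omega> = g \<omega> - (h \<omega> - env_step h \<omega>)"
      using v by (rule SE) blast
    obtain h' B' where h' [measurable]: "h' \<in> borel_measurable M" "\<And>\<omega>. \<omega> \<in> space M \<Longrightarrow> \<bar>h' \<omega>\<bar> \<le> B'"
      "\<And>\<omega>. \<omega> \<in> space M \<Longrightarrow> w \<omega> = g \<omega> - (h' \<omega> - env_step h' \<omega>)"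
      using w by (rule SE) blast
    note Sm[OF v, measurable] Sm[OF w, measurable]
    show ?thesis
    proof (rule SI[of _ "\<lambda>\<omega>. (1/2) * (h \<omega> + h' \<omega>)" "B + B'"])
      fix \<omega> assume o: "\<omega> \<in> space M"
      show "\<bar>(1/2) * (v \<omega> + w \<omega>)\<bar> \<le> C"
        using Sb[OF v o] Sb[OF w o] by (simp add: abs_le_iff)
      show "\<bar>(1/2) * (h \<omega> + h' \<omega>)\<bar> \<le> B + B'"
        using h(2)[OF o] h'(2)[OF o] by (simp add: abs_le_iff)
      show "(1/2) * (v \<omega> + w \<omega>) = g \<omega> - ((1/2) * (h \<omega> + h' \<omega>) - env_step (\<lambda>\<omega>. (1/2) * (h \<omega> + h' \<omega>)) \<omega>)"
        using h(3)[OF o] h'(3)[OF o] by (simp only: env_step_scale env_step_add) (simp add: field_simps)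
    qed measurable
  qed
  define E where "E v = (\<integral>\<omega>. (v \<omega>)\<^sup>2 \<partial>M)" for v :: "'w \<Rightarrow> real"
  have int2: "integrable M (\<lambda>\<omega>. (v \<omega>)\<^sup>2)" if "v \<in> S" for v
    by (rule integrable_bounded[of _ "C\<^sup>2"]) (use Sm[OF that] Sb[OF that] abs2 in auto)
  have E_nonneg: "0 \<le> E v" for v
    unfolding E_def by simp
  \<comment> \<open>The infimum of the squared norm over \<open>S\<close>; it bounds the midpoint of any two competitors from below.\<close>
  define d where "d = Inf (E ` S)"
  have d_le: "d \<le> E v" if "v \<in> S" for v
    unfolding d_def using that E_nonneg by (intro cInf_lower bdd_belowI[of _ 0]) auto
  have close: "(\<integral>\<omega>. (v \<omega> - w \<omega>)\<^sup>2 \<partial>M) \<le> 2 * (E v - d) + 2 * (E w - d)"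
    if v: "v \<in> S" and w: "w \<in> S" for v w
  proof -
    have "(\<integral>\<omega>. (v \<omega> - w \<omega>)\<^sup>2 \<partial>M) =
      (\<integral>\<omega>. 2 * (v \<omega>)\<^sup>2 + 2 * (w \<omega>)\<^sup>2 - 4 * ((1/2) * (v \<omega> + w \<omega>))\<^sup>2 \<partial>M)"
      by (rule Bochner_Integration.integral_cong) (auto simp: power2_eq_square field_simps)
    also have "\<dots> = 2 * E v + 2 * E w - 4 * E (\<lambda>\<omega>. (1/2) * (v \<omega> + w \<omega>))"
      unfolding E_def using int2[OF v] int2[OF w] int2[OF mid_S[OF v w]] by simp
    finally show ?thesis
      using d_le[OF mid_S[OF v w]] by simp
  qed
  have E_step: "E (env_step v) \<le> E v" if v: "v \<in> S" for v
  proof -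
    have m [measurable]: "(\<lambda>\<omega>. (v \<omega>)\<^sup>2) \<in> borel_measurable M"
      using Sm[OF v] by measurable
    have b: "\<bar>(v \<omega>)\<^sup>2\<bar> \<le> C\<^sup>2" if "\<omega> \<in> space M" for \<omega>
      using abs2[OF Sb[OF v that]] .
    have "E (env_step v) \<le> (\<integral>\<omega>. env_step (\<lambda>\<omega>. (v \<omega>)\<^sup>2) \<omega> \<partial>M)"
      unfolding E_def
    proof (rule integral_mono)
      show "integrable M (env_step (\<lambda>\<omega>. (v \<omega>)\<^sup>2))"
        by (rule integrable_bounded[of _ "C\<^sup>2"]) (auto intro: env_step_bounded[OF b])
    qed (auto intro: int2[OF step_S[OF v]] env_step_square_le)
    also have "\<dots> = E v"
      unfolding E_def by (rule integral_env_step[OF m b])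
    finally show ?thesis .
  qed
  have "\<exists>v\<in>S. E v < d + (1/4)^k" for k :: nat
  proof -
    have "Inf (E ` S) < d + (1/4)^k"
      by (simp add: d_def)
    then show ?thesis
      using gS by (subst (asm) cInf_less_iff) (auto intro!: bdd_belowI[of _ 0] E_nonneg)
  qed
  then obtain v where vS: "\<And>k. v k \<in> S" and vE: "\<And>k::nat. E (v k) < d + (1/4)^k"
    by metis
  note vm [measurable] = Sm[OF vS]
  have vb: "\<bar>v k \<omega>\<bar> \<le> C" if "\<omega> \<in> space M" for k \<omega>
    using Sb[OF vS that] .
  have arith: "x \<le> 2 * (a' - d) + 2 * (a - d) \<Longrightarrow> a < d + t \<Longrightarrow> a' < d + t' \<Longrightarrow> t' \<le> t \<Longrightarrow> x \<le> 4 * t"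
    for x a a' t t' :: real
    by (simp add: algebra_simps)
  have diff2: "(\<integral>\<omega>. (v (Suc k) \<omega> - v k \<omega>)\<^sup>2 \<partial>M) \<le> 4 * (1/4)^k" for k
  proof -
    have "(1/4::real)^Suc k \<le> (1/4)^k"
      by simp
    then show ?thesis
      by (rule arith[OF close[OF vS vS] vE vE])
  qed
  \<comment> \<open>The \<open>L\<^sup>1\<close> norms of the increments are summable, so the sequence converges almost surely.\<close>
  have diff1: "(\<integral>\<omega>. \<bar>v (Suc k) \<omega> - v k \<omega>\<bar> \<partial>M) \<le> 3 * (1/2)^k" for k
  proof -
    \<comment> \<open>The AM-GM inequality with weight \<open>2^k\<close>, the inverse order of magnitude of the increment.\<close>
    have ptw: "\<bar>x\<bar> \<le> (1/2)^k + 2^k * x\<^sup>2 / 2" for x :: real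
    proof -
      have "0 \<le> (2^k * \<bar>x\<bar> - 1)\<^sup>2"
        by simp
      then have "2 * 2^k * \<bar>x\<bar> \<le> 2^k * (2^k * x\<^sup>2) + 1"
        by (simp add: power2_eq_square algebra_simps)
      then have "\<bar>x\<bar> \<le> 2^k * x\<^sup>2 / 2 + (1/2)^k / 2"
        by (simp add: power_divide field_simps)
      also have "(1/2::real)^k / 2 \<le> (1/2)^k"
        by simp
      finally show ?thesis
        by simp
    qed
    have b: "\<bar>v (Suc k) \<omega> - v k \<omega>\<bar> \<le> 2 * C" if "\<omega> \<in> space M" for \<omega>
      using vb[OF that, of k] vb[OF that, of "Suc k"] by linarith
    have i2: "integrable M (\<lambda>\<omega>. (v (Suc k) \<omega> - v k \<omega>)\<^sup>2)"
      by (rule integrable_bounded[of _ "(2 * C)\<^sup>2"], measurable) (rule abs2[OF b])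
    have i1: "integrable M (\<lambda>\<omega>. \<bar>v (Suc k) \<omega> - v k \<omega>\<bar>)"
      by (rule integrable_bounded[of _ "2 * C"]) (use b in auto)
    have "(\<integral>\<omega>. \<bar>v (Suc k) \<omega> - v k \<omega>\<bar> \<partial>M) \<le> (\<integral>\<omega>. (1/2)^k + 2^k * (v (Suc k) \<omega> - v k \<omega>)\<^sup>2 / 2 \<partial>M)"
      by (rule integral_mono) (use i1 i2 ptw in auto)
    also have "\<dots> = (1/2)^k + 2^k * (\<integral>\<omega>. (v (Suc k) \<omega> - v k \<omega>)\<^sup>2 \<partial>M) / 2"
      using i2 by (simp add: prob_space)
    also have "\<dots> \<le> (1/2)^k + 2^k * (4 * (1/4)^k) / 2"
      by (intro add_left_mono divide_right_mono mult_left_mono diff2) auto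
    also have "2^k * (4 * (1/4)^k) / 2 = (2 * (1/2)^k :: real)"
      by (simp add: power_divide power_mult_distrib[symmetric] field_simps)
    finally show ?thesis
      by simp
  qed
  have "AE \<omega> in M. convergent (\<lambda>k. v k \<omega>)"
  proof -
    have "(\<integral>\<^sup>+\<omega>. (\<Sum>k. ennreal \<bar>v (Suc k) \<omega> - v k \<omega>\<bar>) \<partial>M) = (\<Sum>k. \<integral>\<^sup>+\<omega>. ennreal \<bar>v (Suc k) \<omega> - v k \<omega>\<bar> \<partial>M)"
      by (rule nn_integral_suminf) measurable
    also have "\<dots> \<le> (\<Sum>k. ennreal (3 * (1/2)^k))"
    proof (rule suminf_le)
      fix k
      have b: "\<bar>v (Suc k) \<omega> - v k \<omega>\<bar> \<le> 2 * C" if "\<omega> \<in> space M" for \<omega>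
        using vb[OF that, of k] vb[OF that, of "Suc k"] by linarith
      have "integrable M (\<lambda>\<omega>. \<bar>v (Suc k) \<omega> - v k \<omega>\<bar>)"
        by (rule integrable_bounded[of _ "2 * C"]) (use b in auto)
      then show "(\<integral>\<^sup>+\<omega>. ennreal \<bar>v (Suc k) \<omega> - v k \<omega>\<bar> \<partial>M) \<le> ennreal (3 * (1/2)^k)"
        by (subst nn_integral_eq_integral) (auto intro: ennreal_leI diff1)
    qed auto
    also have "\<dots> < \<infinity>"
    proof -
      have "summable (\<lambda>k. 3 * (1/2::real)^k)"
        by (intro summable_mult summable_geometric) simp
      then show ?thesis
        by (simp add: suminf_ennreal_eq[OF _ summable_sums])
    qed
    finally have "AE \<omega> in M. (\<Sum>k. ennreal \<bar>v (Suc k) \<omega> - v k \<omega>\<bar>) \<noteq> \<infinity>"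
      by (intro nn_integral_PInf_AE) auto
    then show ?thesis
    proof eventually_elim
      case (elim \<omega>)
      have "summable (\<lambda>k. \<bar>v (Suc k) \<omega> - v k \<omega>\<bar>)"
        using elim by (intro summable_suminf_not_top) auto
      then have "summable (\<lambda>k. v (Suc k) \<omega> - v k \<omega>)"
        by (rule summable_rabs_cancel)
      then have "convergent (\<lambda>n. \<Sum>k<n. v (Suc k) \<omega> - v k \<omega>)"
        by (simp add: summable_iff_convergent)
      then have "convergent (\<lambda>n. (\<Sum>k<n. v (Suc k) \<omega> - v k \<omega>) + v 0 \<omega>)"
        by (intro convergent_add convergent_const)
      then show ?case
        by (simp add: sum_lessThan_telescope[of "\<lambda>k. v k \<omega>"])
    qed
  qed
  \<comment> \<open>Truncation keeps \<open>f\<close> bounded also where the sequence diverges.\<close>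
  define f where "f \<omega> = max (-C) (min C (lim (\<lambda>k. v k \<omega>)))" for \<omega>
  have fm [measurable]: "f \<in> borel_measurable M"
    unfolding f_def[abs_def] by measurable
  have fb: "\<bar>f \<omega>\<bar> \<le> C" for \<omega>
    using C by (auto simp: f_def)
  have lim: "AE \<omega> in M. (\<lambda>k. v k \<omega>) \<longlonglongrightarrow> f \<omega>"
    using \<open>AE \<omega> in M. convergent (\<lambda>k. v k \<omega>)\<close> AE_space
  proof eventually_elim
    case (elim \<omega>)
    then have L: "(\<lambda>k. v k \<omega>) \<longlonglongrightarrow> lim (\<lambda>k. v k \<omega>)"
      by (simp add: convergent_LIMSEQ_iff)
    have "lim (\<lambda>k. v k \<omega>) \<le> C"
      by (rule LIMSEQ_le_const2[OF L]) (use vb[OF elim(2)] in \<open>auto simp: abs_le_iff\<close>)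
    moreover have "-C \<le> lim (\<lambda>k. v k \<omega>)"
      by (rule LIMSEQ_le_const[OF L]) (use vb[OF elim(2)] in \<open>auto simp: abs_le_iff; smt\<close>)
    ultimately show ?case
      using L by (simp add: f_def)
  qed
  have lim_step: "AE \<omega> in M. (\<lambda>k. env_step (v k) \<omega>) \<longlonglongrightarrow> env_step f \<omega>"
  proof -
    have "AE \<omega> in M. \<forall>z. (\<lambda>k. v k (\<tau> z \<omega>)) \<longlonglongrightarrow> f (\<tau> z \<omega>)"
      by (subst AE_all_countable) (intro allI AE_action lim)
    then show ?thesis
      by eventually_elim (auto simp: env_step_def intro!: tendsto_intros)
  qed
  have "(\<lambda>k. \<integral>\<omega>. (v k \<omega> - env_step (v k) \<omega>)\<^sup>2 \<partial>M) \<longlonglongrightarrow> (\<integral>\<omega>. (f \<omega> - env_step f \<omega>)\<^sup>2 \<partial>M)"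
  proof (rule integral_dominated_convergence[where w="\<lambda>_. (2 * C)\<^sup>2"])
    show "AE \<omega> in M. (\<lambda>k. (v k \<omega> - env_step (v k) \<omega>)\<^sup>2) \<longlonglongrightarrow> (f \<omega> - env_step f \<omega>)\<^sup>2"
      using lim lim_step by eventually_elim (intro tendsto_intros)
    show "AE \<omega> in M. norm ((v k \<omega> - env_step (v k) \<omega>)\<^sup>2) \<le> (2 * C)\<^sup>2" for k
      using AE_space
    proof eventually_elim
      case (elim \<omega>)
      then have "\<bar>v k \<omega> - env_step (v k) \<omega>\<bar> \<le> 2 * C"
        using vb[OF elim, of k] Sb[OF step_S[OF vS] elim, of k] by linarith
      then show ?case
        using abs2[of "v k \<omega> - env_step (v k) \<omega>" "2 * C"] by simp
    qed
  qed auto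
  \<comment> \<open>Both \<open>v k\<close> and \<open>env_step (v k)\<close> are almost minimal, hence close to each other.\<close>
  moreover have "(\<lambda>k. \<integral>\<omega>. (v k \<omega> - env_step (v k) \<omega>)\<^sup>2 \<partial>M) \<longlonglongrightarrow> 0"
  proof (rule tendsto_sandwich[OF always_eventually always_eventually tendsto_const])
    show "\<forall>k. (\<integral>\<omega>. (v k \<omega> - env_step (v k) \<omega>)\<^sup>2 \<partial>M) \<le> 4 * (1/4)^k"
    proof
      fix k
      have "(\<integral>\<omega>. (v k \<omega> - env_step (v k) \<omega>)\<^sup>2 \<partial>M) \<le> 2 * (E (v k) - d) + 2 * (E (env_step (v k)) - d)"
        by (rule close[OF vS step_S[OF vS]])
      then show "(\<integral>\<omega>. (v k \<omega> - env_step (v k) \<omega>)\<^sup>2 \<partial>M) \<le> 4 * (1/4)^k"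
        by (rule arith[OF _ le_less_trans[OF E_step[OF vS] vE] vE order_refl])
    qed
    have "(\<lambda>k. (1/4::real)^k) \<longlonglongrightarrow> 0"
      by (rule LIMSEQ_power_zero) simp
    then show "(\<lambda>k. 4 * (1/4::real)^k) \<longlonglongrightarrow> 0"
      using tendsto_mult_right_zero by blast
  qed simp
  ultimately have "(\<integral>\<omega>. (f \<omega> - env_step f \<omega>)\<^sup>2 \<partial>M) = 0"
    using LIMSEQ_unique by blast
  moreover have "integrable M (\<lambda>\<omega>. (f \<omega> - env_step f \<omega>)\<^sup>2)"
  proof (rule integrable_bounded[of _ "(2 * C)\<^sup>2"])
    fix \<omega> assume w: "\<omega> \<in> space M"
    have "\<bar>f \<omega> - env_step f \<omega>\<bar> \<le> 2 * C"
      using fb[of \<omega>] env_step_bounded[of f C, OF fb w] by linarith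
    then show "\<bar>(f \<omega> - env_step f \<omega>)\<^sup>2\<bar> \<le> (2 * C)\<^sup>2"
      using abs2[of "f \<omega> - env_step f \<omega>" "2 * C"] by simp
  qed measurable
  ultimately have "AE \<omega> in M. (f \<omega> - env_step f \<omega>)\<^sup>2 = 0"
    using integral_nonneg_eq_0_iff_AE[of M "\<lambda>\<omega>. (f \<omega> - env_step f \<omega>)\<^sup>2"] by simp
  then have "AE \<omega> in M. env_step f \<omega> = f \<omega>"
    by eventually_elim simp
  then have f_const: "AE \<omega> in M. f \<omega> = (\<integral>\<omega>. f \<omega> \<partial>M)"
    by (rule AE_eq_expectation_if_env_step_invariant[of f C, OF fm fb])
  have "(\<lambda>k. \<integral>\<omega>. v k \<omega> \<partial>M) \<longlonglongrightarrow> (\<integral>\<omega>. f \<omega> \<partial>M)"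
    by (rule integral_dominated_convergence[where w="\<lambda>_. C"]) (use lim vb in \<open>auto intro!: AE_I2\<close>)
  moreover have "(\<integral>\<omega>. v k \<omega> \<partial>M) = 0" for k
  proof -
    obtain h B where h [measurable]: "h \<in> borel_measurable M" and hb: "\<And>\<omega>. \<omega> \<in> space M \<Longrightarrow> \<bar>h \<omega>\<bar> \<le> B"
      and eq: "\<And>\<omega>. \<omega> \<in> space M \<Longrightarrow> v k \<omega> = g \<omega> - (h \<omega> - env_step h \<omega>)"
      using vS[of k] by (rule SE) blast
    have "(\<integral>\<omega>. v k \<omega> \<partial>M) = (\<integral>\<omega>. g \<omega> - (h \<omega> - env_step h \<omega>) \<partial>M)"
      by (rule Bochner_Integration.integral_cong) (simp_all add: eq)
    moreover have "integrable M g" "integrable M h" "integrable M (env_step h)"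
      by (rule integrable_bounded[OF _ gb] integrable_bounded[OF _ hb]
          integrable_bounded[OF _ env_step_bounded[OF hb]]; simp)+
    ultimately show ?thesis
      using g0 integral_env_step[OF h hb] by simp
  qed
  ultimately have "(\<integral>\<omega>. f \<omega> \<partial>M) = 0"
    by (simp add: LIMSEQ_const_iff)
  then have f0: "AE \<omega> in M. f \<omega> = 0"
    using f_const by simp
  have "(\<lambda>k. E (v k)) \<longlonglongrightarrow> (\<integral>\<omega>. 0 \<partial>M)"
    unfolding E_def
  proof (rule integral_dominated_convergence[where w="\<lambda>_. C\<^sup>2"])
    show "AE \<omega> in M. (\<lambda>k. (v k \<omega>)\<^sup>2) \<longlonglongrightarrow> 0"
      using lim f0
    proof eventually_elim
      case (elim \<omega>)
      then have "(\<lambda>k. (v k \<omega>)\<^sup>2) \<longlonglongrightarrow> 0\<^sup>2"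
        by (intro tendsto_intros) simp
      then show ?case
        by simp
    qed
    show "AE \<omega> in M. norm ((v k \<omega>)\<^sup>2) \<le> C\<^sup>2" for k
      using AE_space by eventually_elim (simp add: abs2[OF vb, simplified])
  qed auto
  then have "eventually (\<lambda>k. E (v k) < e) sequentially"
    using e by (intro order_tendstoD(2)) auto
  then obtain k where k: "E (v k) < e"
    using eventually_happens by force
  obtain h B where h: "h \<in> borel_measurable M" and hb: "\<And>\<omega>. \<omega> \<in> space M \<Longrightarrow> \<bar>h \<omega>\<bar> \<le> B"
    and eq: "\<And>\<omega>. \<omega> \<in> space M \<Longrightarrow> v k \<omega> = g \<omega> - (h \<omega> - env_step h \<omega>)"
    using vS[of k] by (rule SE) blast
  have "(\<integral>\<omega>. (g \<omega> - (h \<omega> - env_step h \<omega>))\<^sup>2 \<partial>M) = E (v k)"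
    unfolding E_def by (rule Bochner_Integration.integral_cong) (simp_all add: eq)
  with k show thesis
    by (intro that[OF h hb]) auto
qed

end

section \<open>Homogenisation along the walk\<close>

context bounded_range_environment
begin

text \<open>
  The Markov operator of the pair (environment seen from the walker, position): by covariance the
  walk at the site \<open>x\<close> of \<open>\<omega>\<close> jumps as the walk at the origin of \<open>\<tau> x \<omega>\<close>. Thus \<open>(step ^^ n) F \<omega> 0\<close> is the
  expectation of \<open>F (\<tau> (X n) \<omega>) (X n)\<close> for the walk in the environment \<open>\<omega>\<close>.
\<close>

definition step :: "('w \<Rightarrow> int ^ 'd \<Rightarrow> real) \<Rightarrow> 'w \<Rightarrow> int ^ 'd \<Rightarrow> real"
  where "step F \<omega> x = (\<Sum>z\<in>\<Lambda>. p \<omega> 0 z * F (\<tau> z \<omega>) (x + z))"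

text \<open>
  The bound may depend on the position, because the logarithmic potential is unbounded on the
  lattice; with finitely many jumps the class is still stable under \<open>step\<close>.
\<close>

definition observable :: "('w \<Rightarrow> int ^ 'd \<Rightarrow> real) \<Rightarrow> bool"
  where "observable F \<longleftrightarrow>
    (\<forall>x. (\<lambda>\<omega>. F \<omega> x) \<in> borel_measurable M \<and> (\<exists>C. \<forall>\<omega>\<in>space M. \<bar>F \<omega> x\<bar> \<le> C))"

text \<open>
  The expectation of \<open>F (\<tau> (X n) \<omega>) (X n)\<close> under the annealed law, where the environment is random too.
\<close>

definition walk_mean :: "nat \<Rightarrow> ('w \<Rightarrow> int ^ 'd \<Rightarrow> real) \<Rightarrow> real"
  where "walk_mean n F = (\<integral>\<omega>. (step ^^ n) F \<omega> 0 \<partial>M)"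

lemma observableI:
  "(\<And>x. (\<lambda>\<omega>. F \<omega> x) \<in> borel_measurable M) \<Longrightarrow> (\<And>x \<omega>. \<omega> \<in> space M \<Longrightarrow> \<bar>F \<omega> x\<bar> \<le> C x) \<Longrightarrow> observable F"
  unfolding observable_def by blast

lemma observable_integrable: "observable F \<Longrightarrow> integrable M (\<lambda>\<omega>. F \<omega> x)"
  unfolding observable_def by (meson integrable_bounded)

lemma observable_step:
  assumes "observable F"
  shows "observable (step F)"
proof -
  have m: "(\<lambda>\<omega>. F \<omega> x) \<in> borel_measurable M" for x
    using assms by (simp add: observable_def)
  have [measurable]: "(\<lambda>\<omega>. F (\<tau> z \<omega>) x) \<in> borel_measurable M" for z x
    using measurable_compose[OF measurable_action m] .
  note measurable_env [measurable]
  obtain C where C: "\<And>x \<omega>. \<omega> \<in> space M \<Longrightarrow> \<bar>F \<omega> x\<bar> \<le> C x"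
    using assms unfolding observable_def by metis
  show ?thesis
  proof (rule observableI[where C="\<lambda>x. \<Sum>z\<in>\<Lambda>. C (x + z)"])
    show "(\<lambda>\<omega>. step F \<omega> x) \<in> borel_measurable M" for x
      unfolding step_def by measurable
    fix x \<omega> assume w: "\<omega> \<in> space M"
    have "\<bar>F (\<tau> z \<omega>) (x + z)\<bar> \<le> (\<Sum>z\<in>\<Lambda>. C (x + z))" if z: "z \<in> \<Lambda>" for z
    proof -
      have "0 \<le> C y" for y
        using C[OF w, of y] by linarith
      then have "C (x + z) \<le> (\<Sum>z\<in>\<Lambda>. C (x + z))"
        using z finite_jumps by (intro member_le_sum) auto
      then show ?thesis
        using C[of "\<tau> z \<omega>" "x + z"] w by simp
    qed
    then show "\<bar>step F \<omega> x\<bar> \<le> (\<Sum>z\<in>\<Lambda>. C (x + z))"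
      unfolding step_def by (rule average_abs_le[OF w])
  qed
qed

lemma observable_iter: "observable F \<Longrightarrow> observable ((step ^^ n) F)"
  by (induction n) (auto intro: observable_step)

lemma observable_add: "observable F \<Longrightarrow> observable G \<Longrightarrow> observable (\<lambda>\<omega> x. F \<omega> x + G \<omega> x)"
proof -
  assume F: "observable F" and G: "observable G"
  obtain C where C: "\<And>x \<omega>. \<omega> \<in> space M \<Longrightarrow> \<bar>F \<omega> x\<bar> \<le> C x"
    using F unfolding observable_def by metis
  obtain D where D: "\<And>x \<omega>. \<omega> \<in> space M \<Longrightarrow> \<bar>G \<omega> x\<bar> \<le> D x"
    using G unfolding observable_def by metis
  show ?thesis
  proof (rule observableI[where C="\<lambda>x. C x + D x"])
    show "(\<lambda>\<omega>. F \<omega> x + G \<omega> x) \<in> borel_measurable M" for x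
      using F G by (auto simp: observable_def intro!: borel_measurable_add)
    show "\<bar>F \<omega> x + G \<omega> x\<bar> \<le> C x + D x" if "\<omega> \<in> space M" for \<omega> x
      using C[OF that, of x] D[OF that, of x] by linarith
  qed
qed

lemma observable_product:
  assumes "g \<in> borel_measurable M" "\<And>\<omega>. \<omega> \<in> space M \<Longrightarrow> \<bar>g \<omega>\<bar> \<le> B"
  shows "observable (\<lambda>\<omega> x. g \<omega> * \<Phi> x)"
  by (rule observableI[where C="\<lambda>x. B * \<bar>\<Phi> x\<bar>"]) (use assms in \<open>auto simp: abs_mult intro!: mult_right_mono\<close>)

lemma observable_function: "observable (\<lambda>_ x. \<Phi> x)"
  by (rule observableI[where C="\<lambda>x. \<bar>\<Phi> x\<bar>"]) auto

lemma observable_scale: "observable F \<Longrightarrow> observable (\<lambda>\<omega> x. c * F \<omega> x)"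
proof -
  assume F: "observable F"
  obtain C where C: "\<And>x \<omega>. \<omega> \<in> space M \<Longrightarrow> \<bar>F \<omega> x\<bar> \<le> C x"
    using F unfolding observable_def by metis
  show ?thesis
    by (rule observableI[where C="\<lambda>x. \<bar>c\<bar> * C x"])
      (use F C in \<open>auto simp: observable_def abs_mult intro!: mult_left_mono borel_measurable_times\<close>)
qed

lemma observable_sum:
  "finite I \<Longrightarrow> (\<And>i. i \<in> I \<Longrightarrow> observable (F i)) \<Longrightarrow> observable (\<lambda>\<omega> x. \<Sum>i\<in>I. F i \<omega> x)"
  by (induction I rule: finite_induct) (auto intro: observable_add observable_function)

lemma step_mono:
  assumes "\<And>\<omega> x. \<omega> \<in> space M \<Longrightarrow> F \<omega> x \<le> G \<omega> x" "\<omega> \<in> space M"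
  shows "step F \<omega> x \<le> step G \<omega> x"
  unfolding step_def by (intro sum_mono mult_left_mono assms nonneg action_in_space)

lemma iter_mono:
  assumes "\<And>\<omega> x. \<omega> \<in> space M \<Longrightarrow> F \<omega> x \<le> G \<omega> x" "\<omega> \<in> space M"
  shows "(step ^^ n) F \<omega> x \<le> (step ^^ n) G \<omega> x"
  using assms(2) by (induction n arbitrary: \<omega> x) (auto intro: assms(1) step_mono)

lemma iter_add: "(step ^^ n) (\<lambda>\<omega> x. F \<omega> x + G \<omega> x) = (\<lambda>\<omega> x. (step ^^ n) F \<omega> x + (step ^^ n) G \<omega> x)"
  by (induction n) (simp_all add: step_def fun_eq_iff sum.distrib algebra_simps)

lemma iter_scale: "(step ^^ n) (\<lambda>\<omega> x. c * F \<omega> x) = (\<lambda>\<omega> x. c * (step ^^ n) F \<omega> x)"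
  by (induction n) (simp_all add: step_def fun_eq_iff sum_distrib_left algebra_simps)

lemma iter_zero: "(step ^^ n) (\<lambda>\<omega> x. 0) = (\<lambda>\<omega> x. 0)"
  by (induction n) (simp_all add: step_def fun_eq_iff)

lemma iter_sum: "finite I \<Longrightarrow> (step ^^ n) (\<lambda>\<omega> x. \<Sum>i\<in>I. F i \<omega> x) = (\<lambda>\<omega> x. \<Sum>i\<in>I. (step ^^ n) (F i) \<omega> x)"
  by (induction I rule: finite_induct) (simp_all add: iter_zero iter_add)

lemma iter_translate: "(step ^^ n) (\<lambda>\<omega> x. F \<omega> (x + a)) \<omega> x = (step ^^ n) F \<omega> (x + a)"
  by (induction n arbitrary: \<omega> x) (simp_all add: step_def add_ac)

lemma iter_environment: "(step ^^ n) (\<lambda>\<omega> x. g \<omega>) \<omega> x = (env_step ^^ n) g \<omega>"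
  by (induction n arbitrary: \<omega> x) (simp_all add: step_def env_step_def)

lemma walk_mean_0: "walk_mean 0 F = (\<integral>\<omega>. F \<omega> 0 \<partial>M)"
  by (simp add: walk_mean_def)

lemma walk_mean_Suc: "walk_mean (Suc n) F = walk_mean n (step F)"
  by (simp add: walk_mean_def funpow_swap1)

lemma walk_mean_mono:
  assumes "observable F" "observable G" "\<And>\<omega> x. \<omega> \<in> space M \<Longrightarrow> F \<omega> x \<le> G \<omega> x"
  shows "walk_mean n F \<le> walk_mean n G"
  unfolding walk_mean_def
  by (intro integral_mono observable_integrable observable_iter iter_mono assms)

lemma walk_mean_add:
  "observable F \<Longrightarrow> observable G \<Longrightarrow> walk_mean n (\<lambda>\<omega> x. F \<omega> x + G \<omega> x) = walk_mean n F + walk_mean n G"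
  unfolding walk_mean_def
  by (simp add: iter_add observable_integrable observable_iter)

lemma walk_mean_scale: "walk_mean n (\<lambda>\<omega> x. c * F \<omega> x) = c * walk_mean n F"
  unfolding walk_mean_def by (simp add: iter_scale)

lemma walk_mean_sum:
  "finite I \<Longrightarrow> (\<And>i. i \<in> I \<Longrightarrow> observable (F i)) \<Longrightarrow>
    walk_mean n (\<lambda>\<omega> x. \<Sum>i\<in>I. F i \<omega> x) = (\<Sum>i\<in>I. walk_mean n (F i))"
  unfolding walk_mean_def by (simp add: iter_sum observable_integrable observable_iter)

lemma walk_mean_environment:
  assumes g: "g \<in> borel_measurable M" and b: "\<And>\<omega>. \<omega> \<in> space M \<Longrightarrow> \<bar>g \<omega>\<bar> \<le> C"
  shows "walk_mean n (\<lambda>\<omega> x. g \<omega>) = (\<integral>\<omega>. g \<omega> \<partial>M)"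
proof -
  have "(env_step ^^ n) g \<in> borel_measurable M \<and> (\<forall>\<omega>\<in>space M. \<bar>(env_step ^^ n) g \<omega>\<bar> \<le> C) \<and>
    (\<integral>\<omega>. (env_step ^^ n) g \<omega> \<partial>M) = (\<integral>\<omega>. g \<omega> \<partial>M)"
  proof (induction n)
    case (Suc n)
    then show ?case
      using integral_env_step[of "(env_step ^^ n) g" C] by (auto intro: env_step_bounded)
  qed (use assms in auto)
  then show ?thesis
    by (simp add: walk_mean_def iter_environment)
qed

lemma walk_mean_const: "walk_mean n (\<lambda>_ _. c) = c"
  using walk_mean_environment[of "\<lambda>_. c" "\<bar>c\<bar>"] by (simp add: prob_space)

lemma walk_mean_abs_le:
  assumes F: "observable F" and g: "g \<in> borel_measurable M" and b: "\<And>\<omega>. \<omega> \<in> space M \<Longrightarrow> \<bar>g \<omega>\<bar> \<le> C"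
    and le: "\<And>\<omega> x. \<omega> \<in> space M \<Longrightarrow> \<bar>F \<omega> x\<bar> \<le> g \<omega>"
  shows "\<bar>walk_mean n F\<bar> \<le> (\<integral>\<omega>. g \<omega> \<partial>M)"
proof -
  have G: "observable (\<lambda>\<omega> x. g \<omega>)" and G': "observable (\<lambda>\<omega> x. (-1) * g \<omega>)"
    by (rule observableI[where C="\<lambda>_. C"]; use g b in auto)+
  have "F \<omega> x \<le> g \<omega>" "(-1) * g \<omega> \<le> F \<omega> x" if "\<omega> \<in> space M" for \<omega> x
    using le[OF that, of x] by auto
  then have "walk_mean n F \<le> walk_mean n (\<lambda>\<omega> x. g \<omega>)" "walk_mean n (\<lambda>\<omega> x. (-1) * g \<omega>) \<le> walk_mean n F"
    by (intro walk_mean_mono F G G'; blast)+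
  moreover have "walk_mean n (\<lambda>\<omega> x. g \<omega>) = (\<integral>\<omega>. g \<omega> \<partial>M)"
    by (rule walk_mean_environment[OF g]) (rule b)
  ultimately show ?thesis
    unfolding walk_mean_scale by (simp add: abs_le_iff)
qed

text \<open>
  Homogenisation: in time averages against a test function \<open>\<Phi>\<close> of the position that varies little
  in one jump, a function \<open>g\<close> of the environment may be replaced by its mean. For a
  coboundary \<open>h - env_step h\<close> the sum over time telescopes up to the variation \<open>D\<close> of \<open>\<Phi>\<close> in each
  jump, and the small remainder is controlled by stationarity. The constant \<open>H\<close> does not depend on
  \<open>\<Phi>\<close>, so the estimate can be used for test functions at every scale.
\<close>

lemma walk_mean_average:
  assumes g [measurable]: "g \<in> borel_measurable M" and gb: "\<And>\<omega>. \<omega> \<in> space M \<Longrightarrow> \<bar>g \<omega>\<bar> \<le> K"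
    and \<eta>: "\<eta> > 0"
  obtains H where "H \<ge> 0"
    "\<And>\<Phi> C D m. (\<And>x. \<bar>\<Phi> x\<bar> \<le> C) \<Longrightarrow> (\<And>x z. z \<in> \<Lambda> \<Longrightarrow> \<bar>\<Phi> (x + z) - \<Phi> x\<bar> \<le> D) \<Longrightarrow>
      \<bar>\<Sum>n<m. walk_mean n (\<lambda>\<omega> x. (g \<omega> - (\<integral>\<omega>. g \<omega> \<partial>M)) * \<Phi> x)\<bar> \<le> 2 * H * C + real m * H * D + real m * \<eta> * C"
proof -
  define g0 where "g0 \<omega> = g \<omega> - (\<integral>\<omega>. g \<omega> \<partial>M)" for \<omega>
  have g0m [measurable]: "g0 \<in> borel_measurable M"
    unfolding g0_def[abs_def] by measurable
  have intg: "integrable M g"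
    using g gb by (rule integrable_bounded)
  define K0 where "K0 = K + \<bar>\<integral>\<omega>. g \<omega> \<partial>M\<bar>"
  have g0b: "\<bar>g0 \<omega>\<bar> \<le> K0" if "\<omega> \<in> space M" for \<omega>
    using gb[OF that] unfolding g0_def K0_def by linarith
  have "(\<integral>\<omega>. g0 \<omega> \<partial>M) = 0"
    unfolding g0_def using intg by (simp add: prob_space)
  then obtain h B where hm [measurable]: "h \<in> borel_measurable M"
    and hB: "\<And>\<omega>. \<omega> \<in> space M \<Longrightarrow> \<bar>h \<omega>\<bar> \<le> B"
    and small: "(\<integral>\<omega>. (g0 \<omega> - (h \<omega> - env_step h \<omega>))\<^sup>2 \<partial>M) \<le> \<eta>\<^sup>2"
    using mean_ergodic[OF g0m g0b, of "\<eta>\<^sup>2"] \<eta> by (metis zero_less_power)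
  have B: "0 \<le> B"
    using hB not_empty by force
  note sb = env_step_bounded[of h B, OF hB]
  define r where "r \<omega> = g0 \<omega> - (h \<omega> - env_step h \<omega>)" for \<omega>
  have rm [measurable]: "r \<in> borel_measurable M"
    unfolding r_def[abs_def] by measurable
  have rb: "\<bar>r \<omega>\<bar> \<le> K0 + 2 * B" if "\<omega> \<in> space M" for \<omega>
    using g0b[OF that] hB[OF that] sb[OF _ that] unfolding r_def by (simp; linarith)
  have r2: "integrable M (\<lambda>\<omega>. (r \<omega>)\<^sup>2)"
  proof (rule integrable_bounded[of _ "(K0 + 2 * B)\<^sup>2"])
    show "\<bar>(r \<omega>)\<^sup>2\<bar> \<le> (K0 + 2 * B)\<^sup>2" if "\<omega> \<in> space M" for \<omega>
      using power_mono[OF rb[OF that], of 2] by simp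
  qed measurable
  have r1: "(\<integral>\<omega>. \<bar>r \<omega>\<bar> \<partial>M) \<le> \<eta>"
  proof -
    have ptw: "\<bar>x\<bar> \<le> \<eta> / 2 + x\<^sup>2 / (2 * \<eta>)" for x :: real
    proof -
      have "0 \<le> (\<bar>x\<bar> - \<eta>)\<^sup>2"
        by simp
      then have "2 * \<eta> * \<bar>x\<bar> \<le> \<eta>\<^sup>2 + x\<^sup>2"
        by (simp add: power2_eq_square algebra_simps)
      then show ?thesis
        using \<eta> by (simp add: field_simps power2_eq_square)
    qed
    have "(\<integral>\<omega>. \<bar>r \<omega>\<bar> \<partial>M) \<le> (\<integral>\<omega>. \<eta> / 2 + (r \<omega>)\<^sup>2 / (2 * \<eta>) \<partial>M)"
      by (rule integral_mono) (use r2 ptw integrable_bounded[of "\<lambda>\<omega>. \<bar>r \<omega>\<bar>" "K0 + 2 * B"] rb in auto)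
    also have "\<dots> = \<eta> / 2 + (\<integral>\<omega>. (r \<omega>)\<^sup>2 \<partial>M) / (2 * \<eta>)"
      using r2 by (simp add: prob_space)
    also have "\<dots> \<le> \<eta> / 2 + \<eta>\<^sup>2 / (2 * \<eta>)"
      using small \<eta> unfolding r_def by (intro add_left_mono divide_right_mono) auto
    also have "\<dots> = \<eta>"
      using \<eta> by (simp add: power2_eq_square)
    finally show ?thesis .
  qed
  show thesis
  proof (rule that[OF B])
    fix \<Phi> :: "int ^ 'd \<Rightarrow> real" and C D :: real and m :: nat
    assume \<Phi>C: "\<And>x. \<bar>\<Phi> x\<bar> \<le> C" and \<Phi>D: "\<And>x z. z \<in> \<Lambda> \<Longrightarrow> \<bar>\<Phi> (x + z) - \<Phi> x\<bar> \<le> D"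
    have C: "0 \<le> C"
      using \<Phi>C[of 0] by linarith
    let ?hF = "\<lambda>\<omega> x. h \<omega> * \<Phi> x"
    have hF: "observable ?hF"
      by (rule observable_product[OF hm hB])
    define R where "R \<omega> x = r \<omega> * \<Phi> x" for \<omega> x
    have R: "observable R"
      unfolding R_def[abs_def] by (rule observable_product[OF rm rb])
    define \<Delta> where "\<Delta> \<omega> x = env_step h \<omega> * \<Phi> x + (-1) * step ?hF \<omega> x" for \<omega> x
    have \<Delta>: "observable \<Delta>"
      unfolding \<Delta>_def[abs_def]
      by (intro observable_add observable_scale observable_step hF observable_product[where B=B])
        (use sb in auto)
    have \<Delta>b: "\<bar>\<Delta> \<omega> x\<bar> \<le> B * D" if w: "\<omega> \<in> space M" for \<omega> x
    proof -
      have "\<Delta> \<omega> x = (\<Sum>z\<in>\<Lambda>. p \<omega> 0 z * (h (\<tau> z \<omega>) * (\<Phi> x - \<Phi> (x + z))))"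
        unfolding \<Delta>_def step_def env_step_def
        by (simp add: sum_distrib_left sum_distrib_right sum_subtractf sum_negf algebra_simps)
      moreover have "\<bar>h (\<tau> z \<omega>) * (\<Phi> x - \<Phi> (x + z))\<bar> \<le> B * D" if z: "z \<in> \<Lambda>" for z
        unfolding abs_mult using \<Phi>D[OF z, of x] hB[of "\<tau> z \<omega>"] w B
        by (intro mult_mono) (auto simp: abs_minus_commute)
      ultimately show ?thesis
        using average_abs_le[OF w] by presburger
    qed
    have eq: "walk_mean n (\<lambda>\<omega> x. g0 \<omega> * \<Phi> x) =
      walk_mean n R + (walk_mean n ?hF - walk_mean (Suc n) ?hF) - walk_mean n \<Delta>" for n
    proof -
      have "(\<lambda>\<omega> x. g0 \<omega> * \<Phi> x) =
        (\<lambda>\<omega> x. R \<omega> x + (?hF \<omega> x + ((-1) * step ?hF \<omega> x + (-1) * \<Delta> \<omega> x)))"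
        by (simp add: fun_eq_iff R_def r_def \<Delta>_def algebra_simps)
      then show ?thesis
        by (simp only: walk_mean_add walk_mean_scale walk_mean_Suc R hF \<Delta> observable_add
            observable_scale observable_step)
    qed
    have tele: "(\<Sum>n<m. walk_mean n ?hF - walk_mean (Suc n) ?hF) = walk_mean 0 ?hF - walk_mean m ?hF"
      by (induction m) auto
    have "(\<Sum>n<m. walk_mean n (\<lambda>\<omega> x. g0 \<omega> * \<Phi> x)) =
      (\<Sum>n<m. walk_mean n R) + (walk_mean 0 ?hF - walk_mean m ?hF) - (\<Sum>n<m. walk_mean n \<Delta>)"
      unfolding eq sum_subtractf[symmetric] tele[symmetric] by (simp add: sum.distrib sum_subtractf)
    moreover have "\<bar>\<Sum>n<m. walk_mean n R\<bar> \<le> real m * \<eta> * C"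
    proof -
      have "\<bar>walk_mean n R\<bar> \<le> \<eta> * C" for n
      proof -
        have "\<bar>walk_mean n R\<bar> \<le> (\<integral>\<omega>. \<bar>r \<omega>\<bar> * C \<partial>M)"
        proof (rule walk_mean_abs_le[OF R])
          fix \<omega> assume w: "\<omega> \<in> space M"
          show "\<bar>\<bar>r \<omega>\<bar> * C\<bar> \<le> (K0 + 2 * B) * C"
            using mult_right_mono[OF rb[OF w] C] C by (simp add: abs_mult)
          show "\<bar>R \<omega> x\<bar> \<le> \<bar>r \<omega>\<bar> * C" for x
            unfolding R_def abs_mult by (intro mult_left_mono \<Phi>C) simp
        qed measurable
        also have "\<dots> \<le> \<eta> * C"
          using mult_right_mono[OF r1 C] by simp
        finally show ?thesis .
      qed
      then have "(\<Sum>n<m. \<bar>walk_mean n R\<bar>) \<le> (\<Sum>n<m. \<eta> * C)"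
        by (rule sum_mono)
      then have "\<bar>\<Sum>n<m. walk_mean n R\<bar> \<le> (\<Sum>n<m. \<eta> * C)"
        using sum_abs by (rule order_trans[rotated])
      then show ?thesis
        by (simp add: mult.assoc)
    qed
    moreover have "\<bar>walk_mean n ?hF\<bar> \<le> B * C" for n
    proof -
      have "\<bar>walk_mean n ?hF\<bar> \<le> (\<integral>\<omega>. B * C \<partial>M)"
      proof (rule walk_mean_abs_le[OF hF, where C="B * C"])
        show "\<bar>h \<omega> * \<Phi> x\<bar> \<le> B * C" if "\<omega> \<in> space M" for \<omega> x
          unfolding abs_mult by (intro mult_mono hB that \<Phi>C B) simp
      qed (use B C in auto)
      then show ?thesis
        by (simp add: prob_space)
    qed
    from this[of 0] this[of m] have "\<bar>walk_mean 0 ?hF - walk_mean m ?hF\<bar> \<le> 2 * B * C"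
      by linarith
    moreover have "\<bar>\<Sum>n<m. walk_mean n \<Delta>\<bar> \<le> real m * B * D"
    proof -
      have "\<bar>walk_mean n \<Delta>\<bar> \<le> B * D" for n
        using walk_mean_abs_le[OF \<Delta>, of "\<lambda>_. B * D" "\<bar>B * D\<bar>" n] \<Delta>b by (simp add: prob_space)
      then have "(\<Sum>n<m. \<bar>walk_mean n \<Delta>\<bar>) \<le> (\<Sum>n<m. B * D)"
        by (rule sum_mono)
      then have "\<bar>\<Sum>n<m. walk_mean n \<Delta>\<bar> \<le> (\<Sum>n<m. B * D)"
        using sum_abs by (rule order_trans[rotated])
      then show ?thesis
        by (simp add: mult.assoc)
    qed
    ultimately show "\<bar>\<Sum>n<m. walk_mean n (\<lambda>\<omega> x. (g \<omega> - (\<integral>\<omega>. g \<omega> \<partial>M)) * \<Phi> x)\<bar>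
        \<le> 2 * B * C + real m * B * D + real m * \<eta> * C"
      unfolding g0_def by linarith
  qed
qed

end

section \<open>Occupation times and the Green function\<close>

context bounded_range_environment
begin

text \<open>
  The probability that the walk in the environment \<open>\<omega>\<close> is at the origin at time \<open>n\<close>.
\<close>

definition return_prob :: "nat \<Rightarrow> 'w \<Rightarrow> real"
  where "return_prob n \<omega> = (step ^^ n) (\<lambda>_ x. of_bool (x = 0)) \<omega> 0"

text \<open>
  A maximum principle. The expected time spent at \<open>y\<close>, counted only if the environment seen from
  \<open>y\<close> lies in \<open>A\<close>, is harmonic off the set where it is counted, so it is largest for a walk started
  at \<open>y\<close> itself with the environment in \<open>A\<close>; there it is at most a truncated Green function at the
  origin, which \<open>K\<close> bounds.
\<close>

lemma occupation_le:
  assumes A: "\<And>\<omega> N. \<omega> \<in> A \<Longrightarrow> (\<Sum>n<N. return_prob n \<omega>) \<le> K" and K: "0 \<le> K"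
    and w: "\<omega> \<in> space M"
  shows "(\<Sum>n<N. (step ^^ n) (\<lambda>\<omega> x. indicator A \<omega> * of_bool (x = y)) \<omega> x) \<le> K"
  using w
proof (induction N arbitrary: \<omega> x)
  case (Suc N)
  define F :: "'w \<Rightarrow> int ^ 'd \<Rightarrow> real" where "F \<omega> x = indicator A \<omega> * of_bool (x = y)" for \<omega> x
  note IH = Suc.IH[folded F_def[abs_def]]
  show ?case
  proof (cases "\<omega> \<in> A \<and> x = y")
    case True
    have "(\<Sum>n<Suc N. (step ^^ n) F \<omega> x) \<le> (\<Sum>n<Suc N. (step ^^ n) (\<lambda>_ x. of_bool (x = y)) \<omega> x)"
      by (intro sum_mono iter_mono Suc.prems) (auto simp: F_def indicator_def)
    also have "\<dots> = (\<Sum>n<Suc N. return_prob n \<omega>)"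
    proof (rule sum.cong[OF refl])
      fix n
      show "(step ^^ n) (\<lambda>_ x. of_bool (x = y)) \<omega> x = return_prob n \<omega>"
        using iter_translate[of n "\<lambda>_ x. of_bool (x = y)" y \<omega> 0] True by (simp add: return_prob_def)
    qed
    also have "\<dots> \<le> K"
      using A True by blast
    finally show ?thesis
      by (simp only: F_def[abs_def])
  next
    case False
    then have F0: "F \<omega> x = 0"
      by (auto simp: F_def)
    have "(\<Sum>n<Suc N. (step ^^ n) F \<omega> x) = F \<omega> x + (\<Sum>n<N. step ((step ^^ n) F) \<omega> x)"
      by (subst sum.lessThan_Suc_shift) simp
    also have "\<dots> = (\<Sum>z\<in>\<Lambda>. p \<omega> 0 z * (\<Sum>n<N. (step ^^ n) F (\<tau> z \<omega>) (x + z)))"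
      unfolding F0 step_def[of "(step ^^ _) F"] sum_distrib_left by (subst sum.swap) simp
    also have "\<dots> \<le> K"
      by (rule average_le[OF Suc.prems]) (rule IH[OF action_in_space[OF Suc.prems]])
    finally show ?thesis
      by (simp only: F_def[abs_def])
  qed
qed (use K in simp)

text \<open>
  The displacements possible in exactly \<open>n\<close> jumps. Their finiteness reduces a test function of the
  position to a finite combination of indicators of sites.
\<close>

primrec reach :: "nat \<Rightarrow> (int ^ 'd) set"
  where "reach 0 = {0}"
  | "reach (Suc n) = (\<lambda>(z, b). z + b) ` (\<Lambda> \<times> reach n)"

lemma finite_reach: "finite (reach n)"
  by (induction n) (simp_all add: finite_jumps)

lemma iter_local:
  assumes "\<And>\<omega> b. \<omega> \<in> space M \<Longrightarrow> b \<in> reach n \<Longrightarrow> F \<omega> (x + b) = G \<omega> (x + b)" "\<omega> \<in> space M"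
  shows "(step ^^ n) F \<omega> x = (step ^^ n) G \<omega> x"
  using assms
proof (induction n arbitrary: \<omega> x)
  case 0
  then show ?case
    using "0.prems"(1)[of \<omega> 0] by simp
next
  case (Suc n)
  have "(step ^^ n) F (\<tau> z \<omega>) (x + z) = (step ^^ n) G (\<tau> z \<omega>) (x + z)" if "z \<in> \<Lambda>" for z
  proof (rule Suc.IH)
    fix \<omega> b assume "\<omega> \<in> space M" "b \<in> reach n"
    then show "F \<omega> (x + z + b) = G \<omega> (x + z + b)"
      using Suc.prems(1)[of \<omega> "z + b"] that by (force simp: add.assoc)
  qed (use Suc.prems in simp)
  then show ?case
    by (simp add: step_def[of "(step ^^ n) _"])
qed

text \<open>
  If the Green function were bounded on \<open>A\<close>, the walk would spread its time over the sites with
  environment in \<open>A\<close> with a density bounded by \<open>K\<close>, on every scale.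
\<close>

lemma walk_mean_occupation_le:
  assumes AM: "A \<in> sets M"
    and A: "\<And>\<omega> N. \<omega> \<in> A \<Longrightarrow> (\<Sum>n<N. return_prob n \<omega>) \<le> K" and K: "0 \<le> K"
    and \<psi>: "\<And>y. 0 \<le> \<psi> y" "\<And>B. finite B \<Longrightarrow> sum \<psi> B \<le> c"
  shows "(\<Sum>n<m. walk_mean n (\<lambda>\<omega> x. indicator A \<omega> * \<psi> x)) \<le> K * c"
proof -
  let ?B = "\<Union>n<m. reach n"
  have B: "finite ?B"
    by (simp add: finite_reach)
  let ?F = "\<lambda>y \<omega> x. indicator A \<omega> * of_bool (x = y) :: real"
  have F: "observable (?F y)" for y
    by (rule observable_product[of _ 1]) (use AM in \<open>auto simp: indicator_def\<close>)
  have bound: "(\<Sum>n<m. (step ^^ n) (\<lambda>\<omega> x. indicator A \<omega> * \<psi> x) \<omega> 0) \<le> K * c" if w: "\<omega> \<in> space M" for \<omega>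
  proof -
    have "(\<Sum>n<m. (step ^^ n) (\<lambda>\<omega> x. indicator A \<omega> * \<psi> x) \<omega> 0) =
      (\<Sum>n<m. (step ^^ n) (\<lambda>\<omega> x. \<Sum>y\<in>?B. \<psi> y * ?F y \<omega> x) \<omega> 0)"
    proof (rule sum.cong[OF refl], rule iter_local[OF _ w])
      fix n \<omega> b assume "n \<in> {..<m}" "b \<in> reach n"
      then have "b \<in> ?B"
        by blast
      have "(\<Sum>y\<in>?B. \<psi> y * ?F y \<omega> b) = (\<Sum>y\<in>?B. if b = y then indicator A \<omega> * \<psi> y else 0)"
        by (rule sum.cong) auto
      also have "\<dots> = indicator A \<omega> * \<psi> b"
        using \<open>b \<in> ?B\<close> by (subst sum.delta'[OF B]) auto
      finally show "indicator A \<omega> * \<psi> (0 + b) = (\<Sum>y\<in>?B. \<psi> y * ?F y \<omega> (0 + b))"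
        by simp
    qed
    also have "\<dots> = (\<Sum>n<m. \<Sum>y\<in>?B. \<psi> y * (step ^^ n) (?F y) \<omega> 0)"
      by (simp add: iter_sum[OF B] iter_scale)
    also have "\<dots> = (\<Sum>y\<in>?B. \<psi> y * (\<Sum>n<m. (step ^^ n) (?F y) \<omega> 0))"
      by (subst sum.swap) (simp add: sum_distrib_left)
    also have "\<dots> \<le> (\<Sum>y\<in>?B. \<psi> y * K)"
      by (intro sum_mono mult_left_mono \<psi>(1) occupation_le[OF A K w])
    also have "\<dots> = K * sum \<psi> ?B"
      by (simp add: sum_distrib_left mult.commute)
    also have "\<dots> \<le> K * c"
      by (intro mult_left_mono \<psi>(2) B K)
    finally show ?thesis .
  qed
  have obs: "observable (\<lambda>\<omega> x. indicator A \<omega> * \<psi> x)"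
    by (rule observable_product[of _ 1]) (use AM in \<open>auto simp: indicator_def\<close>)
  have int: "integrable M (\<lambda>\<omega>. (step ^^ n) (\<lambda>\<omega> x. indicator A \<omega> * \<psi> x) \<omega> 0)" for n
    by (intro observable_integrable observable_iter obs)
  have "(\<Sum>n<m. walk_mean n (\<lambda>\<omega> x. indicator A \<omega> * \<psi> x)) =
      (\<integral>\<omega>. (\<Sum>n<m. (step ^^ n) (\<lambda>\<omega> x. indicator A \<omega> * \<psi> x) \<omega> 0) \<partial>M)"
    unfolding walk_mean_def by (rule Bochner_Integration.integral_sum[symmetric]) (rule int)
  also have "\<dots> \<le> (\<integral>\<omega>. K * c \<partial>M)"
    by (rule integral_mono) (use int bound in auto)
  also have "\<dots> = K * c"
    by (simp add: prob_space)
  finally show ?thesis .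
qed

end

section \<open>A logarithmic potential\<close>

locale psd_form =
  fixes Q :: "'a::real_inner \<Rightarrow> 'a"
  assumes linear_form: "linear Q"
    and form_commute: "\<And>x y. Q x \<bullet> y = x \<bullet> Q y"
    and form_nonneg: "\<And>x. 0 \<le> x \<bullet> Q x"
begin

lemma form_add: "(x + y) \<bullet> Q (x + y) = x \<bullet> Q x + 2 * (x \<bullet> Q y) + y \<bullet> Q y"
  using linear_add[OF linear_form, of x y] form_commute[of x y]
  by (simp add: inner_add_left inner_add_right inner_commute)

lemma form_Cauchy_Schwarz: "(x \<bullet> Q y)\<^sup>2 \<le> (x \<bullet> Q x) * (y \<bullet> Q y)"
proof -
  define a b c where "a = x \<bullet> Q x" and "b = x \<bullet> Q y" and "c = y \<bullet> Q y"
  have quad: "0 \<le> a + 2 * t * b + t\<^sup>2 * c" for t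
    using form_nonneg[of "x + t *\<^sub>R y"] unfolding form_add
    by (simp add: linear_cmul[OF linear_form] a_def b_def c_def power2_eq_square)
  have "c \<ge> 0"
    unfolding c_def by (rule form_nonneg)
  then consider "c > 0" | "c = 0"
    by linarith
  then have "b\<^sup>2 \<le> a * c"
  proof cases
    case 1
    have "0 \<le> a + 2 * (- b / c) * b + (- b / c)\<^sup>2 * c"
      by (rule quad)
    also have "\<dots> = a - b\<^sup>2 / c"
      using 1 by (simp add: power2_eq_square field_simps)
    finally show ?thesis
      using 1 by (simp add: field_simps)
  next
    case 2
    have "b = 0"
    proof (rule ccontr)
      assume "b \<noteq> 0"
      \<comment> \<open>For \<open>c = 0\<close> the form is affine in \<open>t\<close>; this \<open>t\<close> gives it the value \<open>-1\<close>.\<close>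
      then show False
        using quad[of "- (a + 1) / (2 * b)"] 2 by (simp add: field_simps)
    qed
    then show ?thesis
      using 2 by simp
  qed
  then show ?thesis
    by (simp add: a_def b_def c_def)
qed

end

text \<open>
  The form given by the inverse \<open>Q\<close> of the covariance \<open>V v = \<Sum>i. c i * (w i \<bullet> v) * w i\<close>. The identity
  \<open>V \<circ> Q = id\<close> yields the average of \<open>(x \<bullet> Q w)\<^sup>2\<close> and, as the trace of \<open>V \<circ> Q\<close>, the average of
  \<open>w \<bullet> Q w\<close>; these two averages make the second-order term of the potential computable. The lower
  bound is the Cauchy-Schwarz inequality for \<open>Q\<close> applied to \<open>x\<close> and \<open>V x\<close>.
\<close>

lemma inverse_covariance:
  fixes w :: "'b \<Rightarrow> 'a::euclidean_space" and c :: "'b \<Rightarrow> real"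
  assumes I: "finite I" and c: "\<And>i. i \<in> I \<Longrightarrow> 0 \<le> c i"
    and nondeg: "\<And>v. (\<And>i. i \<in> I \<Longrightarrow> c i \<noteq> 0 \<Longrightarrow> w i \<bullet> v = 0) \<Longrightarrow> v = 0"
  obtains Q \<mu> where "psd_form Q" "\<And>x. (\<Sum>i\<in>I. c i * (x \<bullet> Q (w i))\<^sup>2) = x \<bullet> Q x"
    "(\<Sum>i\<in>I. c i * (w i \<bullet> Q (w i))) = DIM('a)" "\<mu> > 0" "\<And>x. \<mu> * (x \<bullet> x) \<le> x \<bullet> Q x"
proof -
  define V where "V v = (\<Sum>i\<in>I. (c i * (w i \<bullet> v)) *\<^sub>R w i)" for v
  have linV: "linear V"
    unfolding V_def[abs_def]
    by (intro linearI) (simp_all add: inner_add_right algebra_simps sum.distrib scaleR_sum_right)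
  have V: "x \<bullet> V y = (\<Sum>i\<in>I. c i * (w i \<bullet> x) * (w i \<bullet> y))" for x y
    unfolding V_def by (simp add: inner_sum_right inner_commute algebra_simps)
  have "inj V"
  proof (rule iffD2[OF linear_injective_0[OF linV]], intro allI impI)
    fix v assume "V v = 0"
    then have "v \<bullet> V v = 0"
      by simp
    then have "(\<Sum>i\<in>I. c i * (w i \<bullet> v)\<^sup>2) = 0"
      unfolding V by (simp add: power2_eq_square mult.assoc)
    then have "\<forall>i\<in>I. c i * (w i \<bullet> v)\<^sup>2 = 0"
      by (subst (asm) sum_nonneg_eq_0_iff[OF I]) (simp_all add: c)
    then show "v = 0"
      by (intro nondeg) auto
  qed
  then obtain Q where linQ: "linear Q" and QV: "\<And>x. Q (V x) = x" and VQ: "\<And>x. V (Q x) = x"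
    using linear_injective_isomorphism[OF linV] by blast
  have sym: "Q x \<bullet> y = x \<bullet> Q y" for x y
  proof -
    have "Q x \<bullet> V (Q y) = Q y \<bullet> V (Q x)"
      unfolding V by (simp add: mult.commute mult.left_commute)
    then show ?thesis
      by (simp add: VQ inner_commute)
  qed
  have energy: "(\<Sum>i\<in>I. c i * (x \<bullet> Q (w i))\<^sup>2) = x \<bullet> Q x" for x
  proof -
    have "(\<Sum>i\<in>I. c i * (x \<bullet> Q (w i))\<^sup>2) = Q x \<bullet> V (Q x)"
      unfolding V by (simp add: sym[symmetric] power2_eq_square mult.assoc inner_commute)
    then show ?thesis
      by (simp add: VQ sym)
  qed
  have psd: "psd_form Q"
    by (rule psd_form.intro) (use linQ sym in \<open>auto simp: energy[symmetric] intro!: sum_nonneg mult_nonneg_nonneg c\<close>)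
  have trace: "(\<Sum>i\<in>I. c i * (w i \<bullet> Q (w i))) = DIM('a)"
  proof -
    have "(\<Sum>i\<in>I. c i * (w i \<bullet> Q (w i))) = (\<Sum>i\<in>I. \<Sum>b\<in>Basis. c i * (w i \<bullet> b) * (w i \<bullet> Q b))"
      by (rule sum.cong[OF refl], subst euclidean_inner) (simp add: sum_distrib_left sym mult.assoc)
    also have "\<dots> = (\<Sum>b\<in>Basis. b \<bullet> V (Q b))"
      unfolding V by (subst sum.swap) simp
    also have "\<dots> = (\<Sum>b\<in>(Basis::'a set). 1)"
      by (rule sum.cong) (simp_all add: VQ)
    finally show ?thesis
      by simp
  qed
  define t where "t = (\<Sum>i\<in>I. c i * (w i \<bullet> w i)) + 1"
  have t: "t > 0"
    unfolding t_def by (intro add_nonneg_pos sum_nonneg mult_nonneg_nonneg c) auto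
  have lower: "(1 / t) * (x \<bullet> x) \<le> x \<bullet> Q x" for x
  proof (cases "x = 0")
    case True
    then show ?thesis
      using psd_form.form_nonneg[OF psd, of x] by simp
  next
    case False
    then have pos: "x \<bullet> x > 0"
      by simp
    have "x \<bullet> V x \<le> (\<Sum>i\<in>I. c i * ((w i \<bullet> w i) * (x \<bullet> x)))"
      unfolding V mult.assoc
      using Cauchy_Schwarz_ineq[of "w _" x] by (intro sum_mono mult_left_mono c) (simp add: power2_eq_square)
    also have "\<dots> = (t - 1) * (x \<bullet> x)"
      unfolding t_def by (simp add: sum_distrib_right mult.assoc)
    also have "\<dots> \<le> t * (x \<bullet> x)"
      using pos by (simp add: algebra_simps)
    finally have 1: "x \<bullet> V x \<le> t * (x \<bullet> x)" .
    have "(x \<bullet> x)\<^sup>2 \<le> (x \<bullet> Q x) * (V x \<bullet> x)"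
      using psd_form.form_Cauchy_Schwarz[OF psd, of x "V x"] by (simp add: QV)
    also have "\<dots> \<le> (x \<bullet> Q x) * (t * (x \<bullet> x))"
      using 1 by (intro mult_left_mono psd_form.form_nonneg[OF psd]) (simp add: inner_commute)
    finally have "x \<bullet> x \<le> (x \<bullet> Q x) * t"
      using pos by (simp add: power2_eq_square)
    then show ?thesis
      using t by (simp add: field_simps)
  qed
  show thesis
    using that[OF psd energy trace _ lower] t by simp
qed

text \<open>
  The right side minus the left side has the derivative \<open>z ^ 3 / (1 + z)\<close>, hence its minimum at zero. An upper
  bound suffices for the logarithmic potential, which has to be controlled from above.
\<close>

lemma ln_one_plus_le_cubic:
  fixes z :: real
  assumes "z > -1"
  shows "ln (1 + z) \<le> z - z\<^sup>2 / 2 + z ^ 3 / 3"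
proof -
  define f where "f z = z - z\<^sup>2 / 2 + z ^ 3 / 3 - ln (1 + z)" for z :: real
  have f: "(f has_real_derivative z ^ 3 / (1 + z)) (at z)" if "z > -1" for z
    unfolding f_def[abs_def] using that
    by (auto intro!: derivative_eq_intros simp: field_simps power2_eq_square power3_eq_cube)
  have "f 0 \<le> f z"
  proof (cases "z \<ge> 0")
    case True
    show ?thesis
    proof (rule DERIV_nonneg_imp_nondecreasing[OF True])
      fix x :: real assume "0 \<le> x" "x \<le> z"
      then show "\<exists>y. (f has_real_derivative y) (at x) \<and> 0 \<le> y"
        using f[of x] by (intro exI[of _ "x ^ 3 / (1 + x)"]) auto
    qed
  next
    case False
    show ?thesis
    proof (rule DERIV_nonpos_imp_nonincreasing[of z 0])
      fix x assume "z \<le> x" "x \<le> 0"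
      then show "\<exists>y. (f has_real_derivative y) (at x) \<and> y \<le> 0"
        using f[of x] assms by (intro exI[of _ "x ^ 3 / (1 + x)"]) (auto simp: divide_le_0_iff power3_eq_cube mult_le_0_iff)
    qed (use False in simp)
  qed
  then show ?thesis
    by (simp add: f_def)
qed

text \<open>
  The change of \<open>1 / T\<close> in one jump, when \<open>T\<close> changes by at most a multiple of its square root. The form with
  the factor \<open>sqrt T\<close> absorbs quantities that grow like the distance to the origin.
\<close>

lemma ratio_diff_bounds:
  fixes T T' s k :: real
  assumes k: "0 \<le> k" and s: "0 < s" and T: "s\<^sup>2 \<le> T" and T': "s\<^sup>2 \<le> T'"
    and diff: "\<bar>T' - T\<bar> \<le> 3 * k * sqrt T"
  shows "sqrt T * \<bar>1 / T' - 1 / T\<bar> \<le> 3 * k / s\<^sup>2" "\<bar>1 / T' - 1 / T\<bar> \<le> 3 * k / s ^ 3"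
proof -
  define R where "R = sqrt T"
  have "0 \<le> T"
    using T zero_le_power2[of s] by linarith
  then have R: "s \<le> R" "R * R = T"
    using T s by (auto simp: R_def intro: real_le_rsqrt)
  then have pos: "R > 0" "T > 0" "T' > 0"
    using s T' by (auto intro: less_le_trans[of 0 "s\<^sup>2"] less_le_trans[of 0 s])
  have "\<bar>1 / T' - 1 / T\<bar> = \<bar>T' - T\<bar> / (T * T')"
    using pos by (simp add: field_simps abs_div abs_minus_commute)
  also have "\<dots> \<le> 3 * k * R / (T * T')"
    using diff pos unfolding R_def by (intro divide_right_mono) auto
  also have "\<dots> = 3 * k / (R * T')"
    using pos R(2)[symmetric] by (simp add: field_simps)
  finally have *: "\<bar>1 / T' - 1 / T\<bar> \<le> 3 * k / (R * T')" .
  have "R * \<bar>1 / T' - 1 / T\<bar> \<le> R * (3 * k / (R * T'))"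
    using * pos by (intro mult_left_mono) auto
  also have "\<dots> = 3 * k / T'"
    using pos by simp
  also have "\<dots> \<le> 3 * k / s\<^sup>2"
    using T' k s pos by (intro divide_left_mono) auto
  finally show "sqrt T * \<bar>1 / T' - 1 / T\<bar> \<le> 3 * k / s\<^sup>2"
    by (simp add: R_def)
  have "s ^ 3 \<le> R * T'"
    using mult_mono[OF R(1) T'] s pos by (simp add: power3_eq_cube power2_eq_square mult.assoc)
  then have "3 * k / (R * T') \<le> 3 * k / s ^ 3"
    using k s pos by (intro divide_left_mono) auto
  with * show "\<bar>1 / T' - 1 / T\<bar> \<le> 3 * k / s ^ 3"
    by linarith
qed

lemma abs_square_diff_le:
  fixes a b c d :: real
  assumes "\<bar>a - b\<bar> \<le> d" "\<bar>a\<bar> \<le> c" "\<bar>b\<bar> \<le> c"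
  shows "\<bar>a\<^sup>2 - b\<^sup>2\<bar> \<le> 2 * c * d"
proof -
  have "\<bar>a\<^sup>2 - b\<^sup>2\<bar> = \<bar>a - b\<bar> * \<bar>a + b\<bar>"
    by (simp add: abs_mult[symmetric] power2_eq_square algebra_simps)
  also have "\<dots> \<le> d * (2 * c)"
    using assms by (intro mult_mono) auto
  finally show ?thesis
    by (simp add: mult_ac)
qed

context psd_form
begin

text \<open>
  The logarithm of the \<open>Q\<close>-distance to the origin, smoothed at the scale \<open>s\<close>, and the data needed to
  control its mean change in one jump of the walk. With \<open>T = radius2 s x\<close>, a jump \<open>z\<close> changes \<open>ln T / 2\<close> by the
  linear term \<open>(x \<bullet> Q z) / T\<close>, which zero drift annihilates, by the second-order term \<open>curvature s z x\<close>, and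
  by an error of order \<open>1 / s ^ 3\<close>, summable over times of order \<open>s\<^sup>2\<close>. In dimension two \<open>bump s\<close> is the
  curvature averaged over the mean jump law: an approximate Dirac mass of height \<open>1 / s\<^sup>2\<close> and width \<open>s\<close>.
\<close>

definition radius2 :: "real \<Rightarrow> 'a \<Rightarrow> real"
  where "radius2 s x = s\<^sup>2 + x \<bullet> Q x"

definition bump :: "real \<Rightarrow> 'a \<Rightarrow> real"
  where "bump s x = s\<^sup>2 / (radius2 s x)\<^sup>2"

definition curvature :: "real \<Rightarrow> 'a \<Rightarrow> 'a \<Rightarrow> real"
  where "curvature s z x = (z \<bullet> Q z) / (2 * radius2 s x) - (x \<bullet> Q z)\<^sup>2 / (radius2 s x)\<^sup>2"

lemma radius2_ge: "s\<^sup>2 \<le> radius2 s x"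
  using form_nonneg[of x] by (simp add: radius2_def)

lemma radius2_pos: "0 < s \<Longrightarrow> 0 < radius2 s x"
  using radius2_ge[of s x] by (simp add: less_le_trans[of 0 "s\<^sup>2"])

lemma sqrt_radius2_ge: "0 < s \<Longrightarrow> s \<le> sqrt (radius2 s x)"
  by (simp add: real_le_rsqrt radius2_ge)

lemma radius2_add: "radius2 s (x + z) = radius2 s x + 2 * (x \<bullet> Q z) + z \<bullet> Q z"
  by (simp add: radius2_def form_add)

lemma cross_le:
  assumes "z \<bullet> Q z \<le> k\<^sup>2" "0 \<le> k"
  shows "\<bar>x \<bullet> Q z\<bar> \<le> k * sqrt (radius2 s x)"
proof (rule power2_le_imp_le)
  have "(x \<bullet> Q z)\<^sup>2 \<le> (x \<bullet> Q x) * (z \<bullet> Q z)"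
    by (rule form_Cauchy_Schwarz)
  also have "\<dots> \<le> radius2 s x * k\<^sup>2"
    using assms form_nonneg by (intro mult_mono) (auto simp: radius2_def)
  finally show "\<bar>x \<bullet> Q z\<bar>\<^sup>2 \<le> (k * sqrt (radius2 s x))\<^sup>2"
    using order_trans[OF zero_le_power2 radius2_ge, of s x] by (simp add: power_mult_distrib mult.commute)
  show "0 \<le> k * sqrt (radius2 s x)"
    using assms order_trans[OF zero_le_power2 radius2_ge, of s x] by simp
qed

lemma cross_jump_le:
  assumes "z \<bullet> Q z \<le> k\<^sup>2" "w \<bullet> Q w \<le> k\<^sup>2"
  shows "\<bar>w \<bullet> Q z\<bar> \<le> k\<^sup>2"
proof -
  have "(w \<bullet> Q z)\<^sup>2 \<le> (w \<bullet> Q w) * (z \<bullet> Q z)"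
    by (rule form_Cauchy_Schwarz)
  also have "\<dots> \<le> k\<^sup>2 * k\<^sup>2"
    using assms form_nonneg by (intro mult_mono) auto
  finally have "(w \<bullet> Q z)\<^sup>2 \<le> (k\<^sup>2)\<^sup>2"
    by (simp add: power2_eq_square)
  then show ?thesis
    using abs_le_square_iff[of "w \<bullet> Q z" "k\<^sup>2"] by simp
qed

lemma radius2_jump_le:
  assumes "z \<bullet> Q z \<le> k\<^sup>2" "0 < k" "k \<le> s"
  shows "\<bar>radius2 s (x + z) - radius2 s x\<bar> \<le> 3 * k * sqrt (radius2 s x)"
proof -
  have "k\<^sup>2 \<le> k * sqrt (radius2 s x)"
    using sqrt_radius2_ge[of s x] assms by (simp add: power2_eq_square)
  then show ?thesis
    using cross_le[of z k x s] form_nonneg[of z] assms by (simp add: radius2_add)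
qed

lemma bump_nonneg: "0 \<le> bump s x"
  by (simp add: bump_def)

lemma bump_eq: "bump s x = (s / radius2 s x)\<^sup>2"
  by (simp add: bump_def power_divide)

lemma s_over_radius2_le: "0 < s \<Longrightarrow> \<bar>s / radius2 s x\<bar> \<le> 1 / s"
  using radius2_ge[of s x] radius2_pos[of s x] by (simp add: field_simps power2_eq_square)

lemma bump_le: "0 < s \<Longrightarrow> bump s x \<le> 1 / s\<^sup>2"
  using power_mono[OF s_over_radius2_le, of s x 2] by (simp add: bump_eq power_divide)

lemma bump_jump_le:
  assumes z: "z \<bullet> Q z \<le> k\<^sup>2" "0 < k" "k \<le> s"
  shows "\<bar>bump s (x + z) - bump s x\<bar> \<le> 6 * k / s ^ 3"
proof -
  have s: "0 < s"
    using z by simp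
  note b = ratio_diff_bounds(1)[OF less_imp_le[OF z(2)] s radius2_ge radius2_ge radius2_jump_le[OF z]]
  have "\<bar>s / radius2 s (x + z) - s / radius2 s x\<bar> = s * \<bar>1 / radius2 s (x + z) - 1 / radius2 s x\<bar>"
    using s abs_mult[of s "1 / radius2 s (x + z) - 1 / radius2 s x"] by (simp add: right_diff_distrib)
  also have "\<dots> \<le> sqrt (radius2 s x) * \<bar>1 / radius2 s (x + z) - 1 / radius2 s x\<bar>"
    by (intro mult_right_mono sqrt_radius2_ge s) simp
  also have "\<dots> \<le> 3 * k / s\<^sup>2"
    by (rule b)
  finally have "\<bar>bump s (x + z) - bump s x\<bar> \<le> 2 * (1 / s) * (3 * k / s\<^sup>2)"
    unfolding bump_eq by (rule abs_square_diff_le) (intro s_over_radius2_le s)+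
  then show ?thesis
    using s by (simp add: power2_eq_square power3_eq_cube mult_ac)
qed

lemma cross_over_radius2_le:
  assumes z: "z \<bullet> Q z \<le> k\<^sup>2" "0 < k" "0 < s"
  shows "\<bar>(x \<bullet> Q z) / radius2 s x\<bar> \<le> k / s"
proof -
  define R where "R = sqrt (radius2 s x)"
  have R: "s \<le> R" "R * R = radius2 s x"
    using sqrt_radius2_ge[OF z(3), of x] radius2_pos[OF z(3), of x] by (auto simp: R_def)
  have "\<bar>(x \<bullet> Q z) / radius2 s x\<bar> \<le> k * R / (R * R)"
    unfolding R(2) abs_divide abs_of_pos[OF radius2_pos[OF z(3)]]
    using cross_le[OF z(1), of x s] z radius2_pos[OF z(3), of x] unfolding R_def[symmetric]
    by (intro divide_right_mono) auto
  also have "\<dots> = k / R"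
    using R z by (simp add: R(2)[symmetric])
  also have "\<dots> \<le> k / s"
    using R z by (intro divide_left_mono) auto
  finally show ?thesis .
qed

lemma curvature_abs_le:
  assumes z: "z \<bullet> Q z \<le> k\<^sup>2" "0 < k" "0 < s"
  shows "\<bar>curvature s z x\<bar> \<le> 2 * k\<^sup>2 / s\<^sup>2"
proof -
  have "(z \<bullet> Q z) / (2 * radius2 s x) \<le> k\<^sup>2 / s\<^sup>2"
    using z radius2_ge[of s x] radius2_pos[OF z(3), of x] form_nonneg[of z]
    by (intro frac_le) auto
  moreover have "0 \<le> (z \<bullet> Q z) / (2 * radius2 s x)"
    using radius2_pos[OF z(3), of x] form_nonneg[of z] by simp
  moreover have "((x \<bullet> Q z) / radius2 s x)\<^sup>2 \<le> (k / s)\<^sup>2"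
    unfolding abs_le_square_iff[symmetric] using cross_over_radius2_le[OF z, of x] z by simp
  moreover have "0 \<le> ((x \<bullet> Q z) / radius2 s x)\<^sup>2"
    by (rule zero_le_power2)
  moreover have "\<bar>a - b\<bar> \<le> 2 * c" if "a \<le> c" "0 \<le> a" "b \<le> c" "0 \<le> b" for a b c :: real
    using that by (auto simp: abs_le_iff)
  ultimately have "\<bar>(z \<bullet> Q z) / (2 * radius2 s x) - ((x \<bullet> Q z) / radius2 s x)\<^sup>2\<bar> \<le> 2 * (k\<^sup>2 / s\<^sup>2)"
    by (simp only: power_divide)
  then show ?thesis
    by (simp add: curvature_def power_divide)
qed

text \<open>
  Each of the two terms of the curvature is of order \<open>1 / s\<^sup>2\<close>, and its change in one jump is of
  order \<open>1 / s ^ 3\<close>. For the second term this is seen from its square root \<open>(x \<bullet> Q z) / T\<close>, of order \<open>1 / s\<close>, whose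
  numerator and denominator are varied separately.
\<close>

lemma curvature_jump_le:
  assumes z: "z \<bullet> Q z \<le> k\<^sup>2" and w: "w \<bullet> Q w \<le> k\<^sup>2" and k: "0 < k" "k \<le> s"
  shows "\<bar>curvature s z (x + w) - curvature s z x\<bar> \<le> 10 * k ^ 3 / s ^ 3"
proof -
  have s: "0 < s"
    using k by simp
  define T T' where "T = radius2 s x" and "T' = radius2 s (x + w)"
  have T: "T > 0" "T' > 0" "s\<^sup>2 \<le> T'"
    unfolding T_def T'_def by (auto intro: radius2_pos s radius2_ge)
  note b = ratio_diff_bounds[OF less_imp_le[OF k(1)] s radius2_ge radius2_ge radius2_jump_le[OF w k], of x, folded T_def T'_def]
  define B B' where "B = x \<bullet> Q z" and "B' = (x + w) \<bullet> Q z"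
  have BB: "B' = B + w \<bullet> Q z"
    by (simp add: B_def B'_def inner_add_left)
  have "B' / T' - B / T = (w \<bullet> Q z) / T' + B * (1 / T' - 1 / T)"
    by (simp add: BB add_divide_distrib right_diff_distrib)
  also have "\<bar>\<dots>\<bar> \<le> \<bar>(w \<bullet> Q z) / T'\<bar> + \<bar>B\<bar> * \<bar>1 / T' - 1 / T\<bar>"
    unfolding abs_mult[symmetric] by (rule abs_triangle_ineq)
  also have "\<bar>(w \<bullet> Q z) / T'\<bar> \<le> k\<^sup>2 / s\<^sup>2"
    unfolding abs_divide using cross_jump_le[OF z w] T s by (intro frac_le) auto
  also have "\<bar>B\<bar> * \<bar>1 / T' - 1 / T\<bar> \<le> (k * sqrt T) * \<bar>1 / T' - 1 / T\<bar>"
    unfolding B_def T_def using k by (intro mult_right_mono cross_le z) auto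
  also have "\<dots> \<le> k * (3 * k / s\<^sup>2)"
    unfolding mult.assoc using b(1) k by (intro mult_left_mono) (auto simp: mult.assoc)
  finally have "\<bar>B' / T' - B / T\<bar> \<le> 4 * k\<^sup>2 / s\<^sup>2"
    by (simp add: power2_eq_square)
  then have 1: "\<bar>(B' / T')\<^sup>2 - (B / T)\<^sup>2\<bar> \<le> 2 * (k / s) * (4 * k\<^sup>2 / s\<^sup>2)"
    unfolding B_def B'_def T_def T'_def
    by (rule abs_square_diff_le) (intro cross_over_radius2_le z k s)+
  have 2: "\<bar>(z \<bullet> Q z) / 2 * (1 / T' - 1 / T)\<bar> \<le> k\<^sup>2 / 2 * (3 * k / s ^ 3)"
    unfolding abs_mult using z form_nonneg[of z] b(2) by (intro mult_mono) auto
  have "curvature s z (x + w) - curvature s z x =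
      (z \<bullet> Q z) / 2 * (1 / T' - 1 / T) - ((B' / T')\<^sup>2 - (B / T)\<^sup>2)"
    unfolding curvature_def T_def T'_def B_def B'_def by (simp add: power_divide right_diff_distrib)
  then have "\<bar>curvature s z (x + w) - curvature s z x\<bar> \<le>
      k\<^sup>2 / 2 * (3 * k / s ^ 3) + 2 * (k / s) * (4 * k\<^sup>2 / s\<^sup>2)"
    using 1 2 by linarith
  also have "\<dots> = (19/2) * (k ^ 3 / s ^ 3)"
    by (simp add: power2_eq_square power3_eq_cube field_simps)
  also have "\<dots> \<le> 10 * (k ^ 3 / s ^ 3)"
    using k s by (intro mult_right_mono) auto
  finally show ?thesis
    by simp
qed

definition potential :: "real \<Rightarrow> 'a \<Rightarrow> real"
  where "potential s x = ln (radius2 s x) / 2"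

text \<open>
  The Taylor expansion of the logarithm to second order. The relative change \<open>u\<close> of the squared radius is
  at most \<open>3 * k / s\<close>, since \<open>T \<ge> s\<^sup>2\<close> and the cross term \<open>x \<bullet> Q z\<close> is at most \<open>k * sqrt T\<close>.
\<close>

lemma potential_jump_le:
  assumes z: "z \<bullet> Q z \<le> k\<^sup>2" "0 < k" "k \<le> s"
  shows "potential s (x + z) - potential s x \<le>
    (x \<bullet> Q z) / radius2 s x + curvature s z x + 6 * k ^ 3 / s ^ 3"
proof -
  have s: "0 < s"
    using z by simp
  define T B a R where "T = radius2 s x" and "B = x \<bullet> Q z" and "a = z \<bullet> Q z" and "R = sqrt T"
  define e where "e = k ^ 3 / s ^ 3"
  have e: "0 \<le> e"
    using z s by (simp add: e_def)
  have T: "T > 0" "radius2 s (x + z) > 0"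
    unfolding T_def by (auto intro: radius2_pos s)
  have R: "s \<le> R" "R * R = T" "R > 0"
    using sqrt_radius2_ge[OF s, of x] T s by (auto simp: R_def T_def)
  define u where "u = (2 * B + a) / T"
  have u1: "1 + u = radius2 s (x + z) / T"
    using T by (simp add: u_def radius2_add T_def[symmetric] B_def a_def field_simps)
  then have "1 + u > 0"
    using T by simp
  then have "ln (1 + u) \<le> u - u\<^sup>2 / 2 + u ^ 3 / 3"
    by (intro ln_one_plus_le_cubic) simp
  moreover have "ln (1 + u) = ln (radius2 s (x + z)) - ln T"
    unfolding u1 using T by (simp add: ln_div)
  ultimately have 1: "potential s (x + z) - potential s x \<le> (u - u\<^sup>2 / 2 + u ^ 3 / 3) / 2"
    unfolding potential_def T_def by (simp add: field_simps)
  have a: "0 \<le> a" "a \<le> k\<^sup>2"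
    using z form_nonneg by (auto simp: a_def)
  have "\<bar>u\<bar> \<le> 3 * k * R / (R * R)"
    unfolding u_def R(2)[symmetric] abs_divide
    using radius2_jump_le[OF z, of x] R
    by (intro frac_le) (auto simp: radius2_add T_def B_def a_def R_def)
  also have "\<dots> = 3 * k / R"
    using R(3) by simp
  also have "\<dots> \<le> 3 * k / s"
    using R s z by (intro divide_left_mono) auto
  finally have "\<bar>u\<bar> ^ 3 \<le> (3 * k / s) ^ 3"
    by (intro power_mono) auto
  then have u3: "u ^ 3 / 3 \<le> 9 * e"
    by (simp add: power_divide power_mult_distrib power_abs[symmetric] abs_le_iff e_def)
  have cross: "\<bar>B * a / T\<^sup>2\<bar> \<le> e"
  proof -
    have "\<bar>B * a / T\<^sup>2\<bar> = \<bar>B / T\<bar> * (a / T)"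
      using a T by (simp add: abs_mult power2_eq_square)
    also have "\<dots> \<le> (k / s) * (k\<^sup>2 / s\<^sup>2)"
      using cross_over_radius2_le[OF z(1,2) s, of x] a T radius2_ge[of s x] s z
      by (intro mult_mono frac_le) (auto simp: B_def T_def)
    finally show ?thesis
      by (simp add: power2_eq_square power3_eq_cube e_def)
  qed
  have "u - u\<^sup>2 / 2 = 2 * (B / T) + 2 * curvature s z x - 2 * (B * a / T\<^sup>2) - (a / T)\<^sup>2 / 2"
    unfolding u_def curvature_def T_def[symmetric] B_def[symmetric] a_def[symmetric]
    using T(1) by (simp add: power2_eq_square field_simps)
  also have "\<dots> \<le> 2 * (B / T) + 2 * curvature s z x + 2 * e"
    using cross zero_le_power2[of "a / T"] by linarith
  finally have "(u - u\<^sup>2 / 2 + u ^ 3 / 3) / 2 \<le> B / T + curvature s z x + (11/2) * e"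
    using u3 by argo
  also have "(11/2) * e \<le> 6 * e"
    using e by simp
  finally show ?thesis
    using 1 unfolding B_def T_def e_def by simp
qed

text \<open>
  The potential is at least \<open>ln s\<close> everywhere and at least \<open>ln s + ln \<Gamma>\<close> outside the \<open>Q\<close>-ball of radius
  \<open>r = \<Gamma> * s\<close>. The factor \<open>4 * r\<^sup>2\<close> makes the bump of scale \<open>r\<close> at least one inside that ball.
\<close>

lemma potential_ge_cutoff:
  assumes s: "0 < s" and \<Gamma>: "1 \<le> \<Gamma>" and r: "r = \<Gamma> * s"
  shows "ln s + ln \<Gamma> * (1 - 4 * r\<^sup>2 * bump r x) \<le> potential s x"
proof -
  have r0: "0 < r"
    using s \<Gamma> r by simp
  have ln\<Gamma>: "0 \<le> ln \<Gamma>"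
    using \<Gamma> by simp
  show ?thesis
  proof (cases "r\<^sup>2 \<le> x \<bullet> Q x")
    case True
    then have "r\<^sup>2 \<le> radius2 s x"
      by (simp add: radius2_def add_increasing)
    then have "ln (r\<^sup>2) \<le> ln (radius2 s x)"
      using r0 radius2_pos[OF s, of x] by (intro ln_mono) auto
    then have "ln s + ln \<Gamma> \<le> potential s x"
      using s \<Gamma> r0 unfolding potential_def r by (simp add: ln_realpow ln_mult)
    moreover have "ln \<Gamma> * (1 - 4 * r\<^sup>2 * bump r x) \<le> ln \<Gamma> * 1"
      by (intro mult_left_mono ln\<Gamma>) (simp add: bump_nonneg)
    ultimately show ?thesis
      by simp
  next
    case False
    then have "radius2 r x \<le> 2 * r\<^sup>2"
      by (simp add: radius2_def)
    then have "(radius2 r x)\<^sup>2 \<le> (2 * r\<^sup>2)\<^sup>2"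
      using radius2_pos[OF r0, of x] by (intro power_mono) auto
    then have "1 \<le> 4 * r\<^sup>2 * bump r x"
      using radius2_pos[OF r0, of x] by (simp add: bump_def field_simps power2_eq_square)
    then have "ln \<Gamma> * (1 - 4 * r\<^sup>2 * bump r x) \<le> 0"
      using ln\<Gamma> by (simp add: mult_nonneg_nonpos)
    moreover have "ln (s\<^sup>2) \<le> ln (radius2 s x)"
      using radius2_ge[of s x] s by (intro ln_mono) (auto intro: radius2_pos)
    then have "ln s \<le> potential s x"
      using s by (simp add: potential_def ln_realpow)
    ultimately show ?thesis
      by linarith
  qed
qed

end

section \<open>Lattice sums in dimension at most two\<close>

lemma real_vec_add: "real_vec (x + y) = real_vec x + real_vec y"
  by (simp add: real_vec_def vec_eq_iff)

lemma real_vec_zero: "real_vec 0 = 0"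
  by (simp add: real_vec_def vec_eq_iff)

text \<open>
  By the mean value theorem, as the left side is the derivative of \<open>\<lambda>a. arctan (a / t)\<close>, which
  decreases for \<open>a \<ge> 0\<close>. Sums of the right side telescope.
\<close>

lemma inverse_quadratic_le_arctan_diff:
  fixes t a :: real
  assumes t: "0 < t" and a: "1 \<le> a"
  shows "t / (t\<^sup>2 + a\<^sup>2) \<le> arctan (a / t) - arctan ((a - 1) / t)"
proof -
  have "\<exists>z. (a - 1) / t < z \<and> z < a / t \<and>
      arctan (a / t) - arctan ((a - 1) / t) = (a / t - (a - 1) / t) * (inverse (1 + z\<^sup>2))"
    by (rule MVT2) (use t in \<open>auto intro: DERIV_arctan simp: divide_strict_right_mono\<close>)
  then obtain z where z: "(a - 1) / t < z" "z < a / t"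
    and eq: "arctan (a / t) - arctan ((a - 1) / t) = (a / t - (a - 1) / t) * (inverse (1 + z\<^sup>2))"
    by blast
  have "0 \<le> (a - 1) / t"
    using t a by simp
  then have "z\<^sup>2 \<le> (a / t)\<^sup>2"
    using z by (intro power_mono) auto
  then have "inverse (1 + (a / t)\<^sup>2) \<le> inverse (1 + z\<^sup>2)"
    by (intro le_imp_inverse_le) (auto intro: add_pos_nonneg)
  then have "(1 / t) * inverse (1 + (a / t)\<^sup>2) \<le> (1 / t) * inverse (1 + z\<^sup>2)"
    using t by (intro mult_left_mono) auto
  moreover have "(1 / t) * inverse (1 + (a / t)\<^sup>2) = t / (t\<^sup>2 + a\<^sup>2)"
    using t by (simp add: field_simps power2_eq_square)
  moreover have "a / t - (a - 1) / t = 1 / t"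
    using t by (simp add: field_simps)
  ultimately show ?thesis
    using eq by simp
qed

lemma sum_inverse_quadratic_le:
  fixes t :: real and A :: "int set"
  assumes t: "0 < t" and A: "finite A"
  shows "(\<Sum>a\<in>A. t / (t\<^sup>2 + (of_int a)\<^sup>2)) \<le> 1 / t + pi"
proof -
  let ?\<phi> = "\<lambda>a::real. t / (t\<^sup>2 + a\<^sup>2)"
  have half: "(\<Sum>k<n. ?\<phi> (real (Suc k))) \<le> pi / 2" for n
  proof -
    have "(\<Sum>k<n. ?\<phi> (real (Suc k))) \<le> (\<Sum>k<n. arctan (real (Suc k) / t) - arctan (real k / t))"
      by (intro sum_mono inverse_quadratic_le_arctan_diff[OF t, THEN order_trans]) simp_all
    also have "\<dots> = arctan (real n / t)"
      by (subst sum_lessThan_telescope[of "\<lambda>k. arctan (real k / t)"]) simp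
    also have "\<dots> \<le> pi / 2"
      using arctan_ubound less_imp_le by blast
    finally show ?thesis .
  qed
  obtain n :: nat where n: "\<And>a. a \<in> A \<Longrightarrow> \<bar>a\<bar> \<le> int n"
  proof -
    have "a \<in> A \<Longrightarrow> \<bar>a\<bar> \<le> int (nat (\<Sum>a\<in>A. \<bar>a\<bar>))" for a
      using A member_le_sum[of a A "\<lambda>a. \<bar>a\<bar>"] by (simp add: sum_nonneg)
    then show ?thesis
      using that by blast
  qed
  have sub: "A \<subseteq> {0} \<union> ((\<lambda>k. int (Suc k)) ` {..<n} \<union> (\<lambda>k. - int (Suc k)) ` {..<n})"
  proof
    fix a assume "a \<in> A"
    then have le: "\<bar>a\<bar> \<le> int n"
      by (rule n)
    consider "a = 0" | "a > 0" | "a < 0"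
      by linarith
    then show "a \<in> {0} \<union> ((\<lambda>k. int (Suc k)) ` {..<n} \<union> (\<lambda>k. - int (Suc k)) ` {..<n})"
    proof cases
      case 2
      then have "a = int (Suc (nat (a - 1)))" "nat (a - 1) < n"
        using le by auto
      then show ?thesis
        by blast
    next
      case 3
      then have "a = - int (Suc (nat (- a - 1)))" "nat (- a - 1) < n"
        using le by auto
      then show ?thesis
        by blast
    qed simp
  qed
  have nn: "0 \<le> ?\<phi> (real_of_int a)" for a
    using t by simp
  have "(\<Sum>a\<in>A. ?\<phi> (of_int a)) \<le>
      (\<Sum>a\<in>{0} \<union> ((\<lambda>k. int (Suc k)) ` {..<n} \<union> (\<lambda>k. - int (Suc k)) ` {..<n}). ?\<phi> (of_int a))"
    by (rule sum_mono2) (use sub nn in auto)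
  also have "\<dots> = ?\<phi> 0 + ((\<Sum>a\<in>(\<lambda>k. int (Suc k)) ` {..<n}. ?\<phi> (of_int a)) + (\<Sum>a\<in>(\<lambda>k. - int (Suc k)) ` {..<n}. ?\<phi> (of_int a)))"
    by (subst sum.union_disjoint, simp, simp, force, subst sum.union_disjoint, simp, simp, force) simp
  also have "\<dots> = ?\<phi> 0 + ((\<Sum>k<n. ?\<phi> (real (Suc k))) + (\<Sum>k<n. ?\<phi> (real (Suc k))))"
    by (subst sum.reindex, force simp: inj_on_def, subst sum.reindex, force simp: inj_on_def)
      (simp add: power2_eq_square algebra_simps)
  also have "\<dots> \<le> 1 / t + (pi / 2 + pi / 2)"
    by (intro add_mono half) (use t in \<open>simp add: power2_eq_square\<close>)
  finally show ?thesis
    by simp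
qed

lemma sum_prod_lattice_le:
  fixes \<phi> :: "int \<Rightarrow> real" and B :: "(int ^ 'd::finite) set"
  assumes nn: "\<And>a. 0 \<le> \<phi> a" and c: "\<And>A. finite A \<Longrightarrow> sum \<phi> A \<le> c" and B: "finite B"
  shows "(\<Sum>y\<in>B. \<Prod>i\<in>UNIV. \<phi> (y $ i)) \<le> c ^ CARD('d)"
proof -
  define A where "A = (\<lambda>(y, i). y $ i) ` (B \<times> UNIV)"
  have A: "finite A"
    unfolding A_def using B by simp
  have "(\<Sum>y\<in>B. \<Prod>i\<in>UNIV. \<phi> (y $ i)) = (\<Sum>f\<in>vec_nth ` B. \<Prod>i\<in>UNIV. \<phi> (f i))"
    by (subst sum.reindex) (auto simp: inj_on_def vec_eq_iff)
  also have "\<dots> \<le> (\<Sum>f\<in>(UNIV::'d set) \<rightarrow>\<^sub>E A. \<Prod>i\<in>UNIV. \<phi> (f i))"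
  proof (rule sum_mono2)
    show "finite (UNIV \<rightarrow>\<^sub>E A :: ('d \<Rightarrow> int) set)"
      using A by (intro finite_PiE) auto
    show "vec_nth ` B \<subseteq> UNIV \<rightarrow>\<^sub>E A"
      by (force simp: A_def)
  qed (auto intro!: prod_nonneg nn)
  also have "\<dots> = (\<Prod>i\<in>(UNIV::'d set). sum \<phi> A)"
    by (subst prod_sum_PiE) (use A in auto)
  also have "\<dots> = sum \<phi> A ^ CARD('d)"
    by simp
  also have "\<dots> \<le> c ^ CARD('d)"
    by (intro power_mono c A sum_nonneg nn)
  finally show ?thesis .
qed

text \<open>
  Dimension at most two enters here: the bump is the square of \<open>s / radius2 s x \<le> 1\<close>, so it can be
  divided among at most two coordinates, with one summable factor for each of them. The bound does not
  depend on the scale \<open>s\<close>.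
\<close>

lemma (in psd_form) sum_bump_le:
  assumes low: "\<mu> > 0" "\<And>x. \<mu> * (x \<bullet> x) \<le> x \<bullet> Q x"
    and emb: "\<And>y. e y \<bullet> e y = (\<Sum>i\<in>UNIV. (real_of_int (y $ i))\<^sup>2)"
    and d: "CARD('d::finite) \<le> 2" and s: "1 \<le> s" and B: "finite B"
  shows "(\<Sum>y\<in>B. bump s (e (y :: int ^ 'd))) \<le> (1 + pi / sqrt \<mu>) ^ CARD('d)"
proof -
  define \<phi> where "\<phi> a = s / (s\<^sup>2 + \<mu> * (real_of_int a)\<^sup>2)" for a
  have den: "s\<^sup>2 \<le> s\<^sup>2 + \<mu> * b\<^sup>2" "0 < s\<^sup>2 + \<mu> * b\<^sup>2" for b
    using low(1) s by (auto intro!: add_pos_nonneg)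
  have nn: "0 \<le> \<phi> a" for a
    using den(2)[of "real_of_int a"] s by (simp add: \<phi>_def)
  have sum\<phi>: "sum \<phi> A \<le> 1 + pi / sqrt \<mu>" if "finite A" for A
  proof -
    define t where "t = s / sqrt \<mu>"
    have t: "0 < t"
      using s low by (simp add: t_def)
    have "\<phi> a = (1 / sqrt \<mu>) * (t / (t\<^sup>2 + (of_int a)\<^sup>2))" for a
    proof -
      define m where "m = sqrt \<mu>"
      have m: "m > 0" "\<mu> = m\<^sup>2"
        using low(1) by (simp_all add: m_def)
      show ?thesis
      proof -
        have "t\<^sup>2 + (of_int a)\<^sup>2 = (s\<^sup>2 + \<mu> * (of_int a)\<^sup>2) / m\<^sup>2"
          using m by (simp add: t_def m_def[symmetric] power_divide add_divide_distrib)
        then show ?thesis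
          using m(1) by (simp add: \<phi>_def t_def m_def[symmetric] power2_eq_square)
      qed
    qed
    then have "sum \<phi> A = (1 / sqrt \<mu>) * (\<Sum>a\<in>A. t / (t\<^sup>2 + (of_int a)\<^sup>2))"
      by (simp add: sum_distrib_left)
    also have "\<dots> \<le> (1 / sqrt \<mu>) * (1 / t + pi)"
      using low by (intro mult_left_mono sum_inverse_quadratic_le t that) simp
    also have "\<dots> = 1 / s + pi / sqrt \<mu>"
      using low s by (simp add: t_def field_simps)
    also have "\<dots> \<le> 1 + pi / sqrt \<mu>"
      using s by simp
    finally show ?thesis .
  qed
  have "bump s (e y) \<le> (\<Prod>i\<in>UNIV. \<phi> (y $ i))" for y :: "int ^ 'd"
  proof -
    let ?T = "\<lambda>i. s\<^sup>2 + \<mu> * (real_of_int (y $ i))\<^sup>2"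
    define R where "R = radius2 s (e y)"
    have "\<mu> * (\<Sum>i\<in>UNIV. (real_of_int (y $ i))\<^sup>2) \<le> e y \<bullet> Q (e y)"
      using low(2)[of "e y"] by (simp add: emb)
    moreover have "(real_of_int (y $ i))\<^sup>2 \<le> (\<Sum>i\<in>UNIV. (real_of_int (y $ i))\<^sup>2)" for i
      by (rule member_le_sum) auto
    ultimately have TR: "?T i \<le> R" for i
      using low(1) unfolding R_def radius2_def
      by (smt (verit, best) mult_left_mono)
    have Rpos: "0 < R"
      using s by (simp add: R_def radius2_pos)
    have sR: "s \<le> R"
    proof -
      have "s \<le> s\<^sup>2"
        using s by (simp add: power2_eq_square)
      then show ?thesis
        using radius2_ge[of s "e y"] by (simp add: R_def)
    qed
    have one: "s / R \<le> \<phi> (y $ i)" for i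
      unfolding \<phi>_def using TR[of i] den(2)[of "real_of_int (y $ i)"] s by (intro divide_left_mono) auto
    have s1: "0 \<le> s / R" "s / R \<le> 1"
      using sR Rpos s by auto
    have "(s / R)\<^sup>2 \<le> (s / R) ^ CARD('d)"
      by (rule power_decreasing[OF d s1])
    also have "\<dots> = (\<Prod>i\<in>(UNIV::'d set). s / R)"
      by simp
    also have "\<dots> \<le> (\<Prod>i\<in>UNIV. \<phi> (y $ i))"
      by (intro prod_mono) (use s1 one in auto)
    finally show ?thesis
      by (simp add: bump_def R_def power_divide)
  qed
  then have "(\<Sum>y\<in>B. bump s (e y)) \<le> (\<Sum>y\<in>B. \<Prod>i\<in>UNIV. \<phi> (y $ i))"
    by (rule sum_mono)
  also have "\<dots> \<le> (1 + pi / sqrt \<mu>) ^ CARD('d)"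
    by (rule sum_prod_lattice_le[OF nn sum\<phi> B])
  finally show ?thesis .
qed

section \<open>Divergence of the Green function\<close>

context bounded_range_environment
begin

text \<open>
  Homogenisation on the diffusive scale: for test functions of scale \<open>s\<close> and height \<open>1 / s\<^sup>2\<close>, the total error
  over times up to \<open>L * s\<^sup>2\<close> is small once \<open>s\<close> is large, uniformly in the test function.
\<close>

lemma walk_mean_average_scaled:
  assumes g: "g \<in> borel_measurable M" "\<And>\<omega>. \<omega> \<in> space M \<Longrightarrow> \<bar>g \<omega>\<bar> \<le> K"
    and e: "0 < e" and L: "0 \<le> L" and c: "0 \<le> c" "0 \<le> d"
  obtains s0 where "1 \<le> s0"
    "\<And>s m \<Phi>. s0 \<le> s \<Longrightarrow> real m \<le> L * s\<^sup>2 \<Longrightarrow> (\<And>x. \<bar>\<Phi> x\<bar> \<le> c / s\<^sup>2) \<Longrightarrow>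
      (\<And>x z. z \<in> \<Lambda> \<Longrightarrow> \<bar>\<Phi> (x + z) - \<Phi> x\<bar> \<le> d / s ^ 3) \<Longrightarrow>
      \<bar>\<Sum>n<m. walk_mean n (\<lambda>\<omega> x. (g \<omega> - (\<integral>\<omega>. g \<omega> \<partial>M)) * \<Phi> x)\<bar> \<le> e"
proof -
  \<comment> \<open>The errors proportional to \<open>\<eta>\<close> do not decay in \<open>s\<close>; this choice makes them at most \<open>e / 2\<close>, and the others are \<open>J / s\<close>.\<close>
  define \<eta> where "\<eta> = e / (2 * (L * c + 1))"
  have Lc: "0 \<le> L * c"
    using L c by simp
  have \<eta>: "\<eta> > 0"
    unfolding \<eta>_def using e Lc by (intro divide_pos_pos) auto
  obtain H where H: "0 \<le> H" and avg: "\<And>\<Phi> C D m. (\<And>x. \<bar>\<Phi> x\<bar> \<le> C) \<Longrightarrow>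
      (\<And>x z. z \<in> \<Lambda> \<Longrightarrow> \<bar>\<Phi> (x + z) - \<Phi> x\<bar> \<le> D) \<Longrightarrow>
      \<bar>\<Sum>n<m. walk_mean n (\<lambda>\<omega> x. (g \<omega> - (\<integral>\<omega>. g \<omega> \<partial>M)) * \<Phi> x)\<bar> \<le> 2 * H * C + real m * H * D + real m * \<eta> * C"
    using walk_mean_average[OF g \<eta>] by blast
  define J where "J = 2 * H * c + L * H * d"
  have J: "0 \<le> J"
    unfolding J_def using H c L by simp
  show thesis
  proof (rule that[of "1 + 2 * J / e"])
    show "1 \<le> 1 + 2 * J / e"
      using J e by simp
    fix s m \<Phi>
    assume s0: "1 + 2 * J / e \<le> s" and m: "real m \<le> L * s\<^sup>2" and \<Phi>: "\<And>x. \<bar>\<Phi> x\<bar> \<le> c / s\<^sup>2"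
      "\<And>x z. z \<in> \<Lambda> \<Longrightarrow> \<bar>\<Phi> (x + z) - \<Phi> x\<bar> \<le> d / s ^ 3"
    have "0 \<le> 2 * J / e"
      using J e by simp
    then have s: "1 \<le> s" "2 * J / e \<le> s"
      using s0 by linarith+
    have "2 * H * (c / s\<^sup>2) \<le> 2 * H * (c / s)"
      using H c s by (intro mult_left_mono divide_left_mono) (auto simp: power2_eq_square)
    moreover have "real m * H * (d / s ^ 3) \<le> (L * s\<^sup>2) * H * (d / s ^ 3)"
      using m H c s by (intro mult_right_mono) auto
    moreover have "(L * s\<^sup>2) * H * (d / s ^ 3) = L * H * d / s"
      using s by (simp add: power2_eq_square power3_eq_cube)
    moreover have "real m * \<eta> * (c / s\<^sup>2) \<le> (L * s\<^sup>2) * \<eta> * (c / s\<^sup>2)"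
      using m \<eta> c s by (intro mult_right_mono) auto
    moreover have "(L * s\<^sup>2) * \<eta> * (c / s\<^sup>2) = \<eta> * (L * c)"
      using s by simp
    moreover have "\<eta> * (L * c) \<le> e / 2"
    proof -
      have "\<eta> * (L * c) \<le> \<eta> * (L * c + 1)"
        using \<eta> by (intro mult_left_mono) auto
      also have "\<dots> = e / 2"
        using Lc by (simp add: \<eta>_def field_simps)
      finally show ?thesis .
    qed
    moreover have "2 * H * (c / s) + L * H * d / s = J / s"
      using s by (simp add: J_def field_simps)
    moreover have "J / s \<le> e / 2"
      using s e by (simp add: field_simps)
    ultimately have "2 * H * (c / s\<^sup>2) + real m * H * (d / s ^ 3) + real m * \<eta> * (c / s\<^sup>2) \<le> e"
      by linarith
    then show "\<bar>\<Sum>n<m. walk_mean n (\<lambda>\<omega> x. (g \<omega> - (\<integral>\<omega>. g \<omega> \<partial>M)) * \<Phi> x)\<bar> \<le> e"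
      using avg[OF \<Phi>, of m] by linarith
  qed
qed

definition mean_jump_prob :: "int ^ 'd \<Rightarrow> real"
  where "mean_jump_prob z = (\<integral>\<omega>. p \<omega> 0 z \<partial>M)"

lemma p_bounded: "\<omega> \<in> space M \<Longrightarrow> \<bar>p \<omega> x y\<bar> \<le> 1"
  using nonneg p_le_one by (simp add: abs_le_iff add_increasing2)

lemma integrable_p: "integrable M (\<lambda>\<omega>. p \<omega> x y)"
  using measurable_env p_bounded by (rule integrable_bounded)

lemma mean_jump_prob_nonneg: "0 \<le> mean_jump_prob z"
  unfolding mean_jump_prob_def by (intro Bochner_Integration.integral_nonneg nonneg)

text \<open>
  Otherwise almost every walk would be confined to the hyperplane orthogonal to \<open>v\<close>, contradicting
  irreducibility.
\<close>

lemma mean_jumps_nondegenerate: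
  assumes "\<And>z. z \<in> \<Lambda> \<Longrightarrow> mean_jump_prob z \<noteq> 0 \<Longrightarrow> real_vec z \<bullet> v = 0"
  shows "v = 0"
proof -
  have "AE \<omega> in M. \<forall>z\<in>\<Lambda>. p \<omega> 0 z \<noteq> 0 \<longrightarrow> real_vec z \<bullet> v = real_vec 0 \<bullet> v"
  proof (rule AE_ball_countable'[OF _ countable_finite[OF finite_jumps]])
    fix z assume z: "z \<in> \<Lambda>"
    show "AE \<omega> in M. p \<omega> 0 z \<noteq> 0 \<longrightarrow> real_vec z \<bullet> v = real_vec 0 \<bullet> v"
    proof (cases "mean_jump_prob z = 0")
      case True
      have "AE \<omega> in M. 0 \<le> p \<omega> 0 z"
        using AE_space by eventually_elim (rule nonneg)
      then have "AE \<omega> in M. p \<omega> 0 z = 0"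
        using True integral_nonneg_eq_0_iff_AE[OF integrable_p] by (simp add: mean_jump_prob_def)
      then show ?thesis
        by eventually_elim simp
    next
      case False
      then show ?thesis
        using assms[OF z] by (simp add: real_vec_zero)
    qed
  qed
  then have "AE \<omega> in M. \<forall>y. real_vec y \<bullet> v = real_vec 0 \<bullet> v"
    by (rule AE_edge_invariant_imp) (simp add: real_vec_add real_vec_zero inner_add_left)
  then have "\<exists>\<omega>::'w. \<forall>y. real_vec y \<bullet> v = real_vec 0 \<bullet> v"
    by (rule eventually_happens'[rotated]) (simp add: ae_filter_eq_bot_iff emeasure_space_1)
  then have y: "real_vec y \<bullet> v = 0" for y
    by (simp add: real_vec_zero)
  show "v = 0"
  proof (rule vec_eq_iff[THEN iffD2], intro allI)
    fix i :: 'd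
    have "real_vec (axis i 1) = axis i 1"
      by (simp add: real_vec_def axis_def vec_eq_iff)
    then show "v $ i = 0 $ i"
      using y[of "axis i 1"] by (simp add: inner_axis')
  qed
qed

text \<open>
  The bound on the time spent at sites with environment in \<open>A\<close> becomes a bound on the whole time
  spent: homogenisation replaces the indicator of \<open>A\<close> by its probability.
\<close>

lemma walk_mean_occupation_bump_le:
  assumes A: "A \<in> sets M" "0 < prob A" and K: "0 \<le> K" "\<And>\<omega> N. \<omega> \<in> A \<Longrightarrow> (\<Sum>n<N. return_prob n \<omega>) \<le> K"
    and Q: "psd_form Q" and c: "\<And>s B. 1 \<le> s \<Longrightarrow> finite B \<Longrightarrow> (\<Sum>y\<in>B. psd_form.bump Q s (real_vec y)) \<le> c"
    and k: "0 < k" "\<And>z. z \<in> \<Lambda> \<Longrightarrow> real_vec z \<bullet> Q (real_vec z) \<le> k\<^sup>2" and L: "0 \<le> L"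
  obtains s0 where "1 \<le> s0" "\<And>s m. s0 \<le> s \<Longrightarrow> real m \<le> L * s\<^sup>2 \<Longrightarrow>
      (\<Sum>n<m. walk_mean n (\<lambda>_ x. psd_form.bump Q s (real_vec x))) \<le> K * c / prob A + 1"
proof -
  interpret psd_form Q by (rule Q)
  let ?I = "indicator A :: 'w \<Rightarrow> real"
  have m1: "?I \<in> borel_measurable M" and b1: "\<bar>?I \<omega>\<bar> \<le> 1" for \<omega>
    using A by (auto simp: indicator_def)
  have c0: "0 \<le> (1::real)" "0 \<le> 6 * k"
    using k by simp_all
  obtain s0 where s0: "1 \<le> s0" and avg: "\<And>s m \<Phi>. s0 \<le> s \<Longrightarrow> real m \<le> L * s\<^sup>2 \<Longrightarrow> (\<And>x. \<bar>\<Phi> x\<bar> \<le> 1 / s\<^sup>2) \<Longrightarrow>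
      (\<And>x z. z \<in> \<Lambda> \<Longrightarrow> \<bar>\<Phi> (x + z) - \<Phi> x\<bar> \<le> (6 * k) / s ^ 3) \<Longrightarrow>
      \<bar>\<Sum>n<m. walk_mean n (\<lambda>\<omega> x. (?I \<omega> - (\<integral>\<omega>. ?I \<omega> \<partial>M)) * \<Phi> x)\<bar> \<le> prob A"
    using walk_mean_average_scaled[OF m1 b1 A(2) L c0] by blast
  show thesis
  proof (rule that[of "max s0 k"])
    show "1 \<le> max s0 k"
      using s0 by simp
    fix s m assume s: "max s0 k \<le> s" and m: "real m \<le> L * s\<^sup>2"
    let ?\<psi> = "\<lambda>x. bump s (real_vec x)"
    have spos: "0 < s" "1 \<le> s"
      using s s0 by auto
    have obs1: "observable (\<lambda>\<omega> x. ?I \<omega> * ?\<psi> x)"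
      by (rule observable_product[OF m1 b1])
    have obs2: "observable (\<lambda>\<omega> x. (?I \<omega> - prob A) * ?\<psi> x)"
    proof (rule observable_product[where B="1 + prob A"])
      show "(\<lambda>\<omega>. ?I \<omega> - prob A) \<in> borel_measurable M"
        by (intro borel_measurable_diff m1 borel_measurable_const)
      show "\<bar>?I \<omega> - prob A\<bar> \<le> 1 + prob A" for \<omega>
        using prob_le_1[of A] by (auto simp: indicator_def)
    qed
    have split: "prob A * walk_mean n (\<lambda>_ x. ?\<psi> x) =
      walk_mean n (\<lambda>\<omega> x. ?I \<omega> * ?\<psi> x) - walk_mean n (\<lambda>\<omega> x. (?I \<omega> - prob A) * ?\<psi> x)" for n
    proof -
      have "walk_mean n (\<lambda>\<omega> x. ?I \<omega> * ?\<psi> x) =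
        walk_mean n (\<lambda>\<omega> x. prob A * ?\<psi> x + (?I \<omega> - prob A) * ?\<psi> x)"
        by (simp add: algebra_simps)
      also have "\<dots> = prob A * walk_mean n (\<lambda>_ x. ?\<psi> x) + walk_mean n (\<lambda>\<omega> x. (?I \<omega> - prob A) * ?\<psi> x)"
        by (subst walk_mean_add) (auto intro: observable_scale observable_function obs2 simp: walk_mean_scale)
      finally show ?thesis
        by simp
    qed
    have "\<bar>\<Sum>n<m. walk_mean n (\<lambda>\<omega> x. (?I \<omega> - (\<integral>\<omega>. ?I \<omega> \<partial>M)) * ?\<psi> x)\<bar> \<le> prob A"
    proof (rule avg)
      show "\<bar>?\<psi> x\<bar> \<le> 1 / s\<^sup>2" for x
        using bump_le[OF spos(1)] bump_nonneg by simp
      show "\<bar>?\<psi> (x + z) - ?\<psi> x\<bar> \<le> (6 * k) / s ^ 3" if "z \<in> \<Lambda>" for x z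
        unfolding real_vec_add by (rule bump_jump_le[OF k(2)[OF that] k(1)]) (use s in simp)
    qed (use s m in auto)
    then have err: "\<bar>\<Sum>n<m. walk_mean n (\<lambda>\<omega> x. (?I \<omega> - prob A) * ?\<psi> x)\<bar> \<le> prob A"
      using A by simp
    have "(\<Sum>n<m. walk_mean n (\<lambda>\<omega> x. ?I \<omega> * ?\<psi> x)) \<le> K * c"
      by (rule walk_mean_occupation_le[OF A(1) K(2) K(1) bump_nonneg c[OF spos(2)]])
    with err have "prob A * (\<Sum>n<m. walk_mean n (\<lambda>_ x. ?\<psi> x)) \<le> K * c + prob A"
      unfolding sum_distrib_left split sum_subtractf by linarith
    then show "(\<Sum>n<m. walk_mean n (\<lambda>_ x. ?\<psi> x)) \<le> K * c / prob A + 1"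
      using A(2) by (simp add: field_simps)
  qed
qed

text \<open>
  The expected potential grows at most by the expected time spent in the bump. Zero drift removes the
  linear term of each jump; homogenisation replaces the jump probabilities in the second-order term by their
  means, and then that term equals \<open>(d / 2) / T - q / T\<^sup>2\<close> with \<open>T = s\<^sup>2 + q\<close>, which is at most
  \<open>s\<^sup>2 / T\<^sup>2\<close> since \<open>d \<le> 2\<close>.
\<close>

lemma walk_mean_potential_le:
  assumes d: "CARD('d) \<le> 2" and Q: "psd_form Q"
    and energy: "\<And>x. (\<Sum>z\<in>\<Lambda>. mean_jump_prob z * (x \<bullet> Q (real_vec z))\<^sup>2) = x \<bullet> Q x"
    and trace: "(\<Sum>z\<in>\<Lambda>. mean_jump_prob z * (real_vec z \<bullet> Q (real_vec z))) = real CARD('d)"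
    and k: "0 < k" "\<And>z. z \<in> \<Lambda> \<Longrightarrow> real_vec z \<bullet> Q (real_vec z) \<le> k\<^sup>2" and L: "0 \<le> L"
  obtains s0 where "1 \<le> s0" "\<And>s m. s0 \<le> s \<Longrightarrow> real m \<le> L * s\<^sup>2 \<Longrightarrow>
      walk_mean m (\<lambda>_ x. psd_form.potential Q s (real_vec x)) \<le>
        ln s + (\<Sum>n<m. walk_mean n (\<lambda>_ x. psd_form.bump Q s (real_vec x))) + 1"
proof -
  interpret psd_form Q by (rule Q)
  let ?\<Phi> = "\<lambda>s z x. curvature s (real_vec z) (real_vec x)"
  define e where "e = 1 / (2 * (real (card \<Lambda>) + 1))"
  have e: "0 < e"
    by (simp add: e_def)
  have "\<exists>s0\<ge>1. \<forall>s m \<Phi>. s0 \<le> s \<longrightarrow> real m \<le> L * s\<^sup>2 \<longrightarrow> (\<forall>x. \<bar>\<Phi> x\<bar> \<le> (2 * k\<^sup>2) / s\<^sup>2) \<longrightarrow>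
      (\<forall>x w. w \<in> \<Lambda> \<longrightarrow> \<bar>\<Phi> (x + w) - \<Phi> x\<bar> \<le> (10 * k ^ 3) / s ^ 3) \<longrightarrow>
      \<bar>\<Sum>n<m. walk_mean n (\<lambda>\<omega> x. (p \<omega> 0 z - mean_jump_prob z) * \<Phi> x)\<bar> \<le> e" for z
    unfolding mean_jump_prob_def
    by (rule walk_mean_average_scaled[OF measurable_env p_bounded e L, of "2 * k\<^sup>2" "10 * k ^ 3" 0 z]) (use k in auto)
  then obtain S where S: "\<And>z. 1 \<le> S z" and avg: "\<And>z s m \<Phi>. S z \<le> s \<Longrightarrow> real m \<le> L * s\<^sup>2 \<Longrightarrow>
      (\<And>x. \<bar>\<Phi> x\<bar> \<le> (2 * k\<^sup>2) / s\<^sup>2) \<Longrightarrow> (\<And>x w. w \<in> \<Lambda> \<Longrightarrow> \<bar>\<Phi> (x + w) - \<Phi> x\<bar> \<le> (10 * k ^ 3) / s ^ 3) \<Longrightarrow>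
      \<bar>\<Sum>n<m. walk_mean n (\<lambda>\<omega> x. (p \<omega> 0 z - mean_jump_prob z) * \<Phi> x)\<bar> \<le> e"
    by metis
  \<comment> \<open>Beyond every scale \<open>S z\<close>, and large enough for the Taylor errors of \<open>L * s\<^sup>2\<close> steps to add up to at most \<open>1 / 2\<close>.\<close>
  define s0 where "s0 = (\<Sum>z\<in>\<Lambda>. S z) + 1 + k + 12 * L * k ^ 3"
  have S0: "0 \<le> S z" for z
    using S[of z] by linarith
  have s0: "1 \<le> s0" "k \<le> s0" "12 * L * k ^ 3 \<le> s0"
    using k(1) L sum_nonneg[of \<Lambda> S, OF S0] by (auto simp: s0_def add_nonneg_nonneg)
  have s0S: "S z \<le> s0" if "z \<in> \<Lambda>" for z
  proof -
    have "S z \<le> (\<Sum>z\<in>\<Lambda>. S z)"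
      by (rule member_le_sum[OF that S0 finite_jumps])
    moreover have "0 \<le> 12 * L * k ^ 3"
      using k(1) L by simp
    ultimately show ?thesis
      using k(1) unfolding s0_def by linarith
  qed
  show thesis
  proof (rule that[OF s0(1)])
    fix s m assume s: "s0 \<le> s" and m: "real m \<le> L * s\<^sup>2"
    have spos: "0 < s" "1 \<le> s" "k \<le> s"
      using s s0 by auto
    let ?U = "\<lambda>x. potential s (real_vec x)" and ?\<psi> = "\<lambda>x. bump s (real_vec x)"
    let ?F = "\<lambda>z \<omega> x. p \<omega> 0 z * ?\<Phi> s z x"
    let ?G = "\<lambda>z \<omega> x. (p \<omega> 0 z - mean_jump_prob z) * ?\<Phi> s z x"
    define \<epsilon> where "\<epsilon> = 6 * k ^ 3 / s ^ 3"
    have obsF: "observable (?F z)" for z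
      by (rule observable_product[OF measurable_env p_bounded])
    have obsG: "observable (?G z)" for z
      by (rule observable_product[where B="1 + \<bar>mean_jump_prob z\<bar>"])
        (use measurable_env p_bounded in \<open>auto intro: order_trans[OF abs_triangle_ineq4]\<close>)
    have obsU: "observable (\<lambda>_. ?U)" and obs\<psi>: "observable (\<lambda>_. ?\<psi>)" and obs\<epsilon>: "observable (\<lambda>_ _. \<epsilon>)"
      by (rule observable_function)+
    have obsS: "observable (\<lambda>\<omega> x. \<Sum>z\<in>\<Lambda>. ?F z \<omega> x)" and obsSG: "observable (\<lambda>\<omega> x. \<Sum>z\<in>\<Lambda>. ?G z \<omega> x)"
      by (intro observable_sum finite_jumps obsF obsG)+
    have ptw: "step (\<lambda>_. ?U) \<omega> x \<le> ?U x + ((\<Sum>z\<in>\<Lambda>. ?F z \<omega> x) + \<epsilon>)" if w: "\<omega> \<in> space M" for \<omega> x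
    proof -
      have one: "(\<Sum>z\<in>\<Lambda>. p \<omega> 0 z) = 1"
        using row_sum_jumps[OF w, of 0] by simp
      have drift: "(\<Sum>z\<in>\<Lambda>. p \<omega> 0 z * (real_vec x \<bullet> Q (real_vec z))) = 0"
      proof -
        have "(\<Sum>z\<in>\<Lambda>. p \<omega> 0 z * (real_vec x \<bullet> Q (real_vec z))) =
          real_vec x \<bullet> Q (\<Sum>z\<in>\<Lambda>. p \<omega> 0 z *\<^sub>R real_vec z)"
          by (simp add: linear_sum[OF linear_form] linear_cmul[OF linear_form] inner_sum_right)
        then show ?thesis
          using drift_jumps[OF w] by (simp add: linear_0[OF linear_form])
      qed
      have "step (\<lambda>_. ?U) \<omega> x = (\<Sum>z\<in>\<Lambda>. p \<omega> 0 z * ?U (x + z))"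
        by (simp add: step_def)
      also have "\<dots> \<le> (\<Sum>z\<in>\<Lambda>. p \<omega> 0 z * (?U x + (real_vec x \<bullet> Q (real_vec z)) / radius2 s (real_vec x) + ?\<Phi> s z x + \<epsilon>))"
      proof (intro sum_mono mult_left_mono nonneg w)
        fix z assume z: "z \<in> \<Lambda>"
        show "?U (x + z) \<le> ?U x + (real_vec x \<bullet> Q (real_vec z)) / radius2 s (real_vec x) + ?\<Phi> s z x + \<epsilon>"
          using potential_jump_le[OF k(2)[OF z] k(1) spos(3), of "real_vec x"]
          unfolding real_vec_add \<epsilon>_def by linarith
      qed
      also have "\<dots> = (\<Sum>z\<in>\<Lambda>. p \<omega> 0 z) * (?U x + \<epsilon>) +
          (\<Sum>z\<in>\<Lambda>. p \<omega> 0 z * (real_vec x \<bullet> Q (real_vec z))) / radius2 s (real_vec x) + (\<Sum>z\<in>\<Lambda>. ?F z \<omega> x)"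
        by (simp add: sum_distrib_right sum_divide_distrib sum.distrib distrib_left)
      finally show ?thesis
        unfolding drift one by simp
    qed
    have incr: "walk_mean (Suc n) (\<lambda>_. ?U) \<le> walk_mean n (\<lambda>_. ?U) + walk_mean n (\<lambda>\<omega> x. \<Sum>z\<in>\<Lambda>. ?F z \<omega> x) + \<epsilon>" for n
    proof -
      have "walk_mean (Suc n) (\<lambda>_. ?U) \<le> walk_mean n (\<lambda>\<omega> x. ?U x + ((\<Sum>z\<in>\<Lambda>. ?F z \<omega> x) + \<epsilon>))"
        unfolding walk_mean_Suc
        by (intro walk_mean_mono observable_step observable_add obsU obsS obs\<epsilon> ptw)
      also have "\<dots> = walk_mean n (\<lambda>_. ?U) + walk_mean n (\<lambda>\<omega> x. \<Sum>z\<in>\<Lambda>. ?F z \<omega> x) + \<epsilon>"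
        by (simp add: walk_mean_add observable_add obsU obsS obs\<epsilon> walk_mean_const)
      finally show ?thesis .
    qed
    have mean\<Phi>: "(\<Sum>z\<in>\<Lambda>. mean_jump_prob z * ?\<Phi> s z x) \<le> ?\<psi> x" for x
    proof -
      define T q where "T = radius2 s (real_vec x)" and "q = real_vec x \<bullet> Q (real_vec x)"
      have T: "T > 0" "T = s\<^sup>2 + q"
        using radius2_pos[OF spos(1)] by (simp_all add: T_def q_def radius2_def)
      have q: "0 \<le> q"
        by (simp add: q_def form_nonneg)
      have "(\<Sum>z\<in>\<Lambda>. mean_jump_prob z * ?\<Phi> s z x) =
        (\<Sum>z\<in>\<Lambda>. mean_jump_prob z * (real_vec z \<bullet> Q (real_vec z))) / (2 * T) -
        (\<Sum>z\<in>\<Lambda>. mean_jump_prob z * (real_vec x \<bullet> Q (real_vec z))\<^sup>2) / T\<^sup>2"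
        unfolding curvature_def T_def by (simp add: right_diff_distrib sum_subtractf sum_divide_distrib)
      also have "\<dots> = real CARD('d) / (2 * T) - q / T\<^sup>2"
        unfolding energy trace q_def ..
      also have "\<dots> \<le> 2 / (2 * T) - q / T\<^sup>2"
        using d T(1) by (intro diff_right_mono divide_right_mono) auto
      also have "\<dots> = (T - q) / T\<^sup>2"
        using T(1) by (simp add: diff_divide_distrib power2_eq_square)
      finally show ?thesis
        using T by (simp add: bump_def T_def)
    qed
    have second: "walk_mean n (\<lambda>\<omega> x. \<Sum>z\<in>\<Lambda>. ?F z \<omega> x) \<le> walk_mean n (\<lambda>_. ?\<psi>) + (\<Sum>z\<in>\<Lambda>. walk_mean n (?G z))" for n
    proof -
      have "walk_mean n (\<lambda>\<omega> x. \<Sum>z\<in>\<Lambda>. ?F z \<omega> x) \<le> walk_mean n (\<lambda>\<omega> x. ?\<psi> x + (\<Sum>z\<in>\<Lambda>. ?G z \<omega> x))"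
      proof (intro walk_mean_mono obsS observable_add obs\<psi> obsSG)
        fix \<omega> x
        have "(\<Sum>z\<in>\<Lambda>. ?F z \<omega> x) = (\<Sum>z\<in>\<Lambda>. mean_jump_prob z * ?\<Phi> s z x) + (\<Sum>z\<in>\<Lambda>. ?G z \<omega> x)"
          by (simp add: sum.distrib[symmetric] algebra_simps)
        then show "(\<Sum>z\<in>\<Lambda>. ?F z \<omega> x) \<le> ?\<psi> x + (\<Sum>z\<in>\<Lambda>. ?G z \<omega> x)"
          using mean\<Phi>[of x] by simp
      qed
      also have "\<dots> = walk_mean n (\<lambda>_. ?\<psi>) + (\<Sum>z\<in>\<Lambda>. walk_mean n (?G z))"
        by (simp add: walk_mean_add obs\<psi> obsSG walk_mean_sum finite_jumps obsG)
      finally show ?thesis .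
    qed
    have "walk_mean m (\<lambda>_. ?U) \<le> walk_mean 0 (\<lambda>_. ?U) + (\<Sum>n<m. walk_mean n (\<lambda>_. ?\<psi>) + (\<Sum>z\<in>\<Lambda>. walk_mean n (?G z)) + \<epsilon>)"
    proof (induction m)
      case (Suc m)
      then show ?case
        using incr[of m] second[of m] by simp
    qed simp
    also have "walk_mean 0 (\<lambda>_. ?U) = ln s"
      using spos by (simp add: walk_mean_const walk_mean_0 potential_def radius2_def real_vec_zero ln_realpow prob_space)
    also have "(\<Sum>n<m. walk_mean n (\<lambda>_. ?\<psi>) + (\<Sum>z\<in>\<Lambda>. walk_mean n (?G z)) + \<epsilon>) =
        (\<Sum>n<m. walk_mean n (\<lambda>_. ?\<psi>)) + (\<Sum>z\<in>\<Lambda>. \<Sum>n<m. walk_mean n (?G z)) + real m * \<epsilon>"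
      by (simp add: sum.distrib sum.swap[of _ \<Lambda>])
    also have "(\<Sum>z\<in>\<Lambda>. \<Sum>n<m. walk_mean n (?G z)) \<le> (\<Sum>z\<in>\<Lambda>. e)"
    proof (rule sum_mono)
      fix z assume z: "z \<in> \<Lambda>"
      have "\<bar>\<Sum>n<m. walk_mean n (?G z)\<bar> \<le> e"
      proof (rule avg)
        show "S z \<le> s"
          using s0S[OF z] s by linarith
        show "\<bar>?\<Phi> s z x\<bar> \<le> 2 * k\<^sup>2 / s\<^sup>2" for x
          by (rule curvature_abs_le[OF k(2)[OF z] k(1) spos(1)])
        show "\<bar>?\<Phi> s z (x + w) - ?\<Phi> s z x\<bar> \<le> 10 * k ^ 3 / s ^ 3" if "w \<in> \<Lambda>" for x w
          unfolding real_vec_add by (rule curvature_jump_le[OF k(2)[OF z] k(2)[OF that] k(1) spos(3)])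
      qed (rule m)
      then show "(\<Sum>n<m. walk_mean n (?G z)) \<le> e"
        by linarith
    qed
    also have "(\<Sum>z\<in>\<Lambda>. e) \<le> 1 / 2"
      by (simp add: e_def field_simps)
    also have "real m * \<epsilon> \<le> 1 / 2"
    proof -
      have "real m * \<epsilon> \<le> (L * s\<^sup>2) * \<epsilon>"
        using m k spos by (intro mult_right_mono) (auto simp: \<epsilon>_def)
      also have "\<dots> = 6 * L * k ^ 3 / s"
        using spos by (simp add: \<epsilon>_def power2_eq_square power3_eq_cube)
      also have "\<dots> \<le> 1 / 2"
        using s0(3) s spos by (simp add: field_simps)
      finally show ?thesis .
    qed
    finally show "walk_mean m (\<lambda>_ x. ?U x) \<le> ln s + (\<Sum>n<m. walk_mean n (\<lambda>_ x. ?\<psi> x)) + 1"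
      by simp
  qed
qed

lemma real_vec_inner_self: "real_vec y \<bullet> real_vec y = (\<Sum>i\<in>UNIV. (real_of_int (y $ i))\<^sup>2)"
  by (simp add: real_vec_def inner_vec_def power2_eq_square)

text \<open>
  If the Green function were bounded on a set \<open>A\<close> of positive probability, the time spent in a bump of scale
  \<open>s\<close> during times of order \<open>s\<^sup>2\<close> would be at most \<open>\<beta>\<close> at every large scale. Consider \<open>N\<close> steps, a fixed large
  multiple \<open>8 * \<beta>\<close> of \<open>r\<^sup>2\<close>. The bound at the scale \<open>r\<close> says that on average the walk spends at least half of these steps outside
  the \<open>Q\<close>-ball of radius \<open>r\<close>, where the potential of scale \<open>s = r / \<Gamma>\<close> is at least \<open>ln s + ln \<Gamma>\<close>. The bound at the scale
  \<open>s\<close> says that the mean potential is at most \<open>ln s + \<beta> + 1\<close>. These are incompatible for large \<open>\<Gamma>\<close>.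
\<close>

lemma bounded_returns_null:
  assumes d: "CARD('d) \<le> 2" and A: "A \<in> sets M"
    and K: "0 \<le> K" "\<And>\<omega> N. \<omega> \<in> A \<Longrightarrow> (\<Sum>n<N. return_prob n \<omega>) \<le> K"
  shows "prob A = 0"
proof (rule ccontr)
  assume "prob A \<noteq> 0"
  then have pA: "0 < prob A"
    by (simp add: zero_less_measure_iff)
  obtain Q \<mu> where Q: "psd_form Q"
    and energy: "\<And>x. (\<Sum>z\<in>\<Lambda>. mean_jump_prob z * (x \<bullet> Q (real_vec z))\<^sup>2) = x \<bullet> Q x"
    and trace: "(\<Sum>z\<in>\<Lambda>. mean_jump_prob z * (real_vec z \<bullet> Q (real_vec z))) = real DIM(real ^ 'd)"
    and \<mu>: "\<mu> > 0" "\<And>x. \<mu> * (x \<bullet> x) \<le> x \<bullet> Q x"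
    using inverse_covariance[where w=real_vec and c=mean_jump_prob, OF finite_jumps mean_jump_prob_nonneg mean_jumps_nondegenerate]
    by blast
  have trace': "(\<Sum>z\<in>\<Lambda>. mean_jump_prob z * (real_vec z \<bullet> Q (real_vec z))) = real CARD('d)"
    using trace by simp
  interpret psd_form Q by (rule Q)
  define c where "c = (1 + pi / sqrt \<mu>) ^ CARD('d)"
  have c: "(\<Sum>y\<in>B. bump s (real_vec y)) \<le> c" if "1 \<le> s" "finite B" for s and B :: "(int ^ 'd) set"
    unfolding c_def by (rule sum_bump_le[OF \<mu> real_vec_inner_self d that])
  \<comment> \<open>The summand one gives \<open>1 \<le> k\<close>, so that \<open>k\<^sup>2\<close> also bounds the squared lengths.\<close>
  define k where "k = 1 + (\<Sum>z\<in>\<Lambda>. real_vec z \<bullet> Q (real_vec z))"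
  have k1: "1 \<le> k"
    unfolding k_def by (simp add: sum_nonneg form_nonneg)
  have k: "real_vec z \<bullet> Q (real_vec z) \<le> k\<^sup>2" if "z \<in> \<Lambda>" for z
  proof -
    have "real_vec z \<bullet> Q (real_vec z) \<le> k"
      unfolding k_def using member_le_sum[OF that, of "\<lambda>z. real_vec z \<bullet> Q (real_vec z)"] finite_jumps
      by (simp add: form_nonneg add_increasing)
    also have "k \<le> k\<^sup>2"
      using k1 by (simp add: power2_eq_square)
    finally show ?thesis .
  qed
  define \<beta> where "\<beta> = K * c / prob A + 1"
  have "0 \<le> c"
    using c[of 1 "{}"] by simp
  then have \<beta>: "1 \<le> \<beta>"
    using K(1) pA by (simp add: \<beta>_def)
  \<comment> \<open>The contradiction needs \<open>ln \<Gamma> / 2 > \<beta> + 1\<close>.\<close>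
  define \<Gamma> where "\<Gamma> = exp (2 * (\<beta> + 2))"
  have \<Gamma>: "1 \<le> \<Gamma>" and ln\<Gamma>: "ln \<Gamma> = 2 * (\<beta> + 2)"
    using \<beta> by (simp_all add: \<Gamma>_def)
  \<comment> \<open>Chosen so that \<open>N \<le> 8 * \<beta> * r\<^sup>2 + 1\<close> is at most \<open>L * s\<^sup>2\<close>.\<close>
  define L where "L = 8 * \<beta> * \<Gamma>\<^sup>2 + 1"
  have L: "0 \<le> L"
    using \<beta> by (simp add: L_def)
  have k0: "0 < k"
    using k1 by simp
  obtain s1 where s1: "1 \<le> s1" and occ: "\<And>s m. s1 \<le> s \<Longrightarrow> real m \<le> L * s\<^sup>2 \<Longrightarrow>
      (\<Sum>n<m. walk_mean n (\<lambda>_ x. bump s (real_vec x))) \<le> \<beta>"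
    unfolding \<beta>_def using walk_mean_occupation_bump_le[OF A pA K Q c k0 k L] by blast
  obtain s2 where s2: "1 \<le> s2" and pot: "\<And>s m. s2 \<le> s \<Longrightarrow> real m \<le> L * s\<^sup>2 \<Longrightarrow>
      walk_mean m (\<lambda>_ x. potential s (real_vec x)) \<le>
        ln s + (\<Sum>n<m. walk_mean n (\<lambda>_ x. bump s (real_vec x))) + 1"
    using walk_mean_potential_le[OF d Q energy trace' k0 k L] by blast
  define s r where "s = max s1 s2" and "r = \<Gamma> * s"
  have s: "1 \<le> s" "s1 \<le> s" "s2 \<le> s"
    using s1 by (auto simp: s_def)
  have rs: "s \<le> r"
    using \<Gamma> s by (simp add: r_def)
  have r2: "s\<^sup>2 \<le> r\<^sup>2"
    using rs s by (intro power_mono) auto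
  define N where "N = nat \<lceil>8 * \<beta> * r\<^sup>2\<rceil>"
  have x0: "0 \<le> 8 * \<beta> * r\<^sup>2"
    using \<beta> by simp
  have N: "8 * \<beta> * r\<^sup>2 \<le> real N" "real N \<le> 8 * \<beta> * r\<^sup>2 + 1"
    unfolding N_def using x0 by linarith+
  have NL: "real N \<le> L * s\<^sup>2"
  proof -
    have "1 \<le> s\<^sup>2"
      using s(1) by simp
    then show ?thesis
      using N(2) by (simp add: L_def r_def power_mult_distrib algebra_simps)
  qed
  have Npos: "0 < real N"
  proof -
    have "0 < 8 * \<beta> * r\<^sup>2"
      using \<beta> rs s by simp
    then show ?thesis
      using N(1) by linarith
  qed
  let ?u = "\<lambda>n. walk_mean n (\<lambda>_ x. potential s (real_vec x))"
  let ?b = "\<lambda>n. walk_mean n (\<lambda>_ x. bump r (real_vec x))"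
  have upper: "?u n \<le> ln s + \<beta> + 1" if "n < N" for n
  proof -
    have "real n \<le> L * s\<^sup>2"
      using that NL by linarith
    then show ?thesis
      using pot[OF s(3)] occ[OF s(2)] by fastforce
  qed
  have lower: "ln s + ln \<Gamma> - (4 * r\<^sup>2 * ln \<Gamma>) * ?b n \<le> ?u n" for n
  proof -
    have "walk_mean n (\<lambda>_ x. (ln s + ln \<Gamma>) + (- (4 * r\<^sup>2 * ln \<Gamma>)) * bump r (real_vec x)) \<le> ?u n"
    proof (intro walk_mean_mono observable_function)
      show "ln s + ln \<Gamma> + - (4 * r\<^sup>2 * ln \<Gamma>) * bump r (real_vec x) \<le> potential s (real_vec x)" for x
        using potential_ge_cutoff[of s \<Gamma> r "real_vec x"] s \<Gamma> by (simp add: r_def algebra_simps)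
    qed
    also have "walk_mean n (\<lambda>_ x. (ln s + ln \<Gamma>) + (- (4 * r\<^sup>2 * ln \<Gamma>)) * bump r (real_vec x)) =
      (ln s + ln \<Gamma>) + (- (4 * r\<^sup>2 * ln \<Gamma>)) * ?b n"
      by (simp only: walk_mean_add observable_function observable_scale walk_mean_scale walk_mean_const)
    finally show ?thesis
      by simp
  qed
  have "(\<Sum>n<N. ?b n) \<le> \<beta>"
  proof (rule occ)
    show "s1 \<le> r"
      using s rs by linarith
    have "L * s\<^sup>2 \<le> L * r\<^sup>2"
      by (intro mult_left_mono r2 L)
    then show "real N \<le> L * r\<^sup>2"
      using NL by linarith
  qed
  then have "(4 * r\<^sup>2 * ln \<Gamma>) * (\<Sum>n<N. ?b n) \<le> (4 * r\<^sup>2 * ln \<Gamma>) * \<beta>"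
    using \<Gamma> by (intro mult_left_mono) auto
  also have "\<dots> = (ln \<Gamma> / 2) * (8 * \<beta> * r\<^sup>2)"
    by simp
  also have "\<dots> \<le> (ln \<Gamma> / 2) * real N"
    using N(1) \<Gamma> by (intro mult_left_mono) auto
  finally have bsum: "(4 * r\<^sup>2 * ln \<Gamma>) * (\<Sum>n<N. ?b n) \<le> real N * (ln \<Gamma> / 2)"
    by (simp add: mult_ac)
  have "(\<Sum>n<N. ln s + ln \<Gamma> - (4 * r\<^sup>2 * ln \<Gamma>) * ?b n) \<le> (\<Sum>n<N. ln s + \<beta> + 1)"
    by (rule sum_mono, rule order_trans[OF lower upper]) simp
  then have "real N * (ln s + ln \<Gamma>) - (4 * r\<^sup>2 * ln \<Gamma>) * (\<Sum>n<N. ?b n) \<le> real N * (ln s + \<beta> + 1)"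
    by (simp add: sum_subtractf sum_distrib_left)
  then have "real N * (ln s + ln \<Gamma>) - real N * (ln \<Gamma> / 2) \<le> real N * (ln s + \<beta> + 1)"
    using bsum by linarith
  then have "real N * (ln \<Gamma> / 2) \<le> real N * (\<beta> + 1)"
    by (simp add: algebra_simps)
  then show False
    using Npos by (simp add: ln\<Gamma>)
qed

text \<open>
  The environments with a finite Green function form a countable union of the null sets on which it is bounded by an integer.
\<close>

lemma AE_not_summable_return_prob:
  assumes d: "CARD('d) \<le> 2"
  shows "AE \<omega> in M. \<not> summable (\<lambda>n. return_prob n \<omega>)"
proof -
  have obs: "observable ((step ^^ n) (\<lambda>_ x. of_bool (x = 0)))" for n
    by (intro observable_iter observable_function)
  have [measurable]: "return_prob n \<in> borel_measurable M" for n
    using obs[of n] unfolding observable_def return_prob_def[abs_def] by blast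
  have nn: "0 \<le> return_prob n \<omega>" if "\<omega> \<in> space M" for n \<omega>
    using iter_mono[of "\<lambda>_ _. 0" "\<lambda>_ x. of_bool (x = 0)" \<omega> n 0] that
    by (simp add: return_prob_def iter_zero)
  define A where "A k = {\<omega> \<in> space M. \<forall>N. (\<Sum>n<N. return_prob n \<omega>) \<le> real k}" for k :: nat
  have A: "A k \<in> sets M" for k
    unfolding A_def by measurable
  have "AE \<omega> in M. \<forall>k. \<omega> \<notin> A k"
  proof (subst AE_all_countable, intro allI)
    fix k
    have "prob (A k) = 0"
      by (rule bounded_returns_null[OF d A, of "real k"]) (auto simp: A_def)
    then show "AE \<omega> in M. \<omega> \<notin> A k"
      by (simp add: prob_eq_0[OF A])
  qed
  with AE_space show ?thesis
  proof eventually_elim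
    case (elim \<omega>)
    show ?case
    proof
      assume sum: "summable (\<lambda>n. return_prob n \<omega>)"
      obtain k :: nat where "suminf (\<lambda>n. return_prob n \<omega>) \<le> real k"
        using real_arch_simple by blast
      then have "(\<Sum>n<N. return_prob n \<omega>) \<le> real k" for N
        using sum_le_suminf[OF sum, of "{..<N}"] nn elim(1) by fastforce
      then show False
        using elim by (auto simp: A_def)
    qed
  qed
qed

end

section \<open>Recurrence from a divergent Green function\<close>

locale bounded_jump_chain =
  fixes P :: "int ^ 'd::finite \<Rightarrow> int ^ 'd \<Rightarrow> real" and \<Lambda> :: "(int ^ 'd) set"
  assumes P_nonneg: "\<And>x y. 0 \<le> P x y"
    and P_row_sum: "\<And>x. (P x has_sum 1) UNIV"
    and finite_jump_set: "finite \<Lambda>"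
    and P_jumps: "\<And>x y. y - x \<notin> \<Lambda> \<Longrightarrow> P x y = 0"
begin

sublocale walk: prob_space "walk_law P"
  by (rule prob_space_walk_law)

lemma sum_jump_probs: "(\<Sum>z\<in>\<Lambda>. P x (x + z)) = 1"
  by (rule sum_translate_eq_has_sum[OF P_row_sum finite_jump_set P_jumps])

lemma measurable_position [measurable]: "(\<lambda>X. X k) \<in> walk_law P \<rightarrow>\<^sub>M count_space UNIV"
  unfolding measurable_cong_sets[OF sets_walk_law refl] by (rule measurable_component_singleton) simp

lemma pred_position [measurable]: "Measurable.pred (walk_law P) (\<lambda>X. R (X k))"
  by (rule measurable_compose[OF measurable_position]) simp

lemma space_walk [simp]: "space (walk_law P) = UNIV"
  by (rule space_walk_law)

definition cylinder :: "nat \<Rightarrow> (nat \<Rightarrow> int ^ 'd) \<Rightarrow> (nat \<Rightarrow> int ^ 'd) set"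
  where "cylinder n u = {X. \<forall>k\<le>n. X k = u k}"

text \<open>
  The event \<open>S\<close> is decided by the positions up to time \<open>n\<close>: it is a union of cylinders.
\<close>

definition known_at :: "nat \<Rightarrow> (nat \<Rightarrow> int ^ 'd) set \<Rightarrow> bool"
  where "known_at n S \<longleftrightarrow> (\<forall>X\<in>S. cylinder n X \<subseteq> S)"

lemma cylinder_sets: "cylinder n u \<in> sets (walk_law P)"
proof -
  have "{X \<in> space (walk_law P). \<forall>k\<le>n. X k = u k} \<in> sets (walk_law P)"
    by measurable
  then show ?thesis
    by (simp add: cylinder_def)
qed

lemma known_at_position: "k \<le> n \<Longrightarrow> known_at n {X. R (X k)}"
  by (auto simp: known_at_def cylinder_def)

lemma known_at_Int_Suc: "known_at n S \<Longrightarrow> known_at (Suc n) (S \<inter> {X. R (X (Suc n))})"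
proof -
  assume S: "known_at n S"
  have "Y \<in> S \<inter> {X. R (X (Suc n))}" if X: "X \<in> S" "R (X (Suc n))" and Y: "Y \<in> cylinder (Suc n) X" for X Y
  proof -
    have "Y \<in> cylinder n X" "Y (Suc n) = X (Suc n)"
      using Y by (simp_all add: cylinder_def)
    then show ?thesis
      using S X unfolding known_at_def by auto
  qed
  then show ?thesis
    unfolding known_at_def by blast
qed

lemma known_at_Union_cylinders:
  assumes "known_at n S"
  obtains U where "countable U" "S = (\<Union>u\<in>U. cylinder n u)" "disjoint_family_on (cylinder n) U" "U \<subseteq> (\<lambda>X. restrict X {..n}) ` S"
proof
  let ?U = "(\<lambda>X. restrict X {..n}) ` S"
  have "countable ({..n} \<rightarrow>\<^sub>E (UNIV :: (int ^ 'd) set))"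
    by (intro countable_PiE) auto
  moreover have "?U \<subseteq> {..n} \<rightarrow>\<^sub>E UNIV"
    by (rule image_subsetI) (simp add: PiE_def)
  ultimately show "countable ?U"
    by (rule countable_subset[rotated])
  have "cylinder n (restrict X {..n}) = cylinder n X" for X
    by (auto simp: cylinder_def)
  then have "(\<Union>u\<in>?U. cylinder n u) = (\<Union>X\<in>S. cylinder n X)"
    by simp
  moreover have "X \<in> cylinder n X" for X
    by (simp add: cylinder_def)
  ultimately show "S = (\<Union>u\<in>?U. cylinder n u)"
    using assms unfolding known_at_def by blast
  show "disjoint_family_on (cylinder n) ?U"
  proof (clarsimp simp: disjoint_family_on_def)
    fix X Y :: "nat \<Rightarrow> int ^ 'd" assume ne: "restrict X {..n} \<noteq> restrict Y {..n}"
    show "cylinder n (restrict X {..n}) \<inter> cylinder n (restrict Y {..n}) = {}"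
    proof (rule ccontr)
      assume "\<not> ?thesis"
      then obtain Z where "Z \<in> cylinder n (restrict X {..n})" "Z \<in> cylinder n (restrict Y {..n})"
        by blast
      then have Z: "Z k = X k" "Z k = Y k" if "k \<le> n" for k
        using that by (simp_all add: cylinder_def)
      have "restrict X {..n} = restrict Y {..n}"
        by (rule restrict_ext) (metis Z atMost_iff)
      with ne show False ..
    qed
  qed
qed simp

lemma known_at_sets:
  assumes "known_at n S"
  shows "S \<in> sets (walk_law P)"
proof -
  obtain U where U: "countable U" "S = (\<Union>u\<in>U. cylinder n u)"
    using assms by (rule known_at_Union_cylinders)
  show ?thesis
    unfolding U(2) using U(1) by (rule sets.countable_UN') (use cylinder_sets in auto)
qed

text \<open>
  The Markov property, first for a cylinder, then for the countable disjoint union of cylinders that \<open>S\<close> is.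
\<close>

lemma prob_next_position:
  assumes S: "known_at n S" and x: "S \<subseteq> {X. X n = x}"
  shows "walk.prob (S \<inter> {X. X (Suc n) = y}) = walk.prob S * P x y"
proof -
  obtain U where U: "countable U" and eq: "S = (\<Union>u\<in>U. cylinder n u)"
    and disj: "disjoint_family_on (cylinder n) U" and US: "U \<subseteq> (\<lambda>X. restrict X {..n}) ` S"
    using known_at_Union_cylinders[OF S] .
  let ?C = "\<lambda>u. cylinder (Suc n) (u(Suc n := y))"
  have C_eq: "?C u = cylinder n u \<inter> {X. X (Suc n) = y}" for u
    by (auto simp: cylinder_def le_Suc_eq)
  have C: "emeasure (walk_law P) (?C u) = emeasure (walk_law P) (cylinder n u) * ennreal (P x y)" if u: "u \<in> U" for u
  proof -
    obtain X where "X \<in> S" "u = restrict X {..n}"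
      using u US by blast
    then have "u n = x"
      using x by auto
    moreover have "{X. \<forall>k\<le>n. X k = (u(Suc n := y)) k} = cylinder n u"
      by (auto simp: cylinder_def)
    ultimately have "walk.prob (?C u) = walk.prob (cylinder n u) * P x y"
      using walk_law_step[where p=P and n=n and x="u(Suc n := y)", OF P_nonneg P_row_sum] by (simp add: cylinder_def)
    then show ?thesis
      by (simp add: walk.emeasure_eq_measure ennreal_mult P_nonneg)
  qed
  have "emeasure (walk_law P) (S \<inter> {X. X (Suc n) = y}) = emeasure (walk_law P) (\<Union>u\<in>U. ?C u)"
    unfolding C_eq by (rule arg_cong[where f="emeasure (walk_law P)"]) (auto simp: eq)
  also have "\<dots> = (\<integral>\<^sup>+u. emeasure (walk_law P) (?C u) \<partial>count_space U)"
  proof (rule emeasure_UN_countable[OF cylinder_sets U])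
    show "disjoint_family_on ?C U"
      unfolding C_eq using disj by (auto simp: disjoint_family_on_def)
  qed
  also have "\<dots> = (\<integral>\<^sup>+u. emeasure (walk_law P) (cylinder n u) * ennreal (P x y) \<partial>count_space U)"
    by (rule nn_integral_cong) (simp add: C)
  also have "\<dots> = (\<integral>\<^sup>+u. emeasure (walk_law P) (cylinder n u) \<partial>count_space U) * ennreal (P x y)"
    by (rule nn_integral_multc) simp
  also have "(\<integral>\<^sup>+u. emeasure (walk_law P) (cylinder n u) \<partial>count_space U) = emeasure (walk_law P) S"
    unfolding eq by (rule emeasure_UN_countable[OF cylinder_sets U disj, symmetric])
  finally show ?thesis
    by (simp add: walk.emeasure_eq_measure ennreal_mult[symmetric] P_nonneg)
qed

text \<open>
  The next position is almost surely one of the finitely many \<open>x + z\<close>, because their probabilities add up to one.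
\<close>

lemma prob_split_next_position:
  assumes S: "known_at n S" and x: "S \<subseteq> {X. X n = x}" and E: "E \<in> sets (walk_law P)"
  shows "walk.prob (S \<inter> E) = (\<Sum>z\<in>\<Lambda>. walk.prob (S \<inter> {X. X (Suc n) = x + z} \<inter> E))"
proof -
  let ?N = "\<lambda>z. {X. X (Suc n) = x + z}"
  have Sm: "S \<in> sets (walk_law P)"
    by (rule known_at_sets[OF S])
  have Nm: "?N z \<in> sets (walk_law P)" for z
    by (rule known_at_sets[OF known_at_position[of "Suc n" "Suc n"]]) simp
  have U: "walk.prob (\<Union>z\<in>\<Lambda>. S \<inter> ?N z \<inter> F) = (\<Sum>z\<in>\<Lambda>. walk.prob (S \<inter> ?N z \<inter> F))" if F: "F \<in> sets (walk_law P)" for F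
    by (rule walk.finite_measure_finite_Union)
      (use finite_jump_set Sm Nm F in \<open>auto simp: disjoint_family_on_def intro: sets.Int\<close>)
  let ?J = "\<Union>z\<in>\<Lambda>. S \<inter> ?N z \<inter> UNIV"
  have Jm: "?J \<in> sets (walk_law P)"
    using finite_jump_set Sm Nm by (intro sets.finite_UN) (auto intro: sets.Int)
  have "walk.prob ?J = walk.prob S"
  proof -
    have "walk.prob ?J = (\<Sum>z\<in>\<Lambda>. walk.prob (S \<inter> ?N z))"
      using U[of UNIV] sets.top[of "walk_law P"] by simp
    also have "\<dots> = walk.prob S * (\<Sum>z\<in>\<Lambda>. P x (x + z))"
      by (simp add: prob_next_position[OF S x] sum_distrib_left)
    finally show ?thesis
      by (simp add: sum_jump_probs)
  qed
  then have null: "walk.prob (S - ?J) = 0"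
    using walk.finite_measure_Diff[OF Sm Jm] by auto
  have "walk.prob (S \<inter> E) = walk.prob ((S \<inter> E) \<inter> ?J) + walk.prob ((S \<inter> E) - ?J)"
  proof -
    have "S \<inter> E \<in> sets (walk_law P)"
      using Sm E by auto
    then show ?thesis
      using walk.finite_measure_Union[of "(S \<inter> E) \<inter> ?J" "(S \<inter> E) - ?J"] Jm
      by (simp add: Int_Diff_Un sets.Int sets.Diff Int_Diff_disjoint)
  qed
  moreover have "walk.prob ((S \<inter> E) - ?J) \<le> walk.prob (S - ?J)"
    by (rule walk.finite_measure_mono) (use Sm Jm in auto)
  then have "walk.prob ((S \<inter> E) - ?J) = 0"
    using null measure_nonneg[of "walk_law P" "(S \<inter> E) - ?J"] by linarith
  moreover have "(S \<inter> E) \<inter> ?J = (\<Union>z\<in>\<Lambda>. S \<inter> ?N z \<inter> E)"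
    by auto
  ultimately show ?thesis
    using U[OF E] by simp
qed

primrec hit_prob :: "nat \<Rightarrow> int ^ 'd \<Rightarrow> real"
  where "hit_prob 0 x = of_bool (x = 0)"
  | "hit_prob (Suc k) x = (\<Sum>z\<in>\<Lambda>. P x (x + z) * hit_prob k (x + z))"

primrec avoid_prob :: "nat \<Rightarrow> int ^ 'd \<Rightarrow> real"
  where "avoid_prob 0 x = 1"
  | "avoid_prob (Suc m) x = (\<Sum>z\<in>\<Lambda>. P x (x + z) * (of_bool (x + z \<noteq> 0) * avoid_prob m (x + z)))"

definition avoids :: "nat \<Rightarrow> nat \<Rightarrow> (nat \<Rightarrow> int ^ 'd) set"
  where "avoids n m = {X. \<forall>k. n < k \<and> k \<le> n + m \<longrightarrow> X k \<noteq> 0}"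

lemma avoids_sets: "avoids n m \<in> sets (walk_law P)"
proof -
  have "{X \<in> space (walk_law P). \<forall>k. n < k \<and> k \<le> n + m \<longrightarrow> X k \<noteq> 0} \<in> sets (walk_law P)"
    by measurable
  then show ?thesis
    by (simp add: avoids_def)
qed

lemma prob_hit:
  assumes "known_at n S" "S \<subseteq> {X. X n = x}"
  shows "walk.prob (S \<inter> {X. X (n + k) = 0}) = walk.prob S * hit_prob k x"
  using assms
proof (induction k arbitrary: n S x)
  case 0
  show ?case
  proof (cases "x = 0")
    case True
    then have "S \<inter> {X. X (n + 0) = 0} = S"
      using 0 by auto
    then show ?thesis
      using True by simp
  next
    case False
    then have "S \<inter> {X. X (n + 0) = 0} = {}"
      using 0 by auto
    then show ?thesis
      using False by simp
  qed
next
  case (Suc k)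
  have "walk.prob (S \<inter> {X. X (n + Suc k) = 0}) =
    (\<Sum>z\<in>\<Lambda>. walk.prob (S \<inter> {X. X (Suc n) = x + z} \<inter> {X. X (n + Suc k) = 0}))"
    by (rule prob_split_next_position[OF Suc.prems]) (rule known_at_sets[OF known_at_position[OF order_refl]])
  also have "\<dots> = (\<Sum>z\<in>\<Lambda>. walk.prob (S \<inter> {X. X (Suc n) = x + z}) * hit_prob k (x + z))"
  proof (rule sum.cong[OF refl])
    fix z
    show "walk.prob (S \<inter> {X. X (Suc n) = x + z} \<inter> {X. X (n + Suc k) = 0}) =
      walk.prob (S \<inter> {X. X (Suc n) = x + z}) * hit_prob k (x + z)"
      using Suc.IH[OF known_at_Int_Suc[OF Suc.prems(1)], of "\<lambda>y. y = x + z" "x + z"] by simp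
  qed
  also have "\<dots> = walk.prob S * hit_prob (Suc k) x"
    by (simp add: prob_next_position[OF Suc.prems] sum_distrib_left mult.assoc)
  finally show ?case .
qed

lemma prob_avoid:
  assumes "known_at n S" "S \<subseteq> {X. X n = x}"
  shows "walk.prob (S \<inter> avoids n m) = walk.prob S * avoid_prob m x"
  using assms
proof (induction m arbitrary: n S x)
  case 0
  have "avoids n 0 = UNIV"
    by (auto simp: avoids_def)
  then show ?case
    by simp
next
  case (Suc m)
  have "walk.prob (S \<inter> avoids n (Suc m)) =
    (\<Sum>z\<in>\<Lambda>. walk.prob (S \<inter> {X. X (Suc n) = x + z} \<inter> avoids n (Suc m)))"
    by (rule prob_split_next_position[OF Suc.prems avoids_sets])
  also have "\<dots> = (\<Sum>z\<in>\<Lambda>. walk.prob (S \<inter> {X. X (Suc n) = x + z}) * (of_bool (x + z \<noteq> 0) * avoid_prob m (x + z)))"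
  proof (rule sum.cong[OF refl])
    fix z
    have split: "avoids n (Suc m) = {X. X (Suc n) \<noteq> 0} \<inter> avoids (Suc n) m"
    proof -
      have "n < k \<and> k \<le> n + Suc m \<longleftrightarrow> k = Suc n \<or> Suc n < k \<and> k \<le> Suc n + m" for k
        by arith
      then show ?thesis
        unfolding avoids_def by auto
    qed
    show "walk.prob (S \<inter> {X. X (Suc n) = x + z} \<inter> avoids n (Suc m)) =
      walk.prob (S \<inter> {X. X (Suc n) = x + z}) * (of_bool (x + z \<noteq> 0) * avoid_prob m (x + z))"
    proof (cases "x + z = 0")
      case True
      then have "S \<inter> {X. X (Suc n) = x + z} \<inter> avoids n (Suc m) = {}"
        unfolding split by auto
      then show ?thesis
        using True by simp
    next
      case False
      then have "S \<inter> {X. X (Suc n) = x + z} \<inter> avoids n (Suc m) = S \<inter> {X. X (Suc n) = x + z} \<inter> avoids (Suc n) m"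
        unfolding split by auto
      then show ?thesis
        using False Suc.IH[OF known_at_Int_Suc[OF Suc.prems(1)], of "\<lambda>y. y = x + z" "x + z"] by simp
    qed
  qed
  also have "\<dots> = walk.prob S * avoid_prob (Suc m) x"
    by (simp add: prob_next_position[OF Suc.prems] sum_distrib_left mult.assoc)
  finally show ?case .
qed

lemma hit_prob_nonneg: "0 \<le> hit_prob k x"
  by (induction k arbitrary: x) (auto intro!: sum_nonneg mult_nonneg_nonneg P_nonneg)

lemma prob_at_origin: "walk.prob {X. X n = 0} = hit_prob n 0"
proof -
  have S: "known_at 0 {X. X 0 = 0}"
    by (rule known_at_position) simp
  have m: "{X. X k = 0} \<in> sets (walk_law P)" for k
    by (rule known_at_sets[OF known_at_position[OF order_refl]])
  have "walk.prob ({X. X 0 = 0} \<inter> {X. X n = 0}) = hit_prob n 0"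
    using prob_hit[OF S, of 0 n] walk_law_start[of P] by simp
  moreover have "AE X in walk_law P. X 0 = 0"
    using walk.AE_prob_1[OF walk_law_start] by simp
  then have "walk.prob ({X. X 0 = 0} \<inter> {X. X n = 0}) = walk.prob {X. X n = 0}"
    by (intro walk.finite_measure_eq_AE) (use m in auto)
  ultimately show ?thesis
    by simp
qed

text \<open>
  Last-exit decomposition. By the Markov property the last visit to the origin happens at time \<open>n\<close> with
  probability \<open>hit_prob n 0 * e\<close>, where \<open>e\<close> is the probability of never returning. These events are disjoint, so
  \<open>e\<close> times the Green function is at most one. As the Green function diverges, \<open>e = 0\<close>, and almost
  surely there is no last visit.
\<close>

lemma AE_infinitely_many_returns:
  assumes "\<not> summable (\<lambda>n. hit_prob n 0)"
  shows "AE X in walk_law P. infinite {n. X n = 0}"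
proof -
  define last where "last n = {X. X n = 0} \<inter> (\<Inter>m. avoids n m)" for n
  have last_sets: "last n \<in> sets (walk_law P)" for n
    unfolding last_def
    by (intro sets.Int known_at_sets[OF known_at_position[OF order_refl]] sets.countable_INT') (auto simp: avoids_sets)
  have lim: "(\<lambda>m. hit_prob n 0 * avoid_prob m 0) \<longlonglongrightarrow> walk.prob (last n)" for n
  proof -
    let ?A = "\<lambda>m. {X. X n = 0} \<inter> avoids n m"
    have "(\<lambda>m. walk.prob (?A m)) \<longlonglongrightarrow> walk.prob (\<Inter>m. ?A m)"
    proof (rule walk.finite_Lim_measure_decseq)
      show "range ?A \<subseteq> sets (walk_law P)"
        using avoids_sets known_at_sets[OF known_at_position[OF order_refl, of n]] by auto
      show "decseq ?A"
        by (auto simp: decseq_def avoids_def)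
    qed
    moreover have "walk.prob (?A m) = hit_prob n 0 * avoid_prob m 0" for m
      using prob_avoid[OF known_at_position[OF order_refl, of n "\<lambda>x. x = 0"], of 0 m] by (simp add: prob_at_origin)
    moreover have "(\<Inter>m. ?A m) = last n"
      by (auto simp: last_def)
    ultimately show ?thesis
      by simp
  qed
  define e where "e = walk.prob (last 0)"
  have "(\<lambda>m. avoid_prob m 0) \<longlonglongrightarrow> e"
    using lim[of 0] by (simp add: e_def)
  then have last_prob: "walk.prob (last n) = hit_prob n 0 * e" for n
    using LIMSEQ_unique[OF lim[of n] tendsto_mult_left] by blast
  have disj: "disjoint_family last"
  proof -
    have "last i \<inter> last j = {}" if "i < j" for i j
    proof -
      have "X \<notin> last i" if "X \<in> last j" for X
      proof
        assume "X \<in> last i"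
        then have "X \<in> avoids i (j - i)"
          by (simp add: last_def)
        then have "X j \<noteq> 0"
          using \<open>i < j\<close> by (simp add: avoids_def)
        then show False
          using that by (simp add: last_def)
      qed
      then show ?thesis
        by blast
    qed
    then show ?thesis
      unfolding disjoint_family_on_def by (metis Int_commute linorder_neqE_nat)
  qed
  have "e = 0"
  proof (rule ccontr)
    assume "e \<noteq> 0"
    then have e: "0 < e"
      by (simp add: e_def zero_less_measure_iff)
    have "(\<Sum>n<N. hit_prob n 0) \<le> 1 / e" for N
    proof -
      have "(\<Sum>n<N. hit_prob n 0) * e = walk.prob (\<Union>n<N. last n)"
        by (subst walk.finite_measure_finite_Union)
          (use last_sets disj in \<open>auto simp: last_prob sum_distrib_right disjoint_family_on_def\<close>)
      also have "\<dots> \<le> 1"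
        by simp
      finally show ?thesis
        using e by (simp add: field_simps)
    qed
    then have "summable (\<lambda>n. hit_prob n 0)"
      by (intro bounded_imp_summable[of _ "1 / e"] hit_prob_nonneg) (metis lessThan_Suc_atMost)
    with assms show False
      by simp
  qed
  then have "walk.prob (last n) = 0" for n
    by (simp add: last_prob)
  then have "AE X in walk_law P. \<forall>n. X \<notin> last n"
    by (subst AE_all_countable) (simp add: walk.prob_eq_0[OF last_sets])
  moreover have "AE X in walk_law P. X 0 = 0"
    using walk.AE_prob_1[OF walk_law_start] by simp
  ultimately show ?thesis
  proof eventually_elim
    case (elim X)
    show ?case
    proof
      assume fin: "finite {n. X n = 0}"
      define n where "n = Max {n. X n = 0}"
      have "X n = 0"
        using Max_in[OF fin] elim(2) unfolding n_def by blast
      moreover have "X k \<noteq> 0" if "n < k" for k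
        using Max_ge[OF fin, of k] that unfolding n_def by auto
      ultimately have "X \<in> last n"
        by (auto simp: last_def avoids_def)
      then show False
        using elim(1) by blast
    qed
  qed
qed

end

context bounded_range_environment
begin

lemma bounded_jump_chain_environment:
  assumes w: "\<omega> \<in> space M"
  shows "bounded_jump_chain (p \<omega>) \<Lambda>"
  by unfold_locales (use nonneg[OF w] row_sum[OF w] finite_jumps jumps[OF w] in auto)

lemma return_prob_eq_hit_prob:
  assumes w: "\<omega> \<in> space M"
  shows "return_prob n \<omega> = bounded_jump_chain.hit_prob (p \<omega>) \<Lambda> n 0"
proof -
  interpret chain: bounded_jump_chain "p \<omega>" \<Lambda>
    by (rule bounded_jump_chain_environment[OF w])
  have "(step ^^ n) (\<lambda>_ x. of_bool (x = 0)) (\<tau> a \<omega>) a = chain.hit_prob n a" for a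
  proof (induction n arbitrary: a)
    case (Suc n)
    show ?case
      using w Suc by (simp add: step_def covariance action_add[symmetric] add.commute)
  qed simp
  from this[of 0] show ?thesis
    using w by (simp add: return_prob_def action_zero)
qed

lemma AE_recurrent:
  assumes "CARD('d) \<le> 2"
  shows "AE \<omega> in M. AE X in walk_law (p \<omega>). infinite {n. X n = 0}"
  using AE_not_summable_return_prob[OF assms] AE_space
proof eventually_elim
  case (elim \<omega>)
  then show ?case
    by (intro bounded_jump_chain.AE_infinitely_many_returns[OF bounded_jump_chain_environment])
      (simp_all add: return_prob_eq_hit_prob)
qed

end

theorem theorem4p5:
  fixes M :: "'w measure"
    and \<tau> :: "int ^ 'd::finite \<Rightarrow> 'w \<Rightarrow> 'w"
    and p :: "'w \<Rightarrow> int ^ 'd \<Rightarrow> int ^ 'd \<Rightarrow> real"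
  assumes "random_environment M \<tau> p"
    and "CARD('d) \<le> 2"
  shows "AE \<omega> in M. AE X in walk_law (p \<omega>).
           \<exists>r :: nat \<Rightarrow> nat. strict_mono r \<and> (\<forall>j. X (r j) = 0)"
proof -
  interpret random_environment M \<tau> p
    by (rule assms(1))
  obtain \<Lambda> where "finite \<Lambda>" "\<forall>\<omega>\<in>space M. \<forall>x y. y - x \<notin> \<Lambda> \<longrightarrow> p \<omega> x y = 0"
    using finite_range by blast
  then interpret bounded_range_environment M \<tau> p \<Lambda>
    by unfold_locales auto
  show ?thesis
    using AE_recurrent[OF assms(2)]
  proof eventually_elim
    case (elim \<omega>)
    then show ?case
    proof eventually_elim
      case (elim X)
      then show ?case
        using infinite_enumerate[OF elim] by auto
    qed
  qed
qed

end
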